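(* Let $k$ be a number field and let $S$ be the set of archimedean places of $k$ (a pair of complex conjugate embeddings counts as one place). Let $P\in\mathbb{P}^n(k)$ be any $k$-rational point. Then there is a constant $N(P)$ such that the following holds for every positive real number $c$. If $\{P_i\}$ is any sequence of $k$-rational points of $\mathbb{P}^n$ such that for all $i$ $$\Big(\sum_{v\in S}\mathrm{dist}_v(P,P_i)\Big)H(P_i)\le c,$$ then the set $\{P_i\}$ is a subset of the finite union of lines through $P$ of Plücker height at most $N(P)c$. (The constant $N(P)$ does not depend on $c$.)
   Context: $H$ is the standard absolute multiplicative Weil height on $\mathbb{P}^n(k)$. For $v\in S$, $\mathrm{dist}_v$ denotes the local distance function on $\mathbb{P}^n(k)$ induced by $v$, where $|\cdot|_v$ extends the usual absolute value on $\mathbb{Q}$; concretely one may take $\mathrm{dist}_v([x],[y])=\max_{i<j}|x_iy_j-x_jy_i|_v/(\max_i|x_i|_v\max_j|y_j|_v)$; other choices differ by a multiplicative function bounded away from $0$ and $\infty$. The Plücker height of a line is the absolute multiplicative height of its Plücker coordinate vector, and lines are taken over $k$.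
   Formalization: The sequence is assumed not to be constantly equal to P: for P_i = P the left side is 0, yet for small c there are no lines of Plücker height at most N(P)c, so the claim as stated fails in that case. *)

theory Defs
  imports "HOL-Computational_Algebra.Polynomial" "HOL-Analysis.Cartesian_Space" "HOL-Algebra.QuotRing" "HOL-Algebra.Ideal_Product"
begin

definition number_field :: "'k::field_char_0 itself \<Rightarrow> bool" where
  "number_field _ \<longleftrightarrow>
     (\<exists>B::'k set. finite B \<and> module.span (\<lambda>(q::rat) x. of_rat q * x) B = UNIV)"

definition field_degree :: "'k::field_char_0 itself \<Rightarrow> nat" where
  "field_degree _ = vector_space.dim (\<lambda>(q::rat) (x::'k). of_rat q * x) UNIV"


subsection \<open>Archimedean places\<close>

definition complex_embeddings :: "('k::field_char_0 \<Rightarrow> complex) set" where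
  "complex_embeddings =
     {\<sigma>. \<sigma> 1 = 1 \<and> (\<forall>x y. \<sigma> (x + y) = \<sigma> x + \<sigma> y) \<and> (\<forall>x y. \<sigma> (x * y) = \<sigma> x * \<sigma> y)}"

text \<open>An archimedean place is identified with the absolute value on the field that represents
  it and extends the usual absolute value of the rationals.  Complex conjugate embeddings induce
  the same function and hence count as one place.\<close>

definition arch_places :: "('k::field_char_0 \<Rightarrow> real) set" where
  "arch_places = (\<lambda>\<sigma> x. cmod (\<sigma> x)) ` complex_embeddings"

text \<open>The degree of the completion over the reals: 1 for real places, 2 for complex ones.\<close>

definition arch_local_degree :: "('k::field_char_0 \<Rightarrow> real) \<Rightarrow> nat" where
  "arch_local_degree v =
     (if \<exists>\<sigma>\<in>complex_embeddings. range \<sigma> \<subseteq> \<real> \<and> v = (\<lambda>x. cmod (\<sigma> x)) then 1 else 2)"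


subsection \<open>Non-archimedean places\<close>

definition integer_ring :: "'k::field_char_0 ring" where
  "integer_ring =
     \<lparr>carrier = {x. algebraic_int x}, mult = (*), one = 1, zero = 0, add = (+)\<rparr>"

text \<open>A non-archimedean place is identified with a nonzero prime ideal of the ring of
  integers.\<close>

definition finite_places :: "'k::field_char_0 set set" where
  "finite_places = {\<pp>. primeideal \<pp> integer_ring \<and> \<pp> \<noteq> {0}}"

definition integral_ord :: "'k::field_char_0 set \<Rightarrow> 'k \<Rightarrow> nat" where
  "integral_ord \<pp> a = (GREATEST m::nat. a \<in> \<pp> [^]\<^bsub>ideals_set integer_ring\<^esub> m)"

text \<open>The order at a prime of a nonzero element of the field: write it as a quotient of nonzero
  integers; the difference of orders does not depend on the quotient chosen.\<close>

definition prime_ord :: "'k::field_char_0 set \<Rightarrow> 'k \<Rightarrow> int" where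
  "prime_ord \<pp> x =
     (THE m. \<exists>a\<in>carrier integer_ring. \<exists>b\<in>carrier integer_ring.
        a \<noteq> 0 \<and> b \<noteq> 0 \<and> x = a / b \<and> m = int (integral_ord \<pp> a) - int (integral_ord \<pp> b))"

definition ideal_norm :: "'k::field_char_0 set \<Rightarrow> nat" where
  "ideal_norm \<pp> = card (carrier (integer_ring Quot \<pp>))"

text \<open>The normalised absolute value.  If \<open>v\<close> is the place of \<open>\<pp>\<close>, with \<open>|\<cdot>|\<^sub>v\<close> extending the
  usual \<open>p\<close>-adic absolute value and \<open>n\<^sub>v\<close> its local degree, this is \<open>|\<cdot>|\<^sub>v\<close> to the power
  \<open>n\<^sub>v\<close>; the local degree thus does not occur separately in the height below.\<close>

definition normalized_abs :: "'k::field_char_0 set \<Rightarrow> 'k \<Rightarrow> real" where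
  "normalized_abs \<pp> x = (if x = 0 then 0 else real (ideal_norm \<pp>) powi (- prime_ord \<pp> x))"


subsection \<open>The absolute multiplicative Weil height\<close>

text \<open>The height of the homogeneous coordinates \<open>x\<close> indexed by the finite set \<open>I\<close>, for \<open>x\<close> not
  identically zero on \<open>I\<close>.  Almost all non-archimedean factors equal 1; the product is taken over
  the others, since a product over an infinite set would be 1 by convention.\<close>

definition weil_height :: "'i set \<Rightarrow> ('i \<Rightarrow> 'k::field_char_0) \<Rightarrow> real" where
  "weil_height I x =
     ((\<Prod>v\<in>arch_places. (MAX i\<in>I. v (x i)) ^ arch_local_degree v) *
      (\<Prod>\<pp>\<in>{\<pp>\<in>finite_places. (MAX i\<in>I. normalized_abs \<pp> (x i)) \<noteq> 1}.
         MAX i\<in>I. normalized_abs \<pp> (x i)))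
     powr (1 / real (field_degree TYPE('k)))"


subsection \<open>Points and lines of projective space\<close>

text \<open>\<open>'k ^ 'n\<close> holds the homogeneous coordinates of the projective space of dimension
  \<open>CARD('n) - 1\<close>.  Its points and lines over \<open>'k\<close> are the linear subspaces of
  \<open>'k ^ 'n\<close> of dimension 1 and 2, and incidence is inclusion.\<close>

definition proj_points :: "('k::field ^ 'n) set set" where
  "proj_points = {P. vec.subspace P \<and> vec.dim P = 1}"

definition proj_lines :: "('k::field ^ 'n) set set" where
  "proj_lines = {L. vec.subspace L \<and> vec.dim L = 2}"

definition points_of :: "('k::field ^ 'n) set \<Rightarrow> ('k ^ 'n) set set" where
  "points_of L = {Q \<in> proj_points. Q \<subseteq> L}"

text \<open>The three functions below choose homogeneous coordinates (respectively a basis of the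
  plane of a line).  Their values do not depend on the choice; for the heights this is the
  product formula.\<close>

definition homog_coords :: "('k::field ^ 'n) set \<Rightarrow> 'k ^ 'n" where
  "homog_coords P = (SOME x. x \<in> P \<and> x \<noteq> 0)"

definition point_height :: "('k::field_char_0 ^ 'n) set \<Rightarrow> real" where
  "point_height P = weil_height UNIV (\<lambda>i. homog_coords P $ i)"

definition plucker_index :: "('n::linorder \<times> 'n) set" where
  "plucker_index = {(i, j). i < j}"

definition plucker :: "'k::field ^ 'n \<Rightarrow> 'k ^ 'n \<Rightarrow> 'n \<times> 'n \<Rightarrow> 'k" where
  "plucker x y = (\<lambda>(i, j). x $ i * y $ j - x $ j * y $ i)"

definition plucker_height :: "('k::field_char_0 ^ 'n::{finite, linorder}) set \<Rightarrow> real" where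
  "plucker_height L =
     (let (x, y) = SOME (x, y). vec.span {x, y} = L in weil_height plucker_index (plucker x y))"

definition local_dist ::
  "('k::field_char_0 \<Rightarrow> real) \<Rightarrow> ('k ^ 'n::{finite, linorder}) set \<Rightarrow>
     ('k ^ 'n::{finite, linorder}) set \<Rightarrow> real" where
  "local_dist v P Q =
     (let x = homog_coords P; y = homog_coords Q in
        (MAX ij\<in>plucker_index. v (plucker x y ij)) /
        ((MAX i\<in>UNIV. v (x $ i)) * (MAX j\<in>UNIV. v (y $ j))))"

definition lines_through_upto ::
  "('k::field_char_0 ^ 'n::{finite, linorder}) set \<Rightarrow> real \<Rightarrow>
     ('k ^ 'n::{finite, linorder}) set set" where
  "lines_through_upto P B = {L \<in> proj_lines. P \<in> points_of L \<and> plucker_height L \<le> B}"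

end

theory Submission
  imports Defs "Jordan_Normal_Form.Char_Poly" "HOL-Algebra.Algebraic_Closure_Type"
begin

text \<open>
  Let \<open>p\<close> and \<open>q\<close> be coordinates of \<open>P\<close> and of a point \<open>Q \<noteq> P\<close>. The minors \<open>p\<^sub>i q\<^sub>j - p\<^sub>j q\<^sub>i\<close> are the
  Pluecker coordinates of the line \<open>L\<close> joining them. At an archimedean place their maximum is
  \<open>dist\<^sub>v(P, Q) |p|\<^sub>v |q|\<^sub>v\<close>, and at the other places it is at most \<open>|p|\<^sub>v |q|\<^sub>v\<close>. Multiplying over all
  places, and using that the archimedean local degrees add up to the degree of the field, gives
  \<open>H(L) \<le> H(P) (\<Sum>\<^sub>v dist\<^sub>v(P, Q)) H(Q)\<close>, so \<open>N = H(P)\<close> works; the lines of bounded height are finite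
  in number by Northcott's theorem.

  Independence of the coordinates is the product formula. The index \<open>[O : aO]\<close> equals the product of
  the \<open>N(\<pp>)\<close> to the power \<open>ord\<^sub>\<pp>(a)\<close>, by changing one exponent at a time; no unique factorisation
  of ideals is needed. Comparing this index with the norm of \<open>a\<close> up to a bounded factor (by
  pigeonhole) suffices, since a bounded homomorphism from the multiplicative group of the field to
  the positive reals is trivial.
\<close>

text \<open>The definitions pick coordinates and bases by \<open>SOME\<close> and count orders by
  powers of ideals, so no height can be evaluated before the product formula holds for exactly these
  notions. The common source of the arithmetic facts is that every residue ring O/aO with
  \<open>a\<close> nonzero is finite: taking floors of rational coordinates shows that O lies in
  finitely many translates of Z[\<theta>], for an integral generator \<theta>. Powers of an element
  must then repeat modulo \<open>a\<close>, which yields inverses modulo a prime and a bound on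
  orders; an ideal containing \<open>a\<close> is a union of finitely many classes, so maximal
  ideals are found by counting. A prime becomes principal after inverting one element outside it,
  because O is integrally closed. The constant is H(P) with no further factor: at finite places the
  ultrametric inequality bounds a minor by the product of the maxima, and at archimedean places the
  minors are already the numerator of the distance.\<close>

no_notation vec_index (infixl "$" 100)
hide_const (open) Polynomials.degree Polynomials.lead_coeff UnivPoly.coeff UnivPoly.monom
  Module.module.smult Matrix.row Matrix.rows Determinant.det Coset.order

section \<open>Algebraic integers\<close>

text \<open>\<open>zmod.span W\<close> is the additive group generated by \<open>W\<close>. Its
  rational counterpart \<open>qvs\<close> is the structure in which \<open>number_field\<close> and
  \<open>field_degree\<close> are phrased.\<close>

interpretation zmod: Modules.module "\<lambda>(n::int) (x::'a::field_char_0). of_int n * x"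
  by standard (simp_all add: algebra_simps)

interpretation qvs: vector_space "\<lambda>(q::rat) (x::'a::field_char_0). of_rat q * x"
  by standard (simp_all add: algebra_simps of_rat_add of_rat_mult)

text \<open>The determinant trick: on the generators, multiplication by \<open>x\<close> is an
  integer matrix, and the list of generators is an eigenvector with eigenvalue \<open>x\<close>,
  nonzero because of \<open>w0\<close>. So \<open>x\<close> is a root of a monic integer
  characteristic polynomial.\<close>

lemma algebraic_int_if_stable:
  fixes x :: "'a::field_char_0"
  assumes "finite W" "w0 \<in> W" "w0 \<noteq> 0" and W: "\<And>w. w \<in> W \<Longrightarrow> x * w \<in> zmod.span W"
  shows "algebraic_int x"
proof -
  obtain ws where ws: "set ws = W" "distinct ws"
    using assms(1) finite_distinct_list by blast
  define n where "n = length ws"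
  have "\<exists>c. x * w = (\<Sum>u\<in>W. of_int (c u) * u)" if "w \<in> W" for w
    using W[OF that] unfolding zmod.span_finite[OF assms(1)] by auto
  then obtain c where c: "\<And>w. w \<in> W \<Longrightarrow> x * w = (\<Sum>u\<in>W. of_int (c w u) * u)"
    by metis
  define Z where "Z = Matrix.mat n n (\<lambda>(i, j). c (ws ! i) (ws ! j))"
  define A where "A = map_mat (of_int :: int \<Rightarrow> 'a) Z"
  define v where "v = Matrix.vec n (\<lambda>i. ws ! i)"
  have Zc: "Z \<in> carrier_mat n n" and Ac: "A \<in> carrier_mat n n" by (auto simp: Z_def A_def)
  have sum_ws: "(\<Sum>u\<in>W. f u) = (\<Sum>i<n. f (ws ! i))" for f :: "'a \<Rightarrow> 'a"
    using sum.reindex_bij_betw[OF bij_betw_nth[OF ws(2), of "{..<n}" W], of f] ws by (simp add: n_def)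
  have "A *\<^sub>v v = x \<cdot>\<^sub>v v"
  proof (rule eq_vecI)
    fix i assume "i < dim_vec (x \<cdot>\<^sub>v v)"
    hence i: "i < n" by (simp add: v_def)
    have "vec_index (A *\<^sub>v v) i = (\<Sum>j<n. of_int (c (ws ! i) (ws ! j)) * (ws ! j))"
      using i by (simp add: A_def Z_def v_def scalar_prod_def atLeast0LessThan)
    also have "\<dots> = x * (ws ! i)"
      using c[of "ws ! i"] i ws by (auto simp: sum_ws n_def)
    finally show "vec_index (A *\<^sub>v v) i = vec_index (x \<cdot>\<^sub>v v) i"
      using i by (simp add: v_def)
  qed (simp add: A_def Z_def v_def)
  moreover obtain i where "i < n" "ws ! i = w0" using assms(2) ws by (metis in_set_conv_nth n_def)
  hence "v \<noteq> 0\<^sub>v n" using assms(3) by (auto simp: v_def dest: arg_cong[of _ _ "\<lambda>v. vec_index v i"])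
  ultimately have "eigenvector A v x"
    using Ac by (auto simp: eigenvector_def v_def)
  hence "poly (char_poly A) x = 0"
    using eigenvalue_root_char_poly[OF Ac] by (auto simp: eigenvalue_def)
  moreover have "char_poly A = map_poly of_int (char_poly Z)"
    unfolding A_def by (rule of_int_hom.char_poly_hom[OF Zc])
  moreover have "lead_coeff (char_poly Z) = 1"
    using degree_monic_char_poly[OF Zc] by auto
  ultimately show ?thesis by (auto simp: algebraic_int_altdef_ipoly)
qed

lemma zspan_mult_closed:
  fixes x :: "'a::field_char_0"
  assumes "\<And>w. w \<in> W \<Longrightarrow> x * w \<in> zmod.span W" "y \<in> zmod.span W"
  shows "x * y \<in> zmod.span W"
  using assms(2)
proof (induction rule: zmod.span_induct_alt)
  case base show ?case by (simp add: zmod.span_zero)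
next
  case (step c w y)
  have "x * (of_int c * w + y) = of_int c * (x * w) + x * y" by (simp add: algebra_simps)
  thus ?case using step assms(1) by (simp add: zmod.span_add zmod.span_scale)
qed

lemma algebraic_int_power_span:
  fixes x :: "'a::field_char_0"
  assumes "algebraic_int x"
  obtains n where "n > 0" "x ^ n \<in> zmod.span ((\<lambda>i. x ^ i) ` {..<n})"
proof -
  obtain p where p: "poly (map_poly of_int p) x = 0" "lead_coeff p = (1::int)"
    using assms by (auto simp: algebraic_int_altdef_ipoly)
  define n where "n = degree p"
  have eq: "(\<Sum>i\<le>n. of_int (coeff p i) * x ^ i) = 0"
    using p(1) by (simp add: poly_altdef n_def)
  have "n > 0"
    using p eq unfolding n_def by (cases "degree p") auto
  moreover have "x ^ n = - (\<Sum>i<n. of_int (coeff p i) * x ^ i)"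
    using eq p(2) by (simp add: n_def lessThan_Suc_atMost[symmetric] eq_neg_iff_add_eq_0 add.commute)
  moreover have "(\<Sum>i<n. of_int (coeff p i) * x ^ i) \<in> zmod.span ((\<lambda>i. x ^ i) ` {..<n})"
    by (intro zmod.span_sum zmod.span_scale zmod.span_base) auto
  ultimately show ?thesis using that by (metis zmod.span_neg)
qed

text \<open>The only critical exponent is \<open>i = m - 1\<close>, where \<open>x ^ m\<close> is
  rewritten by lower powers. Exchanging \<open>x\<close> and \<open>y\<close> gives stability under
  \<open>y\<close> as well.\<close>

lemma power_products_stable:
  fixes x y :: "'a::field_char_0"
  defines "W \<equiv> \<lambda>m n. (\<lambda>(i, j). x ^ i * y ^ j) ` ({..<m} \<times> {..<n})"
  assumes m: "x ^ m \<in> zmod.span ((\<lambda>i. x ^ i) ` {..<m})" and w: "w \<in> W m n"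
  shows "x * w \<in> zmod.span (W m n)"
proof -
  obtain i j where ij: "i < m" "j < n" "w = x ^ i * y ^ j" using w by (auto simp: W_def)
  have "u * y ^ j \<in> zmod.span (W m n)" if "u \<in> zmod.span ((\<lambda>i. x ^ i) ` {..<m})" for u
    using that
  proof (induction rule: zmod.span_induct_alt)
    case base show ?case by (simp add: zmod.span_zero)
  next
    case (step c v z)
    have "v * y ^ j \<in> W m n" using step(1) ij(2) by (auto simp: W_def)
    moreover have "(of_int c * v + z) * y ^ j = of_int c * (v * y ^ j) + z * y ^ j"
      by (simp add: algebra_simps)
    ultimately show ?case using step(2) by (simp add: zmod.span_add zmod.span_scale zmod.span_base)
  qed
  moreover have "x ^ Suc i \<in> zmod.span ((\<lambda>i. x ^ i) ` {..<m})"
  proof (cases "Suc i = m")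
    case False
    thus ?thesis using ij(1) by (intro zmod.span_base imageI) simp
  qed (use m in simp)
  ultimately have "x ^ Suc i * y ^ j \<in> zmod.span (W m n)" by blast
  thus ?thesis using ij(3) by (simp add: mult.assoc)
qed

lemma algebraic_int_add_mult:
  fixes x y :: "'a::field_char_0"
  assumes "algebraic_int x" "algebraic_int y"
  shows "algebraic_int (x + y)" "algebraic_int (x * y)"
proof -
  obtain m where m: "m > 0" "x ^ m \<in> zmod.span ((\<lambda>i. x ^ i) ` {..<m})"
    using algebraic_int_power_span[OF assms(1)] .
  obtain n where n: "n > 0" "y ^ n \<in> zmod.span ((\<lambda>i. y ^ i) ` {..<n})"
    using algebraic_int_power_span[OF assms(2)] .
  define W where "W = (\<lambda>(i, j). x ^ i * y ^ j) ` ({..<m} \<times> {..<n})"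
  have "(\<lambda>(i, j). x ^ i * y ^ j) (0, 0) \<in> W" unfolding W_def using m n by (intro imageI) simp
  hence fin: "finite W" and one: "1 \<in> W" by (auto simp: W_def)
  \<comment> \<open>The same products with the factors exchanged, so that
    \<open>power_products_stable\<close> also applies to \<open>y\<close>.\<close>
  have W': "W = (\<lambda>(j, i). y ^ j * x ^ i) ` ({..<n} \<times> {..<m})"
    unfolding W_def by (force simp: mult.commute)
  have x: "x * w \<in> zmod.span W" if "w \<in> W" for w
    using power_products_stable[OF m(2)] that unfolding W_def by blast
  have y: "y * w \<in> zmod.span W" if "w \<in> W" for w
    using power_products_stable[OF n(2)] that unfolding W' by blast
  show "algebraic_int (x + y)"
    by (rule algebraic_int_if_stable[OF fin one]) (use x y in \<open>auto simp: distrib_right intro: zmod.span_add\<close>)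
  show "algebraic_int (x * y)"
    by (rule algebraic_int_if_stable[OF fin one])
      (use x y zspan_mult_closed[OF x] in \<open>auto simp: mult.assoc\<close>)
qed

lemma algebraic_int_add [intro]:
  "algebraic_int (x::'a::field_char_0) \<Longrightarrow> algebraic_int y \<Longrightarrow> algebraic_int (x + y)"
  and algebraic_int_mult [intro]:
  "algebraic_int (x::'a::field_char_0) \<Longrightarrow> algebraic_int y \<Longrightarrow> algebraic_int (x * y)"
  and algebraic_int_diff [intro]:
  "algebraic_int (x::'a::field_char_0) \<Longrightarrow> algebraic_int y \<Longrightarrow> algebraic_int (x - y)"
  using algebraic_int_add_mult algebraic_int_add_mult(1)[of x "- y"] by auto

lemma algebraic_int_power [intro]: "algebraic_int (x::'a::field_char_0) \<Longrightarrow> algebraic_int (x ^ n)"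
  by (induction n) auto

lemma algebraic_int_sum [intro]:
  "(\<And>i. i \<in> I \<Longrightarrow> algebraic_int (f i :: 'a::field_char_0)) \<Longrightarrow> algebraic_int (\<Sum>i\<in>I. f i)"
  by (induction I rule: infinite_finite_induct) auto

lemma algebraic_int_prod [intro]:
  "(\<And>i. i \<in> I \<Longrightarrow> algebraic_int (f i :: 'a::field_char_0)) \<Longrightarrow> algebraic_int (\<Prod>i\<in>I. f i)"
  by (induction I rule: infinite_finite_induct) auto

text \<open>If \<open>a\<close> is the leading coefficient of an integer polynomial \<open>p\<close> with root \<open>x\<close>, then \<open>a x\<close>
  is a root of a monic integer polynomial.\<close>

lemma algebraic_multiple_integral:
  fixes x :: "'a::field_char_0"
  assumes "algebraic x"
  obtains m :: nat where "m > 0" "algebraic_int (of_nat m * x)"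
proof -
  obtain p where p: "p \<noteq> 0" "poly (map_poly of_int p) x = 0"
    using assms by (elim algebraicE')
  define n a where "n = degree p" and "a = lead_coeff p"
  define y where "y = of_int a * x"
  have "a \<noteq> 0" using p by (simp add: a_def)
  have eq: "(\<Sum>i\<le>n. of_int (coeff p i) * x ^ i) = 0"
    using p(2) by (simp add: poly_altdef n_def)
  have "n > 0"
  proof (rule ccontr)
    assume "\<not> n > 0"
    thus False using eq \<open>a \<noteq> 0\<close> by (simp add: n_def a_def)
  qed
  have "of_int a * x ^ n = - (\<Sum>i<n. of_int (coeff p i) * x ^ i)"
    using eq by (simp add: n_def a_def lessThan_Suc_atMost[symmetric] eq_neg_iff_add_eq_0 add.commute)
  \<comment> \<open>The factor \<open>a ^ (n - 1)\<close> turns the leading term into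
    \<open>y ^ n\<close> and each lower term into an integer multiple of
    \<open>y ^ i\<close>.\<close>
  hence lhs: "of_int a ^ (n - 1) * (of_int a * x ^ n) = - (\<Sum>i<n. of_int a ^ (n - 1) * (of_int (coeff p i) * x ^ i))"
    by (simp add: sum_distrib_left)
  have yn: "of_int a ^ (n - 1) * (of_int a * x ^ n) = y ^ n"
    using \<open>n > 0\<close> by (cases n) (simp_all add: y_def power_mult_distrib mult_ac)
  have coeff_eq: "of_int a ^ (n - 1) * (of_int (coeff p i) * x ^ i) = of_int (coeff p i * a ^ (n - 1 - i)) * y ^ i"
    if "i < n" for i
  proof -
    have "n - 1 = (n - 1 - i) + i" using that by simp
    hence "(of_int a :: 'a) ^ (n - 1) = of_int a ^ (n - 1 - i) * of_int a ^ i"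
      by (metis power_add)
    thus ?thesis by (simp add: y_def power_mult_distrib mult_ac)
  qed
  have "y ^ n = - (\<Sum>i<n. of_int a ^ (n - 1) * (of_int (coeff p i) * x ^ i))"
    using lhs yn by simp
  also have "\<dots> = - (\<Sum>i<n. of_int (coeff p i * a ^ (n - 1 - i)) * y ^ i)"
    by (intro arg_cong[of _ _ uminus] sum.cong refl coeff_eq) auto
  also have "\<dots> \<in> zmod.span ((\<lambda>i. y ^ i) ` {..<n})"
    by (intro zmod.span_neg zmod.span_sum zmod.span_scale zmod.span_base) auto
  finally have yn: "y ^ n \<in> zmod.span ((\<lambda>i. y ^ i) ` {..<n})" .
  have "algebraic_int y"
  proof (rule algebraic_int_if_stable)
    show "1 \<in> (\<lambda>i. y ^ i) ` {..<n}" using \<open>n > 0\<close> by force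
    show "y * w \<in> zmod.span ((\<lambda>i. y ^ i) ` {..<n})" if "w \<in> (\<lambda>i. y ^ i) ` {..<n}" for w
    proof -
      obtain i where i: "i < n" "w = y ^ i" using \<open>w \<in> _\<close> by auto
      show ?thesis
      proof (cases "Suc i = n")
        case True thus ?thesis using yn i by auto
      next
        case False thus ?thesis using i by (auto intro!: zmod.span_base image_eqI[of _ _ "Suc i"])
      qed
    qed
  qed auto
  \<comment> \<open>The multiplier has to be a positive natural number, so the sign of
    \<open>a\<close> is absorbed here.\<close>
  hence "algebraic_int (of_int (sgn a) * y)" by auto
  also have "of_int (sgn a) * y = of_nat (nat \<bar>a\<bar>) * x"
    by (simp add: y_def flip: of_int_mult mult.assoc) (simp add: mult.commute[of "sgn a"] flip: abs_sgn)
  finally show ?thesis using that[of "nat \<bar>a\<bar>"] \<open>a \<noteq> 0\<close> by auto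
qed

section \<open>Primitive elements\<close>

text \<open>One evaluation map for a rational polynomial in the field, in its algebraic closure and
  in the complex numbers, so that roots can be compared across them.\<close>

definition rpoly :: "rat poly \<Rightarrow> 'a::field_char_0 \<Rightarrow> 'a" where
  "rpoly p x = poly (map_poly of_rat p) x"

lemma rpoly_0 [simp]: "rpoly 0 x = 0"
  and rpoly_1 [simp]: "rpoly 1 x = 1"
  and rpoly_add [simp]: "rpoly (p + q) x = rpoly p x + rpoly q x"
  and rpoly_diff [simp]: "rpoly (p - q) x = rpoly p x - rpoly q x"
  and rpoly_mult [simp]: "rpoly (p * q) x = rpoly p x * rpoly q x"
  and rpoly_pCons [simp]: "rpoly (pCons a p) x = of_rat a + x * rpoly p x"
  and rpoly_smult [simp]: "rpoly (smult a p) x = of_rat a * rpoly p x"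
  and rpoly_monom [simp]: "rpoly (Polynomial.monom a n) x = of_rat a * x ^ n"
proof -
  interpret h: map_poly_idom_hom "of_rat :: rat \<Rightarrow> 'a" ..
  show "rpoly 0 x = 0" "rpoly 1 x = 1" "rpoly (p + q) x = rpoly p x + rpoly q x"
    "rpoly (p - q) x = rpoly p x - rpoly q x" "rpoly (p * q) x = rpoly p x * rpoly q x"
    "rpoly (pCons a p) x = of_rat a + x * rpoly p x" "rpoly (smult a p) x = of_rat a * rpoly p x"
    "rpoly (Polynomial.monom a n) x = of_rat a * x ^ n"
    by (simp_all add: rpoly_def h.hom_add h.hom_minus h.hom_mult of_rat_hom.map_poly_hom_smult
        of_rat_hom.map_poly_pCons_hom poly_monom)
qed

lemma rpoly_sum [simp]: "rpoly (\<Sum>i\<in>I. p i) x = (\<Sum>i\<in>I. rpoly (p i) x)"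
  by (induction I rule: infinite_finite_induct) auto

lemma rpoly_pcompose [simp]: "rpoly (pcompose p q) x = rpoly p (rpoly q x)"
  by (induction p) (auto simp: pcompose_pCons)

lemma rpoly_pderiv: "rpoly (pderiv p) x = poly (pderiv (map_poly of_rat p)) x"
  by (simp add: rpoly_def of_rat_hom.map_poly_pderiv)

lemma rpoly_altdef: "rpoly p x = (\<Sum>i\<le>degree p. of_rat (coeff p i) * x ^ i)"
  by (simp add: rpoly_def poly_altdef)

lemma rpoly_of_rat_hom:
  fixes \<sigma> :: "'a::field_char_0 \<Rightarrow> 'b::field_char_0"
  assumes "\<sigma> 1 = 1" "\<And>x y. \<sigma> (x + y) = \<sigma> x + \<sigma> y" "\<And>x y. \<sigma> (x * y) = \<sigma> x * \<sigma> y"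
  shows "\<sigma> (rpoly p x) = rpoly p (\<sigma> x)" and "\<sigma> (of_rat q) = of_rat q"
proof -
  have "\<sigma> 0 = 0" using assms(2)[of 0 0] by simp
  then interpret h: field_hom \<sigma> using assms by unfold_locales auto
  have nat: "\<sigma> (of_nat n) = of_nat n" for n by (induction n) (auto simp: assms \<open>\<sigma> 0 = 0\<close>)
  have int: "\<sigma> (of_int z) = of_int z" for z
    by (cases z rule: int_cases2) (simp_all add: nat h.hom_uminus)
  show q: "\<sigma> (of_rat q) = of_rat q" for q
    by (cases q rule: Rat_cases) (simp add: Rat.of_rat_rat h.hom_div int)
  show "\<sigma> (rpoly p x) = rpoly p (\<sigma> x)"
    by (induction p) (auto simp: assms q \<open>\<sigma> 0 = 0\<close>)
qed

lemma algebraic_iff_rpoly: "algebraic (x::'a::field_char_0) \<longleftrightarrow> (\<exists>p. p \<noteq> 0 \<and> rpoly p x = 0)"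
proof
  assume "algebraic x"
  then obtain p where p: "p \<noteq> 0" "poly (map_poly of_int p) x = 0" by (elim algebraicE')
  have "rpoly (map_poly of_int p) x = 0"
    using p by (simp add: rpoly_def map_poly_map_poly o_def)
  thus "\<exists>p. p \<noteq> 0 \<and> rpoly p x = 0" using p by (intro exI[of _ "map_poly of_int p"]) auto
next
  assume "\<exists>p. p \<noteq> 0 \<and> rpoly p x = 0"
  then obtain p where "p \<noteq> 0" "rpoly p x = 0" by auto
  thus "algebraic x" unfolding algebraic_altdef
    by (intro exI[of _ "map_poly of_rat p"]) (auto simp: rpoly_def)
qed

text \<open>Least degree takes the place of the usual monic normalisation; such a polynomial is
  determined up to a nonzero rational factor.\<close>

definition is_minpoly :: "rat poly \<Rightarrow> 'a::field_char_0 \<Rightarrow> bool" where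
  "is_minpoly m x \<longleftrightarrow> m \<noteq> 0 \<and> rpoly m x = 0 \<and> (\<forall>p. p \<noteq> 0 \<longrightarrow> rpoly p x = 0 \<longrightarrow> degree m \<le> degree p)"

lemma minpoly_exists:
  assumes "algebraic x"
  obtains m where "is_minpoly m x"
proof -
  obtain p where p: "p \<noteq> 0 \<and> rpoly p x = 0" using assms algebraic_iff_rpoly by auto
  show ?thesis
    using ex_has_least_nat[of "\<lambda>p. p \<noteq> 0 \<and> rpoly p x = 0", OF p, of degree] that
    unfolding is_minpoly_def by blast
qed

lemma minpoly_dvd:
  assumes "is_minpoly m x"
  shows "rpoly h x = 0 \<longleftrightarrow> m dvd h"
proof
  assume h: "rpoly h x = 0"
  have m: "m \<noteq> 0" "rpoly m x = 0" using assms by (auto simp: is_minpoly_def)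
  have "rpoly h x = rpoly (h div m) x * rpoly m x + rpoly (h mod m) x"
    unfolding rpoly_mult[symmetric] rpoly_add[symmetric] by simp
  hence "rpoly (h mod m) x = 0" using h m by simp
  hence "h mod m \<noteq> 0 \<Longrightarrow> degree m \<le> degree (h mod m)"
    using assms by (simp add: is_minpoly_def)
  hence "h mod m = 0" using degree_mod_less[OF m(1), of h] by linarith
  thus "m dvd h" by (simp add: mod_eq_0_iff_dvd)
next
  assume "m dvd h"
  then obtain q where "h = m * q" by (elim dvdE)
  thus "rpoly h x = 0" using assms by (simp add: is_minpoly_def)
qed

text \<open>As \<open>x\<close> is not a root of the gcd, it is a root of the cofactor. Minimality
  forces the cofactor to have full degree, so the gcd is a unit.\<close>

lemma minpoly_bezout:
  assumes m: "is_minpoly m x" and h: "rpoly h x \<noteq> 0"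
  obtains u v where "u * h + v * m = 1"
proof -
  obtain q where q: "m = gcd h m * q" by (metis dvdE gcd_dvd2)
  have nz: "m \<noteq> 0" "gcd h m \<noteq> 0" "q \<noteq> 0" using m q by (auto simp: is_minpoly_def)
  have "rpoly (gcd h m) x \<noteq> 0"
    using h by (metis dvd_def gcd_dvd1 mult_zero_left rpoly_mult)
  moreover have "rpoly (gcd h m) x * rpoly q x = 0"
    using q m by (metis is_minpoly_def rpoly_mult)
  ultimately have "rpoly q x = 0" by auto
  hence "degree m \<le> degree q" using m nz by (auto simp: is_minpoly_def)
  moreover have "degree m = degree (gcd h m) + degree q"
    using nz q degree_mult_eq by metis
  ultimately have "is_unit (gcd h m)" using nz by (simp add: is_unit_iff_degree)
  hence "gcd h m = 1" by (metis is_unit_gcd_iff)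
  thus ?thesis using that bezout_coefficients_fst_snd[of h m] by metis
qed

lemma minpoly_degree_pos: "is_minpoly m x \<Longrightarrow> degree m > 0"
  by (auto simp: is_minpoly_def intro!: Nat.gr0I elim!: degree_eq_zeroE)

text \<open>The derivative has smaller degree and so does not vanish at \<open>x\<close>; it is
  therefore coprime to \<open>m\<close>. The Bezout identity, evaluated at \<open>z\<close> in any
  field of characteristic zero, excludes a common root.\<close>

lemma minpoly_separable:
  assumes m: "is_minpoly m x" and z: "rpoly m (z::'b::field_char_0) = 0"
  shows "rpoly (pderiv m) z \<noteq> 0"
proof -
  have d: "degree (pderiv m) < degree m" "pderiv m \<noteq> 0"
    using minpoly_degree_pos[OF m] by (simp_all add: degree_pderiv pderiv_eq_0_iff)
  hence "rpoly (pderiv m) x \<noteq> 0" using m not_le unfolding is_minpoly_def by blast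
  then obtain u v where "u * pderiv m + v * m = 1" using minpoly_bezout[OF m] by blast
  from arg_cong[OF this, of "\<lambda>p. rpoly p z"]
  have "rpoly u z * rpoly (pderiv m) z + rpoly v z * rpoly m z = 1" by simp
  thus ?thesis using z by auto
qed

section \<open>Subfields generated by one element\<close>

definition adjoin :: "'a::field_char_0 \<Rightarrow> 'a set" where
  "adjoin x = range (\<lambda>p. rpoly p x)"

lemma adjoin_closed:
  "0 \<in> adjoin x" "1 \<in> adjoin x" "x \<in> adjoin x" "of_rat q \<in> adjoin x"
  "a \<in> adjoin x \<Longrightarrow> b \<in> adjoin x \<Longrightarrow> a + b \<in> adjoin x"
  "a \<in> adjoin x \<Longrightarrow> b \<in> adjoin x \<Longrightarrow> a - b \<in> adjoin x"
  "a \<in> adjoin x \<Longrightarrow> b \<in> adjoin x \<Longrightarrow> a * b \<in> adjoin x"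
proof -
  have I: "rpoly p x \<in> adjoin x" for p by (auto simp: adjoin_def)
  show "0 \<in> adjoin x" "1 \<in> adjoin x" "x \<in> adjoin x" "of_rat q \<in> adjoin x"
    using I[of 0] I[of 1] I[of "[:0,1:]"] I[of "[:q:]"] by simp_all
  show "a \<in> adjoin x \<Longrightarrow> b \<in> adjoin x \<Longrightarrow> a + b \<in> adjoin x"
  "a \<in> adjoin x \<Longrightarrow> b \<in> adjoin x \<Longrightarrow> a - b \<in> adjoin x"
  "a \<in> adjoin x \<Longrightarrow> b \<in> adjoin x \<Longrightarrow> a * b \<in> adjoin x"
    unfolding adjoin_def image_iff by (metis rpoly_add UNIV_I, metis rpoly_diff UNIV_I, metis rpoly_mult UNIV_I)
qed

lemma adjoin_subset: "x \<in> adjoin y \<Longrightarrow> adjoin x \<subseteq> adjoin y"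
  unfolding adjoin_def by clarsimp (metis rangeI rpoly_pcompose)

lemma adjoin_inverse:
  assumes "algebraic x" "a \<in> adjoin x"
  shows "inverse a \<in> adjoin x"
proof (cases "a = 0")
  case False
  obtain m where m: "is_minpoly m x" using minpoly_exists[OF assms(1)] .
  obtain h where h: "a = rpoly h x" using assms(2) by (auto simp: adjoin_def)
  obtain u v where "u * h + v * m = 1" using minpoly_bezout[OF m, of h] h False by blast
  from arg_cong[OF this, of "\<lambda>p. rpoly p x"]
  have "rpoly u x * a + rpoly v x * rpoly m x = 1" using h by simp
  hence "rpoly u x * a = 1" using m by (simp add: is_minpoly_def)
  hence "inverse a = rpoly u x" by (metis inverse_unique mult.commute)
  thus ?thesis by (auto simp: adjoin_def)
qed (simp add: adjoin_closed)

text \<open>Long division by a monic polynomial only multiplies and subtracts coefficients, so the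
  remainder keeps its coefficients in \<open>F\<close>. This gives division with remainder over the
  subfield \<open>adjoin \<gamma>\<close>, which is a set and not a type.\<close>

lemma monic_mod_closed:
  fixes h p :: "'a::field poly"
  assumes F: "0 \<in> F" "\<And>a b. a \<in> F \<Longrightarrow> b \<in> F \<Longrightarrow> a - b \<in> F" "\<And>a b. a \<in> F \<Longrightarrow> b \<in> F \<Longrightarrow> a * b \<in> F"
    and h: "lead_coeff h = 1" "\<And>i. coeff h i \<in> F"
    and p: "\<And>i. coeff p i \<in> F"
  shows "\<exists>q r. p = q * h + r \<and> (r = 0 \<or> degree r < degree h) \<and> (\<forall>i. coeff r i \<in> F)"
  using p
proof (induction "degree p" arbitrary: p rule: less_induct)
  case less
  show ?case
  proof (cases "p = 0 \<or> degree p < degree h")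
    case True thus ?thesis using less.prems by (intro exI[of _ 0] exI[of _ p]) auto
  next
    case False
    hence le: "degree h \<le> degree p" and "p \<noteq> 0" by auto
    define s where "s = Polynomial.monom (lead_coeff p) (degree p - degree h)"
    define p' where "p' = p - s * h"
    have cp': "coeff p' i = coeff p i - (if degree p - degree h \<le> i then lead_coeff p * coeff h (i - (degree p - degree h)) else 0)" for i
      by (simp add: p'_def s_def coeff_monom_mult)
    have cF: "coeff p' i \<in> F" for i
      unfolding cp' using less.prems F h by (auto intro!: F)
    have "coeff p' i = 0" if "i \<ge> degree p" for i
    proof (cases "i = degree p")
      case True thus ?thesis using le h by (simp add: cp')
    next
      case False
      thus ?thesis using that le by (simp add: cp' coeff_eq_0)
    qed
    hence deg: "p' = 0 \<or> degree p' < degree p"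
      by (metis leading_coeff_0_iff not_le)
    show ?thesis
    proof (cases "p' = 0")
      case True
      thus ?thesis using F(1) by (intro exI[of _ s] exI[of _ 0]) (auto simp: p'_def)
    next
      case False
      then obtain q r where "p' = q * h + r" "r = 0 \<or> degree r < degree h" "\<forall>i. coeff r i \<in> F"
        using less.hyps[of p'] deg cF by blast
      thus ?thesis by (intro exI[of _ "s + q"] exI[of _ r]) (auto simp: p'_def algebra_simps)
    qed
  qed
qed

lemma poly_map_to_ac: "poly (map_poly to_ac p) (to_ac x) = to_ac (poly p x)"
  by (induction p) (auto simp: map_poly_pCons)

lemma map_to_ac_pCons: "map_poly to_ac (pCons a p) = pCons (to_ac a) (map_poly to_ac p)"
  by (rule poly_eqI) (simp add: coeff_map_poly coeff_pCons split: nat.split)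

lemma map_to_ac_mult: "map_poly to_ac (p * q) = map_poly to_ac p * map_poly to_ac (q :: 'a::field poly)"
  by (rule poly_eqI) (simp add: coeff_map_poly coeff_mult to_ac_sum)

lemma to_ac_of_rat: "to_ac (of_rat q :: 'a::field_char_0) = of_rat q"
  by (rule rpoly_of_rat_hom) auto

lemma map_to_ac_of_rat: "map_poly to_ac (map_poly of_rat p :: 'a::field_char_0 poly) = map_poly of_rat p"
  by (simp add: map_poly_map_poly o_def to_ac_of_rat)

lemma monic_multiple_in_adjoin:
  assumes "algebraic x" "p \<noteq> 0" "\<And>i. coeff p i \<in> adjoin x"
  shows "coeff (smult (inverse (lead_coeff p)) p) i \<in> adjoin x"
proof -
  have "inverse (lead_coeff p) \<in> adjoin x" using assms adjoin_inverse by blast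
  thus ?thesis using assms(3) adjoin_closed(7) by auto
qed

text \<open>Put \<gamma> = \<alpha> + c \<beta>. The polynomials g(X) and f(\<gamma> - c X) have
  coefficients in \<open>adjoin \<gamma>\<close> and the common root \<beta>; a good choice of
  \<open>c\<close> makes it their only one. A monic polynomial of least degree over
  \<open>adjoin \<gamma>\<close> with root \<beta> divides both, hence is X - \<beta>, and \<beta>
  can be read off its coefficients.\<close>

lemma adjoin_two:
  fixes \<alpha> \<beta> :: "'a::field_char_0"
  assumes alg: "\<And>x::'a. algebraic x"
  obtains \<gamma> where "\<alpha> \<in> adjoin \<gamma>" "\<beta> \<in> adjoin \<gamma>"
proof -
  obtain f where f: "is_minpoly f \<alpha>" using minpoly_exists alg by blast
  obtain g where g: "is_minpoly g \<beta>" using minpoly_exists alg by blast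
  define R :: "rat poly \<Rightarrow> 'a alg_closure set" where "R p = {z. rpoly p z = 0}" for p
  have finR: "finite (R p)" if "p \<noteq> 0" for p
    unfolding R_def rpoly_def using that by (intro poly_roots_finite) auto
  \<comment> \<open>The values of \<open>c\<close> for which another pair of roots satisfies a + c b
    = \<alpha> + c \<beta>. The pairs with b = \<beta> contribute 0 by division by zero, which
    merely rules out c = 0.\<close>
  define bad where "bad = (\<lambda>(a, b). (a - to_ac \<alpha>) / (to_ac \<beta> - b)) ` (R f \<times> R g)"
  have "finite bad" unfolding bad_def
    by (intro finite_imageI finite_cartesian_product finR) (use f g in \<open>auto simp: is_minpoly_def\<close>)
  moreover have "infinite (range (of_nat :: nat \<Rightarrow> 'a alg_closure))"
    by (rule range_inj_infinite) (simp add: inj_on_def)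
  ultimately obtain c :: nat where c: "(of_nat c :: 'a alg_closure) \<notin> bad"
    by (metis finite_subset image_subsetI)
  define \<gamma> where "\<gamma> = \<alpha> + of_nat c * \<beta>"
  define fs :: "'a poly" where "fs = pcompose (map_poly of_rat f) [:\<gamma>, - of_nat c:]"
  define gs :: "'a poly" where "gs = map_poly of_rat g"
  have ofr: "of_rat q \<in> adjoin \<gamma>" for q by (rule adjoin_closed)
  have ofn: "of_nat n \<in> adjoin \<gamma>" for n using ofr[of "of_nat n"] by simp
  have neg: "- a \<in> adjoin \<gamma>" if "a \<in> adjoin \<gamma>" for a
    using adjoin_closed(6)[OF adjoin_closed(1) that] by simp
  have coeff_mult_closed: "coeff (p * q) i \<in> adjoin \<gamma>"
    if "\<And>i. coeff p i \<in> adjoin \<gamma>" "\<And>i. coeff q i \<in> adjoin \<gamma>" for p q i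
  proof -
    have sum_closed: "(\<And>j. j \<in> A \<Longrightarrow> t j \<in> adjoin \<gamma>) \<Longrightarrow> sum t A \<in> adjoin \<gamma>" for t and A :: "nat set"
      by (induction A rule: infinite_finite_induct) (auto intro: adjoin_closed)
    show ?thesis unfolding coeff_mult by (intro sum_closed adjoin_closed(7) that)
  qed
  have lin: "coeff [:\<gamma>, - of_nat c:] i \<in> adjoin \<gamma>" for i
    by (auto simp: coeff_pCons adjoin_closed neg ofn split: nat.split)
  have fs_coeff: "coeff fs i \<in> adjoin \<gamma>" for i
  proof -
    have "coeff (pcompose (map_poly of_rat p) [:\<gamma>, - of_nat c:]) i \<in> adjoin \<gamma>" for p i
    proof (induction p arbitrary: i)
      case (pCons a p)
      have "coeff [:of_rat a:] i \<in> adjoin \<gamma>"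
        by (auto simp: coeff_pCons adjoin_closed split: nat.split)
      hence "coeff ([:of_rat a:] + [:\<gamma>, - of_nat c:] * pcompose (map_poly of_rat p) [:\<gamma>, - of_nat c:]) i
          \<in> adjoin \<gamma>"
        using coeff_mult_closed[OF lin pCons.IH] unfolding coeff_add by (rule adjoin_closed)
      thus ?case unfolding of_rat_hom.map_poly_pCons_hom pcompose_pCons .
    qed (simp add: adjoin_closed)
    thus ?thesis by (simp add: fs_def)
  qed
  have gs_coeff: "coeff gs i \<in> adjoin \<gamma>" for i
    by (simp add: gs_def adjoin_closed)
  have root: "poly fs \<beta> = 0" "poly gs \<beta> = 0" "gs \<noteq> 0"
    using f g by (auto simp: fs_def gs_def \<gamma>_def poly_pcompose is_minpoly_def rpoly_def)
  \<comment> \<open>A polynomial of least degree with this property plays the minimal polynomial of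
    \<beta> over the subfield \<open>adjoin \<gamma>\<close>.\<close>
  let ?S = "\<lambda>p::'a poly. p \<noteq> 0 \<and> poly p \<beta> = 0 \<and> (\<forall>i. coeff p i \<in> adjoin \<gamma>)"
  obtain h0 where h0: "?S h0" "\<And>p. ?S p \<Longrightarrow> degree h0 \<le> degree p"
    using ex_has_least_nat[of ?S gs degree] root gs_coeff by blast
  define h where "h = smult (inverse (lead_coeff h0)) h0"
  have h: "lead_coeff h = 1" "h \<noteq> 0" "poly h \<beta> = 0" "\<And>i. coeff h i \<in> adjoin \<gamma>" "degree h = degree h0"
    using h0(1) monic_multiple_in_adjoin[OF alg, of h0] by (auto simp: h_def)
  have hdvd: "h dvd p" if p0: "poly p \<beta> = 0" and pF: "\<And>i. coeff p i \<in> adjoin \<gamma>" for p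
  proof -
    obtain q r where qr: "p = q * h + r" "r = 0 \<or> degree r < degree h" "\<forall>i. coeff r i \<in> adjoin \<gamma>"
      using monic_mod_closed[of "adjoin \<gamma>" h p, OF adjoin_closed(1,6,7) h(1,4) pF] by blast
    have "poly r \<beta> = 0" using qr(1) p0 h(3) by simp
    hence "r = 0" using h0(2)[of r] qr h(5) by fastforce
    thus ?thesis using qr by auto
  qed
  obtain h1 where h1: "h = [:-\<beta>, 1:] * h1" using h(3) by (metis dvdE poly_eq_0_iff_dvd)
  \<comment> \<open>A further root in the algebraic closure is a common root of both polynomials,
    hence equals \<beta> by the choice of \<open>c\<close>. Then \<beta> is a double root of
    \<open>g\<close>, against separability.\<close>
  have "degree h1 = 0"
  proof (rule ccontr)
    assume "degree h1 \<noteq> 0"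
    hence "degree (map_poly to_ac h1) > 0" by (subst degree_map_poly) auto
    then obtain y where y: "poly (map_poly to_ac h1) y = 0"
      using alg_closed_imp_poly_has_root by blast
    have yp: "poly (map_poly to_ac p) y = 0" if dv: "h dvd p" for p
    proof -
      obtain k where "p = [:-\<beta>, 1:] * h1 * k" using dv unfolding h1 by (rule dvdE)
      thus ?thesis using y by (simp only: map_to_ac_mult poly_mult) simp
    qed
    have yg: "rpoly g y = 0"
      using yp[OF hdvd[OF root(2) gs_coeff]] by (simp add: gs_def map_to_ac_of_rat rpoly_def)
    have "poly (map_poly to_ac (pcompose p q)) y = poly (map_poly to_ac p) (poly (map_poly to_ac q) y)" for p q
    proof (induction p)
      case (pCons a p)
      have "map_poly to_ac ([:a:] + q * pcompose p q) = [:to_ac a:] + map_poly to_ac (q * pcompose p q)"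
        by (rule poly_eqI) (auto simp: coeff_map_poly coeff_pCons split: nat.split)
      thus ?case using pCons.IH by (simp add: pcompose_pCons map_to_ac_pCons map_to_ac_mult)
    qed simp
    from this[of "map_poly of_rat f" "[:\<gamma>, - of_nat c:]"]
    have "rpoly f (to_ac \<gamma> - of_nat c * y) = 0"
      using yp[OF hdvd[OF root(1) fs_coeff]]
      by (simp add: fs_def map_to_ac_of_rat rpoly_def map_to_ac_pCons algebra_simps)
    hence "(to_ac \<gamma> - of_nat c * y, y) \<in> R f \<times> R g" using yg by (auto simp: R_def)
    moreover have "(to_ac \<gamma> - of_nat c * y - to_ac \<alpha>) / (to_ac \<beta> - y) = of_nat c" if "y \<noteq> to_ac \<beta>"
      using that by (simp add: \<gamma>_def divide_eq_eq algebra_simps)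
    ultimately have "y = to_ac \<beta>"
      using c by (force simp: bad_def)
    hence "poly h1 \<beta> = 0" using y by (simp add: poly_map_to_ac)
    then obtain h2 where h2: "h1 = [:-\<beta>, 1:] * h2" by (metis dvdE poly_eq_0_iff_dvd)
    obtain g1 where "gs = h * g1" using hdvd[OF root(2) gs_coeff] by (rule dvdE)
    hence "gs = [:-\<beta>, 1:] * ([:-\<beta>, 1:] * (h2 * g1))" by (simp only: h1 h2 mult.assoc)
    hence "poly (pderiv gs) \<beta> = 0" by (simp only: pderiv_mult) simp
    thus False using minpoly_separable[OF g, of \<beta>] root by (simp add: gs_def rpoly_pderiv) (simp add: rpoly_def)
  qed
  then obtain a where "h1 = [:a:]" by (metis degree_eq_zeroE)
  hence "h = [:-\<beta>, 1:]" using h(1) h1 by (auto simp: split: if_splits)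
  hence "- \<beta> \<in> adjoin \<gamma>" using h(4)[of 0] by simp
  hence \<beta>: "\<beta> \<in> adjoin \<gamma>" using neg by force
  have "\<alpha> = \<gamma> - of_nat c * \<beta>" by (simp add: \<gamma>_def)
  moreover have "\<gamma> - of_nat c * \<beta> \<in> adjoin \<gamma>" using \<beta> ofn adjoin_closed by blast
  ultimately show ?thesis using \<beta> that by metis
qed

lemma number_field_algebraic:
  assumes "number_field TYPE('k::field_char_0)"
  shows "algebraic (x::'k)"
proof -
  obtain B :: "'k set" where B: "finite B" "qvs.span B = UNIV"
    using assms unfolding number_field_def by blast
  define n where "n = card B"
  \<comment> \<open>More powers than \<open>card B\<close> must be dependent. But
    \<open>qvs.dependent\<close> speaks of the set of powers, so coinciding powers form a case of
    their own, with the polynomial X^i - X^j.\<close>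
  show ?thesis
  proof (cases "inj_on (\<lambda>i. x ^ i) {..n}")
    case True
    let ?S = "(\<lambda>i. x ^ i) ` {..n}"
    have "card ?S = Suc n" using True by (simp add: card_image)
    hence "qvs.dependent ?S"
      using qvs.independent_span_bound[OF B(1), of ?S] B(2) by (auto simp: n_def)
    then obtain u v where uv: "v \<in> ?S" "u v \<noteq> 0" "(\<Sum>v\<in>?S. of_rat (u v) * v) = 0"
      using qvs.dependent_finite[of ?S] by auto
    define p where "p = (\<Sum>i\<le>n. Polynomial.monom (u (x ^ i)) i)"
    have "rpoly p x = 0" using uv(3) True by (simp add: p_def sum.reindex)
    moreover obtain j where "j \<le> n" "v = x ^ j" using uv by auto
    hence "coeff p j \<noteq> 0" using uv by (simp add: p_def coeff_sum)
    hence "p \<noteq> 0" by auto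
    ultimately show ?thesis using algebraic_iff_rpoly by blast
  next
    case False
    then obtain i j where ij: "i \<noteq> j" "x ^ i = x ^ j" by (auto simp: inj_on_def)
    let ?p = "Polynomial.monom 1 i - Polynomial.monom (1::rat) j"
    have "coeff ?p i = 1" using ij by simp
    hence "?p \<noteq> 0" by (metis coeff_0 zero_neq_one)
    moreover have "rpoly ?p x = 0" using ij by simp
    ultimately show ?thesis using algebraic_iff_rpoly by blast
  qed
qed

text \<open>Finitely many generators are merged two at a time. Scaling the result by a natural
  number makes it integral and leaves \<open>adjoin\<close> unchanged, since the rationals belong to
  it.\<close>

theorem primitive_element:
  assumes nf: "number_field TYPE('k)"
  obtains \<theta> :: "'k::field_char_0" where "algebraic_int \<theta>" "adjoin \<theta> = UNIV"
proof -
  note alg = number_field_algebraic[OF nf]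
  obtain B :: "'k set" where B: "finite B" "qvs.span B = UNIV"
    using nf unfolding number_field_def by blast
  have "\<exists>\<theta>. B \<subseteq> adjoin \<theta>" using B(1)
  proof (induction B rule: finite_induct)
    case (insert b B)
    then obtain \<theta> where \<theta>: "B \<subseteq> adjoin \<theta>" by auto
    obtain \<gamma> where "\<theta> \<in> adjoin \<gamma>" "b \<in> adjoin \<gamma>" using adjoin_two[OF alg] by metis
    thus ?case using adjoin_subset \<theta> by (intro exI[of _ \<gamma>]) blast
  qed auto
  then obtain \<theta> where \<theta>: "B \<subseteq> adjoin \<theta>" by auto
  have "x \<in> adjoin \<theta>" if "x \<in> qvs.span B" for x
    using that
  proof (induction x rule: qvs.span_induct_alt)
    case (step c b x)
    hence "of_rat c * b \<in> adjoin \<theta>" using \<theta> adjoin_closed(4,7) by blast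
    thus ?case using step adjoin_closed(5) by blast
  qed (rule adjoin_closed)
  hence UN: "adjoin \<theta> = UNIV" using B(2) by auto
  obtain n where n: "n > 0" "algebraic_int (of_nat n * \<theta>)"
    using algebraic_multiple_integral[OF alg] .
  have "of_rat (1 / of_nat n) * (of_nat n * \<theta>) = \<theta>" using n by (simp add: of_rat_divide)
  hence "\<theta> \<in> adjoin (of_nat n * \<theta>)" using adjoin_closed by metis
  hence "adjoin (of_nat n * \<theta>) = UNIV" using adjoin_subset UN by blast
  thus ?thesis using that n by blast
qed

section \<open>Complex embeddings and the norm\<close>

context
  fixes \<sigma> :: "'k::field_char_0 \<Rightarrow> complex"
  assumes \<sigma>: "\<sigma> \<in> complex_embeddings"
begin

lemma embedding_field_hom: "field_hom \<sigma>"
proof -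
  have "\<sigma> (0 + 0) = \<sigma> 0 + \<sigma> 0" using \<sigma> by (simp only: complex_embeddings_def mem_Collect_eq)
  thus ?thesis using \<sigma> by unfold_locales (auto simp: complex_embeddings_def)
qed

interpretation h: field_hom \<sigma>
  by (rule embedding_field_hom)

lemmas rat_hom = rpoly_of_rat_hom[of \<sigma>, OF h.hom_one h.hom_add h.hom_mult]

lemma complex_embeddings_D:
  shows "\<sigma> 1 = 1" "\<sigma> (x + y) = \<sigma> x + \<sigma> y" "\<sigma> (x * y) = \<sigma> x * \<sigma> y" "\<sigma> 0 = 0"
    "\<sigma> (x - y) = \<sigma> x - \<sigma> y" "\<sigma> (of_rat q) = of_rat q" "\<sigma> (rpoly p x) = rpoly p (\<sigma> x)"
    "\<sigma> (x ^ n) = \<sigma> x ^ n" "\<sigma> x = 0 \<longleftrightarrow> x = 0" "\<sigma> (x / y) = \<sigma> x / \<sigma> y"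
    "\<sigma> (sum f A) = (\<Sum>i\<in>A. \<sigma> (f i))" "\<sigma> (of_int z) = of_int z" "\<sigma> (of_nat n) = of_nat n"
  using rat_hom rat_hom(2)[of "of_int z"] rat_hom(2)[of "of_nat n"]
  by (simp_all add: h.hom_add h.hom_mult h.hom_minus h.hom_power h.hom_div h.hom_sum)

end

lemma embedding_algebraic_int:
  assumes "\<sigma> \<in> complex_embeddings" "algebraic_int x"
  shows "algebraic_int (\<sigma> x)"
proof -
  obtain p where p: "poly (map_poly of_int p) x = 0" "lead_coeff p = 1"
    using assms(2) by (auto simp: algebraic_int_altdef_ipoly)
  have "\<sigma> (rpoly (map_poly of_int p) x) = rpoly (map_poly of_int p) (\<sigma> x)"
    by (rule complex_embeddings_D(7)[OF assms(1)])
  hence "poly (map_poly of_int p) (\<sigma> x) = 0"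
    using p(1) complex_embeddings_D(4)[OF assms(1)]
    by (simp add: rpoly_def map_poly_map_poly o_def)
  thus ?thesis using p(2) by (auto simp: algebraic_int_altdef_ipoly)
qed

lemma cnj_embedding:
  "\<sigma> \<in> complex_embeddings \<Longrightarrow> (\<lambda>x. cnj (\<sigma> x)) \<in> complex_embeddings"
  by (auto simp: complex_embeddings_def)

text \<open>One integral generator governs all that follows: its powers below the degree are a
  rational basis, they lie in the ring of integers, and the complex embeddings correspond to the
  complex roots of \<open>m\<close>.\<close>

locale primitive_gen =
  fixes \<theta> :: "'k::field_char_0" and m :: "rat poly"
  assumes integral: "algebraic_int \<theta>" and gen: "adjoin \<theta> = UNIV" and min: "is_minpoly m \<theta>"
    and nf: "number_field TYPE('k)"
begin

definition deg :: nat where "deg = degree m"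

lemma deg_pos: "deg > 0"
  using minpoly_degree_pos[OF min] by (simp add: deg_def)

definition rep :: "'k \<Rightarrow> rat poly" where "rep x = (SOME p. rpoly p \<theta> = x) mod m"

lemma rpoly_mod: "rpoly m z = 0 \<Longrightarrow> rpoly (p mod m) z = rpoly p z"
proof -
  assume "rpoly m z = 0"
  moreover have "rpoly p z = rpoly (p div m) z * rpoly m z + rpoly (p mod m) z"
    unfolding rpoly_mult[symmetric] rpoly_add[symmetric] by simp
  ultimately show ?thesis by simp
qed

lemma m_root: "rpoly m \<theta> = 0" and m_nz: "m \<noteq> 0"
  using min by (auto simp: is_minpoly_def)

lemma rep: "rpoly (rep x) \<theta> = x" and degree_rep: "degree (rep x) < deg"
proof -
  have "\<exists>p. rpoly p \<theta> = x" using gen by (metis adjoin_def rangeE UNIV_I)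
  hence "rpoly (SOME p. rpoly p \<theta> = x) \<theta> = x" by (rule someI_ex)
  thus "rpoly (rep x) \<theta> = x" by (simp add: rep_def rpoly_mod m_root)
  show "degree (rep x) < deg"
    using degree_mod_less[OF m_nz, of "SOME p. rpoly p \<theta> = x"] deg_pos
    by (auto simp: rep_def deg_def)
qed

lemma rpoly_cong:
  assumes "rpoly p \<theta> = rpoly q \<theta>" "rpoly m z = 0"
  shows "rpoly p z = rpoly q z"
proof -
  have "rpoly (p - q) \<theta> = 0" using assms by simp
  then obtain r where "p - q = m * r" using minpoly_dvd[OF min] by (metis dvdE)
  from arg_cong[OF this, of "\<lambda>p. rpoly p z"] show ?thesis using assms(2) by simp
qed

lemma rep_eq: "rpoly m z = 0 \<Longrightarrow> rpoly (rep (rpoly p \<theta>)) z = rpoly p z"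
  using rpoly_cong rep by blast

lemma expansion: "x = (\<Sum>i<deg. of_rat (coeff (rep x) i) * \<theta> ^ i)"
proof -
  have "x = (\<Sum>i\<le>degree (rep x). of_rat (coeff (rep x) i) * \<theta> ^ i)"
    using rep[of x] by (simp add: rpoly_altdef)
  also have "\<dots> = (\<Sum>i<deg. of_rat (coeff (rep x) i) * \<theta> ^ i)"
    using degree_rep[of x] by (intro sum.mono_neutral_left) (auto simp: coeff_eq_0)
  finally show ?thesis .
qed

lemma powers_independent:
  assumes "(\<Sum>i<deg. of_rat (c i) * \<theta> ^ i) = 0" "i < deg"
  shows "c i = 0"
proof -
  define p where "p = (\<Sum>i<deg. Polynomial.monom (c i) i)"
  have cp: "coeff p j = (if j < deg then c j else 0)" for j
    by (simp add: p_def coeff_sum)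
  have "rpoly p \<theta> = 0" using assms by (simp add: p_def)
  moreover have "degree p < deg \<or> p = 0"
    using deg_pos degree_le[of "deg - 1" p] by (force simp: cp)
  ultimately have "p = 0" using min by (auto simp: is_minpoly_def deg_def)
  thus ?thesis using cp[of i] assms(2) by simp
qed

lemma inj_powers: "inj_on (\<lambda>i. \<theta> ^ i) {..<deg}"
proof (rule inj_onI, rule ccontr)
  fix i j assume ij: "i \<in> {..<deg}" "j \<in> {..<deg}" "\<theta> ^ i = \<theta> ^ j" "i \<noteq> j"
  have "(\<Sum>l<deg. of_rat ((if l = i then 1 else 0) - (if l = j then 1 else 0)) * \<theta> ^ l)
      = (\<Sum>l<deg. (if l = i then \<theta> ^ l else 0)) - (\<Sum>l<deg. (if l = j then \<theta> ^ l else 0))"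
    unfolding sum_subtractf[symmetric] by (intro sum.cong) (auto simp: of_rat_diff)
  also have "\<dots> = 0" using ij by simp
  finally show False using powers_independent[of _ i] ij by force
qed

lemma field_degree_eq: "field_degree TYPE('k) = deg"
proof -
  let ?S = "(\<lambda>i. \<theta> ^ i) ` {..<deg}"
  have ind: "qvs.independent ?S"
  proof (rule qvs.independent_if_scalars_zero)
    fix f x assume "(\<Sum>y\<in>?S. of_rat (f y) * y) = 0" and x: "x \<in> ?S"
    hence "(\<Sum>i<deg. of_rat (f (\<theta> ^ i)) * \<theta> ^ i) = 0" by (simp add: sum.reindex[OF inj_powers])
    from powers_independent[OF this] show "f x = 0" using x by auto
  qed simp
  have "x \<in> qvs.span ?S" for x
    by (subst expansion) (intro qvs.span_sum qvs.span_scale qvs.span_base, auto)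
  hence "qvs.span ?S = UNIV" by auto
  hence "qvs.dim (UNIV :: 'k set) = card ?S"
    using qvs.dim_eq_card[of ?S UNIV] ind by simp
  thus ?thesis unfolding field_degree_def by (simp add: card_image inj_powers)
qed

definition emb :: "complex \<Rightarrow> 'k \<Rightarrow> complex" where "emb z x = rpoly (rep x) z"

lemma emb_rpoly: "rpoly m z = 0 \<Longrightarrow> emb z (rpoly p \<theta>) = rpoly p z"
  by (simp add: emb_def rep_eq)

lemma emb_gen: "rpoly m z = 0 \<Longrightarrow> emb z \<theta> = z"
  using emb_rpoly[of z "[:0, 1:]"] by simp

lemma emb_embedding: "rpoly m z = 0 \<Longrightarrow> emb z \<in> complex_embeddings"
proof -
  assume z: "rpoly m z = 0"
  note E = emb_rpoly[OF z]
  have "emb z (x + y) = emb z x + emb z y" "emb z (x * y) = emb z x * emb z y" for x y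
    using E[of "rep x + rep y"] E[of "rep x * rep y"] E[of "rep x"] E[of "rep y"] by (simp_all add: rep)
  thus ?thesis using E[of 1] by (auto simp: complex_embeddings_def)
qed

lemma embedding_eq_emb: "\<sigma> \<in> complex_embeddings \<Longrightarrow> \<sigma> = emb (\<sigma> \<theta>) \<and> rpoly m (\<sigma> \<theta>) = 0"
proof
  assume s: "\<sigma> \<in> complex_embeddings"
  show z: "rpoly m (\<sigma> \<theta>) = 0"
    using complex_embeddings_D(7)[OF s, of m \<theta>] complex_embeddings_D(4)[OF s] m_root by simp
  show "\<sigma> = emb (\<sigma> \<theta>)"
    using complex_embeddings_D(7)[OF s] rep by (metis emb_def ext)
qed

lemma embeddings_determined:
  "\<sigma> \<in> complex_embeddings \<Longrightarrow> \<tau> \<in> complex_embeddings \<Longrightarrow> \<sigma> \<theta> = \<tau> \<theta> \<Longrightarrow> \<sigma> = \<tau>"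
  using embedding_eq_emb by metis

text \<open>Separability makes all complex roots simple, so there are as many as the degree. Through
  \<open>embeddings_bij\<close> this counts the embeddings.\<close>

lemma card_m_roots: "finite {z::complex. rpoly m z = 0}" "card {z::complex. rpoly m z = 0} = deg"
proof -
  define M where "M = (map_poly of_rat m :: complex poly)"
  have nz: "M \<noteq> 0" using m_nz by (simp add: M_def)
  show fin: "finite {z::complex. rpoly m z = 0}"
    unfolding rpoly_def M_def[symmetric] by (rule poly_roots_finite[OF nz])
  have "rsquarefree M"
    unfolding rsquarefree_roots M_def using minpoly_separable[OF min]
    by (metis rpoly_def rpoly_pderiv)
  hence "M = smult (lead_coeff M) (\<Prod>z|poly M z = 0. [:-z, 1:])"
    using complex_poly_decompose_rsquarefree by metis
  hence "degree M = degree (\<Prod>z|poly M z = 0. [:-z, 1:])"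
    using nz by (metis degree_smult_eq leading_coeff_0_iff)
  also have "\<dots> = card {z. poly M z = 0}"
    by (subst degree_prod_sum_eq) auto
  finally show "card {z::complex. rpoly m z = 0} = deg"
    by (simp add: rpoly_def M_def deg_def)
qed

lemma embeddings_bij: "bij_betw emb {z. rpoly m z = 0} complex_embeddings"
  unfolding bij_betw_def
proof
  show "inj_on emb {z. rpoly m z = 0}"
  proof (rule inj_onI)
    fix y z assume "y \<in> {z. rpoly m z = 0}" "z \<in> {z. rpoly m z = 0}" and eq: "emb y = emb z"
    hence "emb y \<theta> = y" "emb z \<theta> = z" using emb_gen by blast+
    thus "y = z" using fun_cong[OF eq, of \<theta>] by metis
  qed
  show "emb ` {z. rpoly m z = 0} = complex_embeddings"
  proof (intro equalityI subsetI)
    fix \<sigma> :: "'k \<Rightarrow> complex" assume "\<sigma> \<in> complex_embeddings"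
    from embedding_eq_emb[OF this] show "\<sigma> \<in> emb ` {z. rpoly m z = 0}"
      unfolding image_iff by blast
  next
    fix \<sigma> assume "\<sigma> \<in> emb ` {z. rpoly m z = 0}"
    thus "\<sigma> \<in> complex_embeddings" using emb_embedding by blast
  qed
qed

lemma finite_embeddings: "finite (complex_embeddings :: ('k \<Rightarrow> complex) set)"
  and card_embeddings: "card (complex_embeddings :: ('k \<Rightarrow> complex) set) = deg"
  using embeddings_bij card_m_roots bij_betw_finite bij_betw_same_card by metis+

text \<open>The moduli of z and z + 1 determine the real part of z and its imaginary part up to
  sign. Comparing at \<theta> and \<theta> + 1 is therefore enough.\<close>

lemma same_abs:
  assumes s: "\<sigma> \<in> complex_embeddings" and t: "\<tau> \<in> complex_embeddings"
    and eq: "\<And>x::'k. cmod (\<sigma> x) = cmod (\<tau> x)"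
  shows "\<tau> = \<sigma> \<or> \<tau> = (\<lambda>x. cnj (\<sigma> x))"
proof -
  have "cmod (\<sigma> \<theta> + 1) = cmod (\<tau> \<theta> + 1)"
    using eq[of "\<theta> + 1"] by (simp add: complex_embeddings_D[OF s] complex_embeddings_D[OF t])
  hence a: "(Re (\<sigma> \<theta>) + 1)\<^sup>2 + (Im (\<sigma> \<theta>))\<^sup>2 = (Re (\<tau> \<theta>) + 1)\<^sup>2 + (Im (\<tau> \<theta>))\<^sup>2"
    by (metis cmod_power2 plus_complex.simps one_complex.simps add.right_neutral)
  have b: "(Re (\<sigma> \<theta>))\<^sup>2 + (Im (\<sigma> \<theta>))\<^sup>2 = (Re (\<tau> \<theta>))\<^sup>2 + (Im (\<tau> \<theta>))\<^sup>2"
    using eq[of \<theta>] by (metis cmod_power2)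
  have re: "Re (\<tau> \<theta>) = Re (\<sigma> \<theta>)" using a b by (simp add: power2_eq_square algebra_simps)
  hence "(Im (\<tau> \<theta>))\<^sup>2 = (Im (\<sigma> \<theta>))\<^sup>2" using b by simp
  hence "\<tau> \<theta> = \<sigma> \<theta> \<or> \<tau> \<theta> = cnj (\<sigma> \<theta>)"
    using re by (auto simp: power2_eq_iff complex_eq_iff)
  thus ?thesis using embeddings_determined[OF t s] embeddings_determined[OF t cnj_embedding[OF s]] by auto
qed

text \<open>The embeddings inducing the same absolute value are \<sigma> and its complex conjugate,
  and these two coincide exactly when \<sigma> is real.\<close>

lemma arch_local_degree_eq:
  assumes s: "\<sigma> \<in> complex_embeddings"
  shows "card {\<tau> \<in> complex_embeddings. (\<lambda>x::'k. cmod (\<tau> x)) = (\<lambda>x. cmod (\<sigma> x))}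
    = arch_local_degree (\<lambda>x. cmod (\<sigma> x))" (is "card ?F = _")
proof -
  have F: "?F = {\<sigma>, \<lambda>x. cnj (\<sigma> x)}"
  proof
    show "?F \<subseteq> {\<sigma>, \<lambda>x. cnj (\<sigma> x)}"
    proof
      fix \<tau> assume "\<tau> \<in> ?F"
      hence t: "\<tau> \<in> complex_embeddings" "\<And>x. cmod (\<sigma> x) = cmod (\<tau> x)" by (auto simp: fun_eq_iff)
      from same_abs[OF s this] show "\<tau> \<in> {\<sigma>, \<lambda>x. cnj (\<sigma> x)}" by auto
    qed
    show "{\<sigma>, \<lambda>x. cnj (\<sigma> x)} \<subseteq> ?F" using s cnj_embedding[OF s] by auto
  qed
  have real_iff: "(\<lambda>x. cnj (\<tau> x)) = \<tau> \<longleftrightarrow> range \<tau> \<subseteq> \<real>" for \<tau> :: "'k \<Rightarrow> complex"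
    by (auto simp: fun_eq_iff Reals_cnj_iff image_subset_iff)
  have "(\<exists>\<tau>\<in>complex_embeddings. range \<tau> \<subseteq> \<real> \<and> (\<lambda>x. cmod (\<sigma> x)) = (\<lambda>x. cmod (\<tau> x)))
      \<longleftrightarrow> (\<exists>\<tau>\<in>?F. (\<lambda>x. cnj (\<tau> x)) = \<tau>)"
    unfolding real_iff by (auto simp: eq_commute)
  also have "\<dots> \<longleftrightarrow> (\<lambda>x. cnj (\<sigma> x)) = \<sigma>"
    unfolding F by (auto simp: fun_eq_iff)
  finally show ?thesis unfolding F arch_local_degree_def by auto
qed

text \<open>Grouping the embeddings by the place they induce turns local degrees into
  multiplicities. From here on the archimedean part of a height is a plain product over
  embeddings.\<close>

lemma prod_arch_places:
  fixes F :: "('k \<Rightarrow> real) \<Rightarrow> 'c::comm_monoid_mult"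
  shows "(\<Prod>v\<in>arch_places. F v ^ arch_local_degree v) = (\<Prod>\<sigma>\<in>complex_embeddings. F (\<lambda>x. cmod (\<sigma> x)))"
proof -
  let ?g = "\<lambda>\<sigma> x. cmod (\<sigma> (x::'k))"
  have "(\<Prod>\<sigma>\<in>complex_embeddings. F (?g \<sigma>))
      = (\<Prod>v\<in>?g ` complex_embeddings. \<Prod>\<sigma>\<in>{\<sigma> \<in> complex_embeddings. ?g \<sigma> = v}. F (?g \<sigma>))"
    by (rule prod.image_gen[OF finite_embeddings])
  also have "\<dots> = (\<Prod>v\<in>?g ` complex_embeddings. F v ^ arch_local_degree v)"
  proof (rule prod.cong[OF refl])
    fix v assume "v \<in> ?g ` complex_embeddings"
    then obtain \<sigma> where s: "\<sigma> \<in> complex_embeddings" "v = ?g \<sigma>" by auto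
    have "(\<Prod>\<tau>\<in>{\<tau> \<in> complex_embeddings. ?g \<tau> = v}. F (?g \<tau>)) = (\<Prod>\<tau>\<in>{\<tau> \<in> complex_embeddings. ?g \<tau> = v}. F v)"
      by (rule prod.cong) auto
    also have "\<dots> = F v ^ arch_local_degree v"
      using arch_local_degree_eq[OF s(1)] s(2) by simp
    finally show "(\<Prod>\<tau>\<in>{\<tau> \<in> complex_embeddings. ?g \<tau> = v}. F (?g \<tau>)) = F v ^ arch_local_degree v" .
  qed
  finally show ?thesis by (simp add: arch_places_def)
qed

text \<open>Multiplication by \<open>a\<close> has a rational matrix in the basis of powers of \<open>\<theta>\<close>, which the
  Vandermonde matrix of the conjugates of \<open>\<theta>\<close> diagonalises; its determinant is the norm.\<close>

lemma norm_rational: "(\<Prod>\<sigma>\<in>complex_embeddings. \<sigma> (a::'k)) \<in> \<rat>"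
proof -
  define N where "N = deg"
  obtain \<sigma>s where ss: "set \<sigma>s = (complex_embeddings :: ('k \<Rightarrow> complex) set)" "distinct \<sigma>s"
    using finite_embeddings finite_distinct_list by blast
  have len: "length \<sigma>s = N" using ss card_embeddings by (metis N_def distinct_card)
  have mem: "\<sigma>s ! i \<in> complex_embeddings" if "i < N" for i using that ss len nth_mem by metis
  define V where "V = Matrix.mat N N (\<lambda>(j, i). (\<sigma>s ! j) \<theta> ^ i)"
  define MQ where "MQ = Matrix.mat N N (\<lambda>(i, l). coeff (rep (a * \<theta> ^ l)) i)"
  define M where "M = map_mat (of_rat :: rat \<Rightarrow> complex) MQ"
  define D where "D = Matrix.mat N N (\<lambda>(i, j). if i = j then (\<sigma>s ! i) a else 0)"
  have c: "V \<in> carrier_mat N N" "M \<in> carrier_mat N N" "D \<in> carrier_mat N N" "MQ \<in> carrier_mat N N"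
    by (auto simp: V_def M_def D_def MQ_def)
  have "V * M = D * V"
  proof (rule eq_matI)
    fix j l assume "j < dim_row (D * V)" "l < dim_col (D * V)"
    hence jl: "j < N" "l < N" using c by auto
    note s = complex_embeddings_D[OF mem[OF jl(1)]]
    have "(V * M) $$ (j, l) = (\<Sum>i<N. (\<sigma>s ! j) \<theta> ^ i * of_rat (coeff (rep (a * \<theta> ^ l)) i))"
      using jl by (simp add: V_def M_def MQ_def scalar_prod_def atLeast0LessThan)
    also have "\<dots> = (\<sigma>s ! j) (\<Sum>i<N. of_rat (coeff (rep (a * \<theta> ^ l)) i) * \<theta> ^ i)"
      by (simp add: s mult.commute)
    also have "\<dots> = (\<sigma>s ! j) a * (\<sigma>s ! j) \<theta> ^ l"
      unfolding N_def by (subst expansion[symmetric]) (simp add: s)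
    also have "\<dots> = (\<Sum>i<N. if j = i then (\<sigma>s ! j) a * (\<sigma>s ! i) \<theta> ^ l else 0)"
      using jl by simp
    also have "\<dots> = (\<Sum>i<N. (if j = i then (\<sigma>s ! j) a else 0) * (\<sigma>s ! i) \<theta> ^ l)"
      by (intro sum.cong) auto
    also have "\<dots> = (D * V) $$ (j, l)"
      using jl by (simp add: D_def V_def scalar_prod_def atLeast0LessThan)
    finally show "(V * M) $$ (j, l) = (D * V) $$ (j, l)" .
  qed (use c in auto)
  hence "Determinant.det V * Determinant.det M = Determinant.det D * Determinant.det V"
    using det_mult c by metis
  \<comment> \<open>A vector in the kernel lists the coefficients of a polynomial of degree less
    than \<open>N\<close> that vanishes at the \<open>N\<close> distinct conjugates of
    \<theta>.\<close>
  moreover have "Determinant.det V \<noteq> 0"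
  proof
    assume "Determinant.det V = 0"
    then obtain v where v: "v \<in> carrier_vec N" "v \<noteq> 0\<^sub>v N" "V *\<^sub>v v = 0\<^sub>v N"
      using det_0_iff_vec_prod_zero[OF c(1)] by auto
    define p where "p = (\<Sum>i<N. Polynomial.monom (vec_index v i) i)"
    have cp: "coeff p i = (if i < N then vec_index v i else 0)" for i
      by (simp add: p_def coeff_sum)
    have "poly p ((\<sigma>s ! j) \<theta>) = 0" if "j < N" for j
    proof -
      have "0 = vec_index (V *\<^sub>v v) j" using v that by simp
      also have "\<dots> = (\<Sum>i<N. (\<sigma>s ! j) \<theta> ^ i * vec_index v i)"
        using that v(1) by (simp add: V_def scalar_prod_def atLeast0LessThan)
      finally show ?thesis by (simp add: p_def poly_sum poly_monom mult.commute)
    qed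
    hence sub: "(\<lambda>\<sigma>. \<sigma> \<theta>) ` complex_embeddings \<subseteq> {z. poly p z = 0}"
      unfolding ss(1)[symmetric] using len by (auto simp: in_set_conv_nth)
    have "inj_on (\<lambda>\<sigma>. \<sigma> \<theta>) complex_embeddings"
      using embeddings_determined by (auto simp: inj_on_def)
    hence card: "card ((\<lambda>\<sigma>. \<sigma> \<theta>) ` complex_embeddings) = N"
      by (simp add: card_image card_embeddings N_def)
    have "N \<le> degree p" if "p \<noteq> 0"
      using card_mono[OF poly_roots_finite[OF that] sub] card_poly_roots_bound[OF that] card by linarith
    moreover have "degree p < N"
      using degree_le[of "N - 1" p] deg_pos by (force simp: cp N_def)
    ultimately have "p = 0" by linarith
    hence "vec_index v i = 0" if "i < N" for i using cp[of i] that by simp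
    hence "v = 0\<^sub>v N" using v(1) by auto
    thus False using v by simp
  qed
  ultimately have "Determinant.det M = Determinant.det D" by simp
  also have "\<dots> = prod_list (diag_mat D)"
    by (rule det_upper_triangular[OF _ c(3)]) (auto simp: D_def)
  also have "diag_mat D = map (\<lambda>\<sigma>. \<sigma> a) \<sigma>s"
    by (rule nth_equalityI) (auto simp: diag_mat_def D_def len)
  also have "prod_list (map (\<lambda>\<sigma>. \<sigma> a) \<sigma>s) = (\<Prod>\<sigma>\<in>complex_embeddings. \<sigma> a)"
    using ss by (metis prod.distinct_set_conv_list)
  also have "Determinant.det M = of_rat (Determinant.det MQ)"
    by (simp add: M_def of_rat_hom.hom_det)
  finally show ?thesis by (metis Rats_of_rat)
qed

text \<open>The norm is rational and an algebraic integer, hence an ordinary integer, and it is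
  nonzero. This gap above 0 drives both later counting arguments.\<close>

lemma norm_ge_1:
  assumes "algebraic_int (a::'k)" "a \<noteq> 0"
  shows "(\<Prod>\<sigma>\<in>complex_embeddings. cmod (\<sigma> a)) \<ge> 1"
proof -
  have "algebraic_int (\<Prod>\<sigma>\<in>complex_embeddings. \<sigma> a)"
    using embedding_algebraic_int assms(1) by auto
  then obtain z where z: "(\<Prod>\<sigma>\<in>complex_embeddings. \<sigma> a) = of_int z"
    using rational_algebraic_int_is_int norm_rational by (metis Ints_cases)
  have "(\<Prod>\<sigma>\<in>complex_embeddings. \<sigma> a) \<noteq> 0"
    using finite_embeddings complex_embeddings_D(9) assms(2) by (auto simp: prod_zero_iff)
  hence "z \<noteq> 0" using z by auto
  hence "cmod (of_int z) \<ge> 1" by simp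
  thus ?thesis unfolding z[symmetric] by (simp add: prod_norm)
qed

end

lemma primitive_gen_exists:
  assumes "number_field TYPE('k)"
  obtains \<theta> :: "'k::field_char_0" and m where "primitive_gen \<theta> m"
proof -
  obtain \<theta> :: 'k where t: "algebraic_int \<theta>" "adjoin \<theta> = UNIV" using primitive_element[OF assms] .
  obtain m where "is_minpoly m \<theta>" using minpoly_exists number_field_algebraic[OF assms] by blast
  thus ?thesis using that t assms by (simp add: primitive_gen_def)
qed

section \<open>Residues modulo integers\<close>

definition add_closed :: "'a::ab_group_add set \<Rightarrow> bool" where
  "add_closed B \<longleftrightarrow> 0 \<in> B \<and> (\<forall>x\<in>B. \<forall>y\<in>B. x - y \<in> B)"

text \<open>For \<open>B\<close> inside \<open>A\<close> this is the quotient A/B, so its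
  cardinality is the index. Working with sets lets both groups vary within one type.\<close>

definition cosets :: "'a::ab_group_add set \<Rightarrow> 'a set \<Rightarrow> 'a set set" where
  "cosets A B = (\<lambda>x. (+) x ` B) ` A"

lemma add_closedD:
  assumes "add_closed B"
  shows "0 \<in> B" "x \<in> B \<Longrightarrow> y \<in> B \<Longrightarrow> x - y \<in> B" "x \<in> B \<Longrightarrow> - x \<in> B" "x \<in> B \<Longrightarrow> y \<in> B \<Longrightarrow> x + y \<in> B"
proof -
  show z: "0 \<in> B" and d: "x \<in> B \<Longrightarrow> y \<in> B \<Longrightarrow> x - y \<in> B" for x y
    using assms by (auto simp: add_closed_def)
  show n: "x \<in> B \<Longrightarrow> - x \<in> B" for x using d[OF z] by simp
  show "x \<in> B \<Longrightarrow> y \<in> B \<Longrightarrow> x + y \<in> B" using d[of x "- y"] n[of y] by simp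
qed

lemma coset_eq_iff:
  assumes "add_closed B"
  shows "(+) x ` B = (+) y ` B \<longleftrightarrow> x - y \<in> B"
proof
  assume "(+) x ` B = (+) y ` B"
  moreover have "x \<in> (+) x ` B" using add_closedD(1)[OF assms] by force
  ultimately obtain b where "b \<in> B" "x = y + b" by auto
  thus "x - y \<in> B" by simp
next
  assume d: "x - y \<in> B"
  have "(+) x ` B \<subseteq> (+) y ` B" if "x - y \<in> B" for x y
  proof
    fix z assume "z \<in> (+) x ` B"
    then obtain b where b: "b \<in> B" "z = x + b" by auto
    have "z = y + ((x - y) + b)" using b by simp
    thus "z \<in> (+) y ` B" using add_closedD(4)[OF assms that b(1)] by blast
  qed
  moreover have "y - x \<in> B" using add_closedD(3)[OF assms d] by simp
  ultimately show "(+) x ` B = (+) y ` B" using d by blast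
qed

lemma transversal:
  assumes "add_closed B"
  obtains R where "R \<subseteq> A" "bij_betw (\<lambda>x. (+) x ` B) R (cosets A B)"
    "\<forall>x\<in>A. \<exists>r\<in>R. x - r \<in> B"
proof -
  obtain R where R: "R \<subseteq> A" "inj_on (\<lambda>x. (+) x ` B) R" "cosets A B = (\<lambda>x. (+) x ` B) ` R"
    using subset_image_inj[of "cosets A B" "\<lambda>x. (+) x ` B" A] by (auto simp: cosets_def)
  have "\<exists>r\<in>R. x - r \<in> B" if "x \<in> A" for x
  proof -
    have "(+) x ` B \<in> (\<lambda>x. (+) x ` B) ` R" using that R(3) by (auto simp: cosets_def)
    then obtain r where "r \<in> R" "(+) x ` B = (+) r ` B" by blast
    thus ?thesis using coset_eq_iff[OF assms] by blast
  qed
  thus ?thesis using that R by (auto simp: bij_betw_def)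
qed

lemma finite_cosetsI:
  assumes "add_closed B" "finite R" "\<And>x. x \<in> A \<Longrightarrow> \<exists>r\<in>R. x - r \<in> B"
  shows "finite (cosets A B)" "card (cosets A B) \<le> card R"
proof -
  have "cosets A B \<subseteq> (\<lambda>x. (+) x ` B) ` R"
    unfolding cosets_def using assms(3) coset_eq_iff[OF assms(1)] by (auto simp: image_iff)
  thus "finite (cosets A B)" "card (cosets A B) \<le> card R"
    using assms(2) by (auto intro: finite_subset surj_card_le)
qed

lemma finite_cosets_mono:
  assumes "add_closed B" "add_closed B'" "B \<subseteq> B'" "A' \<subseteq> A" "finite (cosets A B)"
  shows "finite (cosets A' B')"
proof -
  obtain R where R: "R \<subseteq> A" "bij_betw (\<lambda>x. (+) x ` B) R (cosets A B)"
    "\<forall>x\<in>A. \<exists>r\<in>R. x - r \<in> B" by (rule transversal[OF assms(1)])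
  have "finite R" using R(2) assms(5) bij_betw_finite by blast
  thus ?thesis by (rule finite_cosetsI(1)[OF assms(2)]) (use R(3) assms(3,4) in blast)
qed

text \<open>Sums of a representative of A/B and one of B/C represent A/C, each class exactly
  once.\<close>

lemma card_cosets_tower:
  assumes A: "add_closed A" and B: "add_closed B" and C: "add_closed C" and sub: "C \<subseteq> B" "B \<subseteq> A"
    and fin: "finite (cosets A B)" "finite (cosets B C)"
  shows "finite (cosets A C)" "card (cosets A C) = card (cosets A B) * card (cosets B C)"
proof -
  obtain R where R: "R \<subseteq> A" "bij_betw (\<lambda>x. (+) x ` B) R (cosets A B)"
    "\<forall>x\<in>A. \<exists>r\<in>R. x - r \<in> B" by (rule transversal[OF B])
  obtain T where T: "T \<subseteq> B" "bij_betw (\<lambda>x. (+) x ` C) T (cosets B C)"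
    "\<forall>x\<in>B. \<exists>r\<in>T. x - r \<in> C" by (rule transversal[OF C])
  have finRT: "finite R" "finite T" using R(2) T(2) fin bij_betw_finite by blast+
  let ?h = "\<lambda>(r, t). (+) (r + t) ` C"
  have "inj_on ?h (R \<times> T)"
  proof (rule inj_onI)
    fix p q assume "p \<in> R \<times> T" "q \<in> R \<times> T" and eq: "?h p = ?h q"
    then obtain r t r' t' where pq: "p = (r, t)" "q = (r', t')"
      and m: "r \<in> R" "t \<in> T" "r' \<in> R" "t' \<in> T" by auto
    hence "(+) (r + t) ` C = (+) (r' + t') ` C" using eq by simp
    hence d: "(r + t) - (r' + t') \<in> C" using coset_eq_iff[OF C] by blast
    have "t - t' \<in> B" using m T(1) by (intro add_closedD(2)[OF B]) auto
    moreover have "(r + t) - (r' + t') \<in> B" using d sub(1) by auto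
    ultimately have "((r + t) - (r' + t')) - (t - t') \<in> B" by (rule add_closedD(2)[OF B, rotated])
    hence "r - r' \<in> B" by (simp add: algebra_simps)
    hence "(+) r ` B = (+) r' ` B" using coset_eq_iff[OF B] by blast
    hence rr: "r = r'" using R(2) m by (auto simp: bij_betw_def inj_on_def)
    hence "t - t' \<in> C" using d by simp
    hence "(+) t ` C = (+) t' ` C" using coset_eq_iff[OF C] by blast
    hence "t = t'" using T(2) m by (auto simp: bij_betw_def inj_on_def)
    thus "p = q" using rr pq by blast
  qed
  moreover have "?h ` (R \<times> T) = cosets A C"
  proof
    show "?h ` (R \<times> T) \<subseteq> cosets A C"
      unfolding cosets_def using R(1) T(1) sub by (force intro!: imageI add_closedD(4)[OF A])
    show "cosets A C \<subseteq> ?h ` (R \<times> T)"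
    proof
      fix K assume "K \<in> cosets A C"
      then obtain x where x: "x \<in> A" "K = (+) x ` C" by (auto simp: cosets_def)
      obtain r where r: "r \<in> R" "x - r \<in> B" using R(3) x by blast
      obtain t where t: "t \<in> T" "(x - r) - t \<in> C" using T(3) r by blast
      have "x - (r + t) \<in> C" using t by (simp add: algebra_simps)
      hence "K = ?h (r, t)" using coset_eq_iff[OF C] x by auto
      thus "K \<in> ?h ` (R \<times> T)" using r t by blast
    qed
  qed
  ultimately have "bij_betw ?h (R \<times> T) (cosets A C)" by (simp add: bij_betw_def)
  hence "finite (cosets A C)" "card (cosets A C) = card R * card T"
    using bij_betw_finite[of ?h "R \<times> T" "cosets A C"] bij_betw_same_card[of ?h "R \<times> T" "cosets A C"]
      finRT card_cartesian_product[of R T] by simp_all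
  thus "finite (cosets A C)" "card (cosets A C) = card (cosets A B) * card (cosets B C)"
    using R(2) T(2) bij_betw_same_card by metis+
qed

text \<open>The assumptions say that \<open>h\<close> induces a bijection from A/B to A'/B'. Later
  \<open>h\<close> is multiplication by a fixed element, which carries the residue field of a prime
  onto a quotient of two ideals.\<close>

lemma bij_cosets:
  fixes h :: "'a::ab_group_add \<Rightarrow> 'b::ab_group_add"
  assumes B: "add_closed B" "add_closed B'" and h: "\<And>x. x \<in> A \<Longrightarrow> h x \<in> A'"
    and ker: "\<And>x y. x \<in> A \<Longrightarrow> y \<in> A \<Longrightarrow> h x - h y \<in> B' \<longleftrightarrow> x - y \<in> B"
    and surj: "\<And>y. y \<in> A' \<Longrightarrow> \<exists>x\<in>A. y - h x \<in> B'"
  shows "finite (cosets A B) \<longleftrightarrow> finite (cosets A' B')" "card (cosets A B) = card (cosets A' B')"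
proof -
  obtain R where R: "R \<subseteq> A" "bij_betw (\<lambda>x. (+) x ` B) R (cosets A B)"
    "\<forall>x\<in>A. \<exists>r\<in>R. x - r \<in> B" by (rule transversal[OF B(1)])
  let ?h = "\<lambda>x. (+) (h x) ` B'"
  have "inj_on ?h R"
  proof (rule inj_onI)
    fix x y assume xy: "x \<in> R" "y \<in> R" "?h x = ?h y"
    hence "x - y \<in> B" using coset_eq_iff[OF B(2)] ker R(1) by blast
    hence "(+) x ` B = (+) y ` B" using coset_eq_iff[OF B(1)] by blast
    thus "x = y" using R(2) xy by (auto simp: bij_betw_def inj_on_def)
  qed
  moreover have "?h ` R = cosets A' B'"
  proof
    show "?h ` R \<subseteq> cosets A' B'" using h R(1) by (auto simp: cosets_def)
    show "cosets A' B' \<subseteq> ?h ` R"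
    proof
      fix K assume "K \<in> cosets A' B'"
      then obtain y where y: "y \<in> A'" "K = (+) y ` B'" by (auto simp: cosets_def)
      obtain x where x: "x \<in> A" "y - h x \<in> B'" using surj y by blast
      obtain r where r: "r \<in> R" "x - r \<in> B" using R(3) x by blast
      have "h x - h r \<in> B'" using ker x r R(1) by blast
      hence "(y - h x) + (h x - h r) \<in> B'" using x add_closedD(4)[OF B(2)] by blast
      hence "K = ?h r" using y coset_eq_iff[OF B(2)] by simp
      thus "K \<in> ?h ` R" using r by blast
    qed
  qed
  ultimately have "bij_betw ?h R (cosets A' B')" by (simp add: bij_betw_def)
  thus "finite (cosets A B) \<longleftrightarrow> finite (cosets A' B')" "card (cosets A B) = card (cosets A' B')"
    using R(2) bij_betw_finite bij_betw_same_card by metis+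
qed

abbreviation alg_ints :: "'a::field_char_0 set" where "alg_ints \<equiv> {x. algebraic_int x}"

lemma add_closed_ints: "add_closed (alg_ints :: 'a::field_char_0 set)"
  by (auto simp: add_closed_def)

definition multiples :: "'a::field_char_0 \<Rightarrow> 'a set" where "multiples a = (*) a ` alg_ints"

abbreviation residue_classes :: "'a::field_char_0 \<Rightarrow> 'a set set" where
  "residue_classes a \<equiv> cosets alg_ints (multiples a)"

lemma multiples_iff: "a \<noteq> 0 \<Longrightarrow> x \<in> multiples a \<longleftrightarrow> algebraic_int (x / a)"
  by (auto simp: multiples_def image_iff)

lemma add_closed_multiples: "add_closed (multiples a)"
  unfolding add_closed_def multiples_def
  by (auto simp: image_iff right_diff_distrib[symmetric] intro!: bexI[of _ 0])

lemma multiples_mult: "x \<in> multiples a \<Longrightarrow> algebraic_int y \<Longrightarrow> x * y \<in> multiples a"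
  by (auto simp: multiples_def image_iff mult.assoc intro: algebraic_int_mult)

section \<open>Finiteness and size of the residue rings\<close>

context primitive_gen
begin

abbreviation E :: "('k \<Rightarrow> complex) set" where "E \<equiv> complex_embeddings"

lemma all_algebraic: "algebraic (x::'k)"
  by (rule number_field_algebraic[OF nf])

text \<open>Each conjugate is located in a square of side 1/4. Two integers sharing all squares have
  a difference whose conjugates are at most 1/2, so its norm is below 1 and it vanishes. Only
  finitely many squares meet the bounded region.\<close>

lemma finite_bounded_ints:
  "finite {x::'k. algebraic_int x \<and> (\<forall>\<sigma>\<in>E. cmod (\<sigma> x) \<le> R)}" (is "finite ?S")
proof -
  define M where "M = \<lfloor>4 * \<bar>R\<bar>\<rfloor> + 1"
  define F where "F = (\<lambda>x::'k. \<lambda>\<sigma>\<in>E. (\<lfloor>4 * Re (\<sigma> x)\<rfloor>, \<lfloor>4 * Im (\<sigma> x)\<rfloor>))"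
  have fl: "\<lfloor>4 * r\<rfloor> \<in> {- M..M}" if "\<bar>r\<bar> \<le> R" for r
    using that unfolding M_def atLeastAtMost_iff by linarith
  have "F ` ?S \<subseteq> PiE E (\<lambda>_. {- M..M} \<times> {- M..M})"
  proof
    fix y assume "y \<in> F ` ?S"
    then obtain x where x: "y = F x" "\<forall>\<sigma>\<in>E. cmod (\<sigma> x) \<le> R" by auto
    have "\<bar>Re (\<sigma> x)\<bar> \<le> R" "\<bar>Im (\<sigma> x)\<bar> \<le> R" if "\<sigma> \<in> E" for \<sigma>
      using that x(2) abs_Re_le_cmod abs_Im_le_cmod order_trans by blast+
    thus "y \<in> PiE E (\<lambda>_. {- M..M} \<times> {- M..M})"
      unfolding x(1) F_def using fl by auto
  qed
  hence "finite (F ` ?S)"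
    by (rule finite_subset) (intro finite_PiE finite_embeddings, simp)
  moreover have "inj_on F ?S"
  proof (rule inj_onI, rule ccontr)
    fix x y assume x: "x \<in> ?S" and y: "y \<in> ?S" and eq: "F x = F y" and ne: "x \<noteq> y"
    have "cmod (\<sigma> (x - y)) \<le> 1 / 2" if s: "\<sigma> \<in> E" for \<sigma>
    proof -
      have "\<lfloor>4 * Re (\<sigma> x)\<rfloor> = \<lfloor>4 * Re (\<sigma> y)\<rfloor>" "\<lfloor>4 * Im (\<sigma> x)\<rfloor> = \<lfloor>4 * Im (\<sigma> y)\<rfloor>"
        using fun_cong[OF eq, of \<sigma>] s by (simp_all add: F_def)
      hence "\<bar>Re (\<sigma> x - \<sigma> y)\<bar> \<le> 1 / 4" "\<bar>Im (\<sigma> x - \<sigma> y)\<bar> \<le> 1 / 4"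
        unfolding minus_complex.simps by linarith+
      thus ?thesis using cmod_le[of "\<sigma> x - \<sigma> y"] by (simp add: complex_embeddings_D(5)[OF s])
    qed
    hence "(\<Prod>\<sigma>\<in>E. cmod (\<sigma> (x - y))) \<le> (\<Prod>\<sigma>\<in>E. 1 / 2)"
      by (intro prod_mono) auto
    also have "\<dots> = (1 / 2) ^ deg" by (simp add: card_embeddings)
    also have "\<dots> < 1" using deg_pos by (simp add: power_less_one_iff)
    finally show False using norm_ge_1[of "x - y"] x y ne by auto
  qed
  ultimately show ?thesis by (rule finite_imageD)
qed

text \<open>A bound for every conjugate of a combination of the powers of \<theta> below the degree,
  with rational coefficients of absolute value at most 1.\<close>

definition size_bound :: real where
  "size_bound = (\<Sum>\<sigma>\<in>E. \<Sum>i<deg. cmod (\<sigma> (\<theta> ^ i)))"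

lemma size_bound: "\<sigma> \<in> E \<Longrightarrow> (\<Sum>i<deg. cmod (\<sigma> (\<theta> ^ i))) \<le> size_bound"
  unfolding size_bound_def
  by (rule member_le_sum[where f = "\<lambda>\<sigma>. \<Sum>i<deg. cmod (\<sigma> (\<theta> ^ i))"]) (auto intro: sum_nonneg finite_embeddings)

lemma size_bound_comb:
  assumes "\<sigma> \<in> E" "\<And>i. i < deg \<Longrightarrow> \<bar>q i\<bar> \<le> c" "c \<ge> 0"
  shows "cmod (\<sigma> (\<Sum>i<deg. of_rat (q i) * \<theta> ^ i)) \<le> of_rat c * size_bound"
proof -
  have "cmod (\<sigma> (\<Sum>i<deg. of_rat (q i) * \<theta> ^ i)) \<le> (\<Sum>i<deg. cmod (of_rat (q i) * \<sigma> (\<theta> ^ i)))"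
    by (simp add: complex_embeddings_D[OF assms(1)] norm_sum)
  also have "\<dots> \<le> (\<Sum>i<deg. of_rat c * cmod (\<sigma> (\<theta> ^ i)))"
  proof (rule sum_mono)
    fix i assume "i \<in> {..<deg}"
    hence "\<bar>real_of_rat (q i)\<bar> \<le> of_rat c"
      using assms(2)[of i] by (metis abs_of_rat lessThan_iff of_rat_less_eq)
    moreover have "cmod (of_rat (q i)) = \<bar>real_of_rat (q i)\<bar>"
      using norm_of_real[of "of_rat (q i)", where 'a = complex] rpoly_of_rat_hom(2)[of complex_of_real "q i"]
      by simp
    ultimately show "cmod (of_rat (q i) * \<sigma> (\<theta> ^ i)) \<le> of_rat c * cmod (\<sigma> (\<theta> ^ i))"
      by (simp add: norm_mult mult_right_mono)
  qed
  also have "\<dots> = of_rat c * (\<Sum>i<deg. cmod (\<sigma> (\<theta> ^ i)))" by (simp add: sum_distrib_left)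
  also have "\<dots> \<le> of_rat c * size_bound"
    using size_bound[OF assms(1)] assms(3) by (intro mult_left_mono) auto
  finally show ?thesis .
qed

text \<open>Removing the integer parts of the rational coordinates of \<open>x\<close> leaves an
  algebraic integer with coordinates in [0, 1), hence with bounded conjugates. There are finitely
  many such remainders, and they form \<open>F\<close>.\<close>

lemma ints_decomposition:
  obtains F :: "'k set" where "finite F" "F \<subseteq> alg_ints"
    "\<And>x. algebraic_int x \<Longrightarrow> \<exists>f\<in>F. \<exists>c::nat \<Rightarrow> int. x = f + (\<Sum>i<deg. of_int (c i) * \<theta> ^ i)"
proof
  let ?F = "{x::'k. algebraic_int x \<and> (\<forall>\<sigma>\<in>E. cmod (\<sigma> x) \<le> of_rat 1 * size_bound)}"
  show "finite ?F" by (rule finite_bounded_ints)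
  show "?F \<subseteq> alg_ints" by auto
  fix x :: 'k assume x: "algebraic_int x"
  define q where "q = coeff (rep x)"
  define y where "y = (\<Sum>i<deg. of_int \<lfloor>q i\<rfloor> * \<theta> ^ i)"
  have "x - y = (\<Sum>i<deg. of_rat (q i) * \<theta> ^ i) - y" unfolding q_def by (subst expansion) simp
  also have "\<dots> = (\<Sum>i<deg. of_rat (frac (q i)) * \<theta> ^ i)"
    by (simp add: y_def frac_def of_rat_diff left_diff_distrib sum_subtractf)
  finally have xy: "x - y = (\<Sum>i<deg. of_rat (frac (q i)) * \<theta> ^ i)" .
  have "\<bar>frac (q i)\<bar> \<le> 1" for i using frac_lt_1[of "q i"] frac_ge_0[of "q i"] by linarith
  hence "cmod (\<sigma> (x - y)) \<le> of_rat 1 * size_bound" if "\<sigma> \<in> E" for \<sigma>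
    unfolding xy using that by (intro size_bound_comb) auto
  moreover have "algebraic_int y"
    unfolding y_def using integral by (intro algebraic_int_sum algebraic_int_mult) auto
  ultimately have "x - y \<in> ?F" using x by auto
  moreover have "x = (x - y) + y" by simp
  ultimately show "\<exists>f\<in>?F. \<exists>c::nat \<Rightarrow> int. x = f + (\<Sum>i<deg. of_int (c i) * \<theta> ^ i)"
    unfolding y_def by (intro bexI[of _ "x - y"] exI[of _ "\<lambda>i. \<lfloor>q i\<rfloor>"]) (auto simp: y_def)
qed

lemma theta_comb_integral: "algebraic_int (\<Sum>i<deg. of_int (c i) * \<theta> ^ i)"
  using integral by (intro algebraic_int_sum algebraic_int_mult) auto

text \<open>Representatives modulo \<open>n\<close> are an element of \<open>F\<close> plus a
  combination of powers of \<theta> with coefficients from 0 to \<open>n - 1\<close>, so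
  \<open>C\<close> can be the size of \<open>F\<close>. The order of growth \<open>n ^ deg\<close>
  is that of the norm of \<open>n\<close>, which is what the product formula consumes.\<close>

lemma ints_mod_nat:
  obtains C :: nat where
    "\<forall>n>0. finite (residue_classes (of_nat n :: 'k)) \<and>
      card (residue_classes (of_nat n :: 'k)) \<le> C * n ^ deg"
proof -
  obtain F :: "'k set" where F: "finite F" "F \<subseteq> alg_ints"
    "\<And>x. algebraic_int x \<Longrightarrow> \<exists>f\<in>F. \<exists>c::nat \<Rightarrow> int. x = f + (\<Sum>i<deg. of_int (c i) * \<theta> ^ i)"
    using ints_decomposition by blast
  have "finite (residue_classes (of_nat n :: 'k)) \<and>
      card (residue_classes (of_nat n :: 'k)) \<le> card F * n ^ deg" if n: "n > 0" for n
  proof -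
    define B where "B = PiE {..<deg} (\<lambda>_. {0..<int n})"
    define R where "R = (\<lambda>(f, c). f + (\<Sum>i<deg. of_int (c i) * \<theta> ^ i)) ` (F \<times> B)"
    have B: "finite B" "card B = n ^ deg" by (auto simp: B_def finite_PiE card_PiE)
    have R: "finite R" "card R \<le> card F * n ^ deg"
      using F(1) B card_image_le[of "F \<times> B" "\<lambda>(f, c). f + (\<Sum>i<deg. of_int (c i) * \<theta> ^ i)"]
      by (auto simp: R_def card_cartesian_product)
    have rep: "\<exists>r\<in>R. x - r \<in> multiples (of_nat n)" if "x \<in> alg_ints" for x
    proof -
      obtain f c where fc: "f \<in> F" "x = f + (\<Sum>i<deg. of_int (c i) * \<theta> ^ i)"
        using F(3) \<open>x \<in> alg_ints\<close> by blast
      define c' where "c' = (\<lambda>i\<in>{..<deg}. c i mod int n)"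
      have "c' \<in> B" using n by (auto simp: B_def c'_def)
      hence r: "f + (\<Sum>i<deg. of_int (c' i) * \<theta> ^ i) \<in> R" using fc(1) by (auto simp: R_def)
      have "x - (f + (\<Sum>i<deg. of_int (c' i) * \<theta> ^ i)) = (\<Sum>i<deg. of_int (c i - c' i) * \<theta> ^ i)"
        by (simp add: fc(2) sum_subtractf left_diff_distrib)
      also have "\<dots> = (\<Sum>i<deg. of_nat n * (of_int (c i div int n) * \<theta> ^ i))"
      proof (rule sum.cong[OF refl])
        fix i assume "i \<in> {..<deg}"
        hence "c i - c' i = int n * (c i div int n)" by (simp add: c'_def minus_mod_eq_mult_div)
        thus "of_int (c i - c' i) * \<theta> ^ i = of_nat n * (of_int (c i div int n) * \<theta> ^ i)"
          by (simp add: mult.assoc)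
      qed
      also have "\<dots> = of_nat n * (\<Sum>i<deg. of_int (c i div int n) * \<theta> ^ i)"
        by (simp add: sum_distrib_left)
      also have "\<dots> \<in> multiples (of_nat n)"
        using theta_comb_integral by (auto simp: multiples_def)
      finally show ?thesis using r by blast
    qed
    show ?thesis
      using finite_cosetsI[OF add_closed_multiples R(1) rep] R(2) by (meson order_trans)
  qed
  thus ?thesis using that by blast
qed

lemma nat_multiple:
  assumes "(a::'k) \<noteq> 0"
  obtains n :: nat where "n > 0" "of_nat n \<in> multiples a"
proof -
  obtain n :: nat where "n > 0" "algebraic_int (of_nat n * inverse a)"
    using algebraic_multiple_integral[OF all_algebraic] .
  thus ?thesis using that assms by (auto simp: multiples_iff divide_inverse)
qed

lemma finite_mod:
  assumes "algebraic_int (a::'k)" "a \<noteq> 0"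
  shows "finite (residue_classes a)"
proof -
  obtain n :: nat where n: "n > 0" "of_nat n \<in> multiples a" using nat_multiple[OF assms(2)] .
  have "multiples (of_nat n) \<subseteq> multiples a"
    using multiples_mult[OF n(2)] by (auto simp: multiples_def[of "of_nat n"])
  moreover obtain C where "\<forall>n>0. finite (residue_classes (of_nat n :: 'k)) \<and>
      card (residue_classes (of_nat n :: 'k)) \<le> C * n ^ deg"
    by (rule ints_mod_nat)
  hence "finite (residue_classes (of_nat n :: 'k))" using n(1) by blast
  ultimately show ?thesis
    using finite_cosets_mono[OF add_closed_multiples add_closed_multiples] subset_refl by blast
qed

lemma finite_mod_subgroup:
  assumes "algebraic_int (a::'k)" "a \<noteq> 0" "add_closed B" "multiples a \<subseteq> B" "A \<subseteq> alg_ints"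
  shows "finite (cosets A B)"
  using finite_cosets_mono[OF add_closed_multiples assms(3,4,5) finite_mod[OF assms(1,2)]] .

text \<open>Take slightly more combinations of powers of \<theta>, with natural coefficients below
  \<open>N\<close>, than there are classes modulo \<open>a\<close>. Two of them are congruent, and
  their difference \<open>a * b\<close> is nonzero with conjugates of size at most N S. Since the
  norm of \<open>b\<close> is at least 1, the norm of \<open>a\<close> is at most (N S)^deg.\<close>

lemma norm_le_index:
  obtains C :: real where "C > 0"
    "\<And>a::'k. algebraic_int a \<Longrightarrow> a \<noteq> 0 \<Longrightarrow>
      (\<Prod>\<sigma>\<in>E. cmod (\<sigma> a)) \<le> C * card (residue_classes a)"
proof
  define S where "S = size_bound + 1"
  have Spos: "S > 0" "size_bound \<le> S"
    unfolding S_def size_bound_def by (auto intro!: add_nonneg_pos sum_nonneg)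
  show "(2 * S) ^ deg > 0" using Spos by simp
  fix a :: 'k assume a: "algebraic_int a" "a \<noteq> 0"
  let ?f = "card (residue_classes a)"
  have fin: "finite (residue_classes a)" by (rule finite_mod[OF a])
  have "residue_classes a \<noteq> {}" unfolding cosets_def by auto
  hence f1: "?f \<ge> 1" using fin by (simp add: Suc_le_eq card_gt_0_iff)
  \<comment> \<open>The least choice keeps \<open>N ^ deg\<close> within a constant factor of the
    index: \<open>(N - 1) ^ deg\<close> is still at most the index, and N \<le> 2 (N - 1) because N
    \<ge> 2.\<close>
  define N where "N = (LEAST N. N ^ deg > ?f)"
  have ex: "\<exists>N. N ^ deg > ?f"
  proof
    have "?f < 2 ^ ?f" by simp
    also have "\<dots> \<le> (2 ^ ?f) ^ deg" using deg_pos by (simp add: self_le_power)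
    finally show "?f < (2 ^ ?f) ^ deg" .
  qed
  have N: "N ^ deg > ?f" unfolding N_def using ex by (rule LeastI_ex)
  have N2: "N \<ge> 2"
  proof (rule ccontr)
    assume "\<not> N \<ge> 2"
    hence "N = 0 \<or> N = 1" by auto
    thus False using N f1 deg_pos by (auto simp: power_0_left)
  qed
  have "\<not> (N - 1) ^ deg > ?f" 
    using not_less_Least[of "N - 1" "\<lambda>N. N ^ deg > ?f"] N2 unfolding N_def[symmetric] by auto
  hence N1: "(N - 1) ^ deg \<le> ?f" by simp
  define B where "B = PiE {..<deg} (\<lambda>_. {..<N})"
  define h where "h c = (\<Sum>i<deg. of_nat (c i) * \<theta> ^ i)" for c :: "nat \<Rightarrow> nat"
  have hint: "algebraic_int (h c)" for c
    unfolding h_def using integral by (intro algebraic_int_sum algebraic_int_mult) auto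
  have cardB: "card B = N ^ deg" "finite B" by (auto simp: B_def card_PiE finite_PiE)
  have "\<not> inj_on (\<lambda>c. (+) (h c) ` multiples a) B"
  proof
    assume "inj_on (\<lambda>c. (+) (h c) ` multiples a) B"
    moreover have "(\<lambda>c. (+) (h c) ` multiples a) ` B \<subseteq> residue_classes a"
      using hint by (auto simp: cosets_def)
    ultimately have "card B \<le> ?f" using fin card_inj_on_le by blast
    thus False using N cardB by simp
  qed
  then obtain c c' where c: "c \<in> B" "c' \<in> B" "c \<noteq> c'"
    and "(+) (h c) ` multiples a = (+) (h c') ` multiples a"
    by (auto simp: inj_on_def)
  hence m: "h c - h c' \<in> multiples a" using coset_eq_iff[OF add_closed_multiples] by blast
  then obtain b where b: "algebraic_int b" "h c - h c' = a * b" by (auto simp: multiples_def)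
  define q where "q i = of_nat (c i) - (of_nat (c' i) :: rat)" for i
  have hq: "h c - h c' = (\<Sum>i<deg. of_rat (q i) * \<theta> ^ i)"
    by (simp add: h_def q_def sum_subtractf left_diff_distrib of_rat_diff)
  have "h c - h c' \<noteq> 0"
  proof
    assume "h c - h c' = 0"
    hence "q i = 0" if "i < deg" for i using powers_independent[of q i] hq that by simp
    hence "c i = c' i" if "i < deg" for i using that by (force simp: q_def)
    hence "c = c'" using c(1,2) unfolding B_def by (intro PiE_ext) auto
    thus False using c by simp
  qed
  hence b0: "b \<noteq> 0" using b by auto
  have q: "\<bar>q i\<bar> \<le> of_nat N" if "i < deg" for i
  proof -
    have "c i < N" "c' i < N" using c that by (auto simp: B_def PiE_iff)
    hence "(of_nat (c i) :: rat) \<le> of_nat N" "(of_nat (c' i) :: rat) \<le> of_nat N" by simp_all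
    thus ?thesis unfolding q_def by (simp add: abs_le_iff algebra_simps add_increasing2)
  qed
  have "(\<Prod>\<sigma>\<in>E. cmod (\<sigma> a)) \<le> (\<Prod>\<sigma>\<in>E. cmod (\<sigma> a)) * (\<Prod>\<sigma>\<in>E. cmod (\<sigma> b))"
    using mult_left_mono[OF norm_ge_1[OF b(1) b0], of "\<Prod>\<sigma>\<in>E. cmod (\<sigma> a)"] by (simp add: prod_nonneg)
  also have "\<dots> = (\<Prod>\<sigma>\<in>E. cmod (\<sigma> (h c - h c')))"
    unfolding b(2) prod.distrib[symmetric]
    by (rule prod.cong) (auto simp: complex_embeddings_D(3) norm_mult)
  also have "\<dots> \<le> (\<Prod>\<sigma>\<in>E. of_nat N * S)"
  proof (rule prod_mono, safe)
    fix \<sigma> assume s: "\<sigma> \<in> E"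
    have "cmod (\<sigma> (h c - h c')) \<le> of_rat (of_nat N) * size_bound"
      unfolding hq by (rule size_bound_comb[OF s q]) auto
    also have "\<dots> \<le> of_nat N * S" using Spos by (simp add: mult_left_mono)
    finally show "cmod (\<sigma> (h c - h c')) \<le> of_nat N * S" .
  qed auto
  also have "\<dots> = (of_nat N * S) ^ deg" by (simp add: card_embeddings)
  also have "\<dots> \<le> (2 * of_nat (N - 1) * S) ^ deg"
    using N2 Spos by (intro power_mono mult_right_mono) (auto simp: of_nat_diff)
  also have "\<dots> = (2 * S) ^ deg * of_nat ((N - 1) ^ deg)"
    by (simp add: power_mult_distrib mult_ac)
  also have "\<dots> \<le> (2 * S) ^ deg * ?f"
    using N1 Spos by (intro mult_left_mono) (auto simp del: of_nat_power)
  finally show "(\<Prod>\<sigma>\<in>E. cmod (\<sigma> a)) \<le> (2 * S) ^ deg * ?f" .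
qed

end

section \<open>Local uniformizers and orders\<close>

lemma integer_ring_simps [simp]:
  "carrier integer_ring = alg_ints" "x \<otimes>\<^bsub>integer_ring\<^esub> y = x * y" "x \<oplus>\<^bsub>integer_ring\<^esub> y = x + y"
  "\<one>\<^bsub>integer_ring\<^esub> = 1" "\<zero>\<^bsub>integer_ring\<^esub> = 0"
  by (simp_all add: integer_ring_def)

lemma cring_integer_ring: "cring (integer_ring :: 'a::field_char_0 ring)"
proof (rule cringI)
  show "abelian_group (integer_ring :: 'a ring)"
  proof (rule abelian_groupI)
    fix x :: 'a assume "x \<in> carrier integer_ring"
    thus "\<exists>y\<in>carrier integer_ring. y \<oplus>\<^bsub>integer_ring\<^esub> x = \<zero>\<^bsub>integer_ring\<^esub>"
      by (intro bexI[of _ "- x"]) auto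
  qed (auto simp: algebra_simps)
  show "comm_monoid (integer_ring :: 'a ring)"
    by (rule comm_monoidI) (auto simp: algebra_simps)
qed (auto simp: algebra_simps)

interpretation int_ring: cring "integer_ring :: 'a::field_char_0 ring"
  by (rule cring_integer_ring)

lemma int_ring_neg: "algebraic_int (x::'a::field_char_0) \<Longrightarrow> \<ominus>\<^bsub>integer_ring\<^esub> x = - x"
  by (rule int_ring.minus_equality) auto

text \<open>Ideals of the ring of integers in terms of the field operations, so that membership
  arguments are calculations in the field; \<open>ideal_iff\<close> is the bridge to the
  record-based notion.\<close>

definition ring_ideal :: "'a::field_char_0 set \<Rightarrow> bool" where
  "ring_ideal I \<longleftrightarrow> I \<subseteq> alg_ints \<and> add_closed I \<and> (\<forall>r\<in>alg_ints. \<forall>x\<in>I. r * x \<in> I)"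

lemma ring_idealD:
  assumes "ring_ideal I"
  shows "x \<in> I \<Longrightarrow> algebraic_int x" "add_closed I" "algebraic_int r \<Longrightarrow> x \<in> I \<Longrightarrow> r * x \<in> I"
    "algebraic_int r \<Longrightarrow> x \<in> I \<Longrightarrow> x * r \<in> I"
    "x \<in> I \<Longrightarrow> y \<in> I \<Longrightarrow> x + y \<in> I" "x \<in> I \<Longrightarrow> y \<in> I \<Longrightarrow> x - y \<in> I" "0 \<in> I"
  using assms by (auto simp: ring_ideal_def mult.commute[of _ r] intro: add_closedD)

lemma ideal_iff: "ideal I (integer_ring :: 'a::field_char_0 ring) \<longleftrightarrow> ring_ideal I"
proof
  assume "ideal I (integer_ring :: 'a ring)"
  then interpret ideal I "integer_ring :: 'a ring" .
  have sub: "I \<subseteq> alg_ints" using a_subset by simp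
  have mul: "r * x \<in> I" if "algebraic_int r" "x \<in> I" for r x
    using I_l_closed[of x r] that by simp
  have "x - y \<in> I" if "x \<in> I" "y \<in> I" for x y
    using a_closed[OF that(1) mul[of "- 1", OF _ that(2)]] by simp
  thus "ring_ideal I" using sub mul zero_closed by (auto simp: ring_ideal_def add_closed_def)
next
  assume I: "ring_ideal I"
  show "ideal I (integer_ring :: 'a ring)"
  proof (rule idealI)
    show "subgroup I (add_monoid (integer_ring :: 'a ring))"
    proof (rule subgroup.intro)
      fix x assume x: "x \<in> I"
      have "\<ominus>\<^bsub>integer_ring\<^esub> x \<in> I"
        using ring_idealD(1)[OF I x] add_closedD(3)[OF ring_idealD(2)[OF I] x] by (simp add: int_ring_neg)
      thus "inv\<^bsub>add_monoid integer_ring\<^esub> x \<in> I" by (simp add: a_inv_def)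
    qed (use ring_idealD[OF I] in auto)
  qed (use ring_idealD[OF I] in \<open>auto intro: int_ring.ring_axioms\<close>)
qed

definition prime_place :: "'a::field_char_0 set \<Rightarrow> bool" where
  "prime_place p \<longleftrightarrow> ring_ideal p \<and> 1 \<notin> p \<and> p \<noteq> {0} \<and>
     (\<forall>x y. algebraic_int x \<longrightarrow> algebraic_int y \<longrightarrow> x * y \<in> p \<longrightarrow> x \<in> p \<or> y \<in> p)"

lemma finite_places_iff: "p \<in> finite_places \<longleftrightarrow> prime_place (p :: 'a::field_char_0 set)"
proof
  assume "p \<in> finite_places"
  hence p: "primeideal p integer_ring" "p \<noteq> {0}" by (auto simp: finite_places_def)
  then interpret primeideal p "integer_ring :: 'a ring" by blast
  have I: "ring_ideal p" using ideal_iff is_ideal by blast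
  have "1 \<notin> p"
  proof
    assume "1 \<in> p"
    hence "x \<in> p" if "algebraic_int x" for x using ring_idealD(3)[OF I that, of 1] by simp
    hence "alg_ints = p" using ring_idealD(1)[OF I] by blast
    thus False using I_notcarr by simp
  qed
  thus "prime_place p" using I p(2) I_prime by (auto simp: prime_place_def)
next
  assume p: "prime_place p"
  have "primeideal p (integer_ring :: 'a ring)"
  proof (rule primeidealI)
    show "ideal p (integer_ring :: 'a ring)" using p ideal_iff by (auto simp: prime_place_def)
    have "1 \<in> carrier (integer_ring :: 'a ring)" "1 \<notin> p" using p by (simp_all add: prime_place_def)
    thus "carrier integer_ring \<noteq> p" by blast
    show "cring (integer_ring :: 'a ring)" by (rule cring_integer_ring)
    show "x \<in> p \<or> y \<in> p" if "x \<in> carrier integer_ring" "y \<in> carrier integer_ring"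
      "x \<otimes>\<^bsub>integer_ring\<^esub> y \<in> p" for x y
      using that p by (simp add: prime_place_def)
  qed
  thus "p \<in> finite_places" using p by (auto simp: finite_places_def prime_place_def)
qed

lemma ideal_norm_eq:
  assumes "ring_ideal (p :: 'a::field_char_0 set)"
  shows "ideal_norm p = card (cosets alg_ints p)"
proof -
  have "carrier (integer_ring Quot p) = cosets alg_ints p"
    by (auto simp: FactRing_def A_RCOSETS_def' a_r_coset_def' cosets_def image_def add.commute)
  thus ?thesis by (simp add: ideal_norm_def)
qed

lemma prime_placeD:
  assumes "prime_place p"
  shows "ring_ideal p" "1 \<notin> p"
    "algebraic_int x \<Longrightarrow> algebraic_int y \<Longrightarrow> x * y \<in> p \<Longrightarrow> x \<in> p \<or> y \<in> p"
  using assms by (auto simp: prime_place_def)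

text \<open>Powers of \<open>x\<close> repeat in a finite residue ring. This single fact later
  produces inverses modulo a prime, elements with a prescribed colon ideal, and the bound on
  orders.\<close>

lemma (in primitive_gen) powers_periodic:
  assumes "algebraic_int (a::'k)" "a \<noteq> 0" "algebraic_int x"
  obtains i j where "j > 0" "x ^ i * (1 - x ^ j) \<in> multiples a"
proof -
  have "range (\<lambda>n::nat. (+) (x ^ n) ` multiples a) \<subseteq> residue_classes a"
    using assms(3) by (auto simp: cosets_def)
  hence "\<not> inj (\<lambda>n::nat. (+) (x ^ n) ` multiples a)"
    using finite_mod[OF assms(1,2)] finite_subset range_inj_infinite by blast
  then obtain n n' :: nat where n: "n \<noteq> n'" "(+) (x ^ n) ` multiples a = (+) (x ^ n') ` multiples a"
    by (auto simp: inj_on_def)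
  have main: "\<exists>i j. j > 0 \<and> x ^ i * (1 - x ^ j) \<in> multiples a"
    if "n < n'" "x ^ n - x ^ n' \<in> multiples a" for n n'
  proof (intro exI conjI)
    have "x ^ n' = x ^ n * x ^ (n' - n)" using \<open>n < n'\<close> by (simp flip: power_add)
    thus "x ^ n * (1 - x ^ (n' - n)) \<in> multiples a"
      using \<open>x ^ n - x ^ n' \<in> multiples a\<close> by (simp add: right_diff_distrib)
  qed (use \<open>n < n'\<close> in simp)
  have "x ^ n - x ^ n' \<in> multiples a" "x ^ n' - x ^ n \<in> multiples a"
    using n(2) coset_eq_iff[OF add_closed_multiples] by metis+
  hence "\<exists>i j. j > 0 \<and> x ^ i * (1 - x ^ j) \<in> multiples a"
    using n(1) main[of n n'] main[of n' n] by (cases "n < n'") auto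
  thus thesis using that by blast
qed

abbreviation "iord \<equiv> integral_ord"

section \<open>Local structure at a prime\<close>

locale place = primitive_gen \<theta> m for \<theta> :: "'k::field_char_0" and m +
  fixes p :: "'k set"
  assumes prime: "prime_place p"
begin

lemmas idl = ring_idealD[OF prime_placeD(1)[OF prime]]

text \<open>These are the integers that become units in the localisation at \<open>p\<close>.
  Statements about the localisation are written with such factors multiplied out instead of with
  fractions.\<close>

definition off :: "'k \<Rightarrow> bool" where "off t \<longleftrightarrow> algebraic_int t \<and> t \<notin> p"

lemma off_mult: "off s \<Longrightarrow> off t \<Longrightarrow> off (s * t)"
  and off_1: "off 1" and off_nz: "off t \<Longrightarrow> t \<noteq> 0" and off_int: "off t \<Longrightarrow> algebraic_int t"
  using prime_placeD(2,3)[OF prime] idl(7) by (auto simp: off_def)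

lemma off_power: "off s \<Longrightarrow> off (s ^ n)"
  by (induction n) (auto intro: off_mult off_1)

lemma off_cancel: "off s \<Longrightarrow> algebraic_int x \<Longrightarrow> s * x \<in> p \<Longrightarrow> x \<in> p"
  using prime_placeD(3)[OF prime] by (auto simp: off_def)

lemma off_one_diff: "x \<in> p \<Longrightarrow> off (1 - x)"
proof -
  assume x: "x \<in> p"
  have "1 - x \<notin> p"
  proof
    assume "1 - x \<in> p"
    from idl(5)[OF this x] show False using prime_placeD(2)[OF prime] by simp
  qed
  thus "off (1 - x)" using idl(1)[OF x] by (auto simp: off_def)
qed

lemma pow_mem: "x \<in> p \<Longrightarrow> n > 0 \<Longrightarrow> x ^ n \<in> p"
  by (cases n) (auto intro: idl(4) idl(1))

lemma nonzero_elem: obtains a where "a \<in> p" "a \<noteq> 0" "algebraic_int a"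
  using prime idl(1,7) by (auto simp: prime_place_def)

lemma multiples_sub: "a \<in> p \<Longrightarrow> multiples a \<subseteq> p"
  by (auto simp: multiples_def intro: idl)

lemma finite_residues: "finite (cosets alg_ints p)"
proof -
  obtain a where "a \<in> p" "a \<noteq> 0" "algebraic_int a" by (rule nonzero_elem)
  thus ?thesis using finite_mod_subgroup[of a p alg_ints] idl(2) multiples_sub by blast
qed

lemma finite_reps:
  assumes "a \<in> p" "a \<noteq> 0"
  obtains R where "finite R" "R \<subseteq> p" "\<forall>x\<in>p. \<exists>r\<in>R. x - r \<in> multiples a"
proof -
  obtain R where R: "R \<subseteq> p" "bij_betw (\<lambda>x. (+) x ` multiples a) R (cosets p (multiples a))"
    "\<forall>x\<in>p. \<exists>r\<in>R. x - r \<in> multiples a"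
    by (rule transversal[OF add_closed_multiples[of a], of p])
  have "finite (cosets p (multiples a))"
    using idl(1) by (intro finite_mod_subgroup[OF idl(1)[OF assms(1)] assms(2)] add_closed_multiples) auto
  thus ?thesis using R that bij_betw_finite by blast
qed

text \<open>In \<open>x ^ i * (1 - x ^ j)\<close> the first factor can be cancelled modulo
  \<open>p\<close>, so \<open>x ^ (j - 1)\<close> is an inverse of \<open>x\<close>. In other words,
  nonzero primes are maximal.\<close>

lemma inverse_mod:
  assumes "off x"
  obtains y where "algebraic_int y" "1 - x * y \<in> p"
proof -
  obtain a where a: "a \<in> p" "a \<noteq> 0" "algebraic_int a" by (rule nonzero_elem)
  obtain i j where ij: "j > 0" "x ^ i * (1 - x ^ j) \<in> multiples a"
    using powers_periodic[OF a(3,2) off_int[OF assms]] .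
  hence "1 - x ^ j \<in> p"
    using multiples_sub[OF a(1)] off_cancel[OF off_power[OF assms], of "1 - x ^ j" i] off_int[OF assms]
    by blast
  moreover have "x ^ j = x * x ^ (j - 1)" using ij by (cases j) auto
  ultimately show ?thesis using that[of "x ^ (j - 1)"] off_int[OF assms] by auto
qed

text \<open>An element \<open>b\<close> with \<open>(aO : b) = p\<close>: starting from \<open>b = 1\<close>, multiply \<open>b\<close> successively so that
  it absorbs one representative of \<open>p\<close> modulo \<open>a\<close> after the other, always keeping
  \<open>(aO : b) \<subseteq> p\<close>.\<close>

lemma colon_ideal:
  assumes "a \<in> p" "a \<noteq> 0"
  obtains b where "algebraic_int b" "b \<notin> multiples a" "\<And>x. x \<in> p \<Longrightarrow> b * x \<in> multiples a"
proof -
  have a: "algebraic_int a" using idl(1) assms(1) .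
  obtain R where "finite R" and R: "R \<subseteq> p" "\<forall>x\<in>p. \<exists>r\<in>R. x - r \<in> multiples a"
    by (rule finite_reps[OF assms])
  \<comment> \<open>The middle condition is (aO : b) \<subseteq> p; the last says that
    \<open>b\<close> already absorbs the representatives in \<open>K\<close>.\<close>
  let ?P = "\<lambda>b K. algebraic_int b \<and> (\<forall>y. algebraic_int y \<longrightarrow> y * b \<in> multiples a \<longrightarrow> y \<in> p)
      \<and> (\<forall>x\<in>K. x * b \<in> multiples a)"
  have "\<exists>b. ?P b R" using \<open>finite R\<close> R(1)
  proof (induction R rule: finite_induct)
    case empty
    show ?case using multiples_sub[OF assms(1)] by (intro exI[of _ 1]) auto
  next
    case (insert x R)
    then obtain b where b: "?P b R" by auto
    have x: "x \<in> p" "algebraic_int x" using insert.prems idl(1) by auto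
    obtain i j where ij: "j > 0" "x ^ i * (1 - x ^ j) \<in> multiples a"
      using powers_periodic[OF a assms(2) x(2)] .
    \<comment> \<open>\<open>?Q n\<close> says that x^n b vanishes modulo \<open>a\<close> after
      localising at \<open>p\<close>. Stopping one power before the least such exponent, and
      multiplying by the witness \<open>u\<close>, gives an element that is killed by
      \<open>x\<close> but by nothing outside \<open>p\<close>.\<close>
    let ?Q = "\<lambda>n. \<exists>u. off u \<and> u * (x ^ n * b) \<in> multiples a"
    have "?Q i"
    proof (intro exI conjI)
      show "off (1 - x ^ j)" using off_one_diff pow_mem x(1) ij(1) by blast
      show "(1 - x ^ j) * (x ^ i * b) \<in> multiples a"
        using multiples_mult[OF ij(2), of b] b by (simp add: mult_ac)
    qed
    define n where "n = (LEAST n. ?Q n)"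
    have Qn: "?Q n" unfolding n_def using \<open>?Q i\<close> by (rule LeastI)
    have "\<not> ?Q 0" using b by (auto simp: off_def)
    hence "n \<noteq> 0" using Qn by metis
    then obtain n' where n': "n = Suc n'" by (cases n) auto
    hence nQ: "\<not> ?Q n'" using not_less_Least[of n' ?Q] unfolding n_def[symmetric] by simp
    obtain u where u: "off u" "u * (x ^ n * b) \<in> multiples a" using Qn by auto
    let ?b = "u * (x ^ n' * b)"
    have "?P ?b (insert x R)"
    proof (intro conjI ballI allI impI)
      show "algebraic_int ?b" using off_int[OF u(1)] x(2) b by auto
      show "y \<in> p" if y: "algebraic_int y" "y * ?b \<in> multiples a" for y
      proof (rule ccontr)
        assume "y \<notin> p"
        hence "off (y * u)" using y u(1) by (intro off_mult) (auto simp: off_def)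
        moreover have "(y * u) * (x ^ n' * b) \<in> multiples a" using y(2) by (simp add: mult_ac)
        ultimately show False using nQ by blast
      qed
      show "y * ?b \<in> multiples a" if "y \<in> insert x R" for y
      proof (cases "y = x")
        case True thus ?thesis using u(2) n' by (simp add: mult_ac)
      next
        case False
        hence "y * b \<in> multiples a" using that b by auto
        hence "y * b * (u * x ^ n') \<in> multiples a"
          using off_int[OF u(1)] x(2) by (intro multiples_mult[of "y * b"]) auto
        thus ?thesis by (simp add: mult_ac)
      qed
    qed
    thus ?case by blast
  qed
  then obtain b where b: "?P b R" by blast
  show ?thesis
  proof
    show "algebraic_int b" using b by blast
    show "b \<notin> multiples a" using b prime_placeD(2)[OF prime] by (auto dest: spec[of _ 1])
    fix x assume "x \<in> p"
    then obtain r where r: "r \<in> R" "x - r \<in> multiples a" using R(2) by blast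
    have "(x - r) * b \<in> multiples a" "r * b \<in> multiples a"
      using multiples_mult[OF r(2)] b r(1) by auto
    from add_closedD(4)[OF add_closed_multiples this] show "b * x \<in> multiples a"
      by (simp add: algebra_simps)
  qed
qed

text \<open>Supplies the finite generating set for the determinant trick: \<open>p\<close> is a
  finite set plus aO, and O is a finite set plus the integer combinations of the powers of
  \<theta>.\<close>

lemma finitely_generated:
  obtains W where "finite W" "W \<subseteq> p" "p \<subseteq> zmod.span W"
proof -
  obtain a where a: "a \<in> p" "a \<noteq> 0" "algebraic_int a" by (rule nonzero_elem)
  obtain R where finR: "finite R" and R: "R \<subseteq> p" "\<forall>x\<in>p. \<exists>r\<in>R. x - r \<in> multiples a"
    by (rule finite_reps[OF a(1,2)])
  obtain F :: "'k set" where F: "finite F" "F \<subseteq> alg_ints"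
    "\<And>x. algebraic_int x \<Longrightarrow> \<exists>f\<in>F. \<exists>c::nat \<Rightarrow> int. x = f + (\<Sum>i<deg. of_int (c i) * \<theta> ^ i)"
    using ints_decomposition by blast
  define W where "W = R \<union> (*) a ` F \<union> (\<lambda>i. a * \<theta> ^ i) ` {..<deg}"
  show ?thesis
  proof
    show "finite W" using finR F(1) by (simp add: W_def)
    show "W \<subseteq> p" using R(1) F(2) a(1) integral by (auto simp: W_def intro!: idl(4))
    show "p \<subseteq> zmod.span W"
    proof
      fix x assume "x \<in> p"
      then obtain r where r: "r \<in> R" "x - r \<in> multiples a" using R(2) by blast
      then obtain y where y: "algebraic_int y" "x - r = a * y" by (auto simp: multiples_def)
      obtain f c where fc: "f \<in> F" "y = f + (\<Sum>i<deg. of_int (c i) * \<theta> ^ i)" using F(3)[OF y(1)] by blast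
      have "x = r + (a * f + (\<Sum>i<deg. of_int (c i) * (a * \<theta> ^ i)))"
        using y(2) fc(2) by (simp add: algebra_simps sum_distrib_left)
      also have "\<dots> \<in> zmod.span W"
        using r(1) fc(1)
        by (intro zmod.span_add zmod.span_sum zmod.span_scale zmod.span_base) (auto simp: W_def)
      finally show "x \<in> zmod.span W" .
    qed
  qed
qed

text \<open>\<open>q\<close> generates \<open>p\<close> once \<open>s\<close> is inverted. A single
  denominator \<open>s\<close> serves all of \<open>p\<close>, so that \<open>s ^ n\<close> can
  serve the n-th power of the ideal.\<close>

definition unif_pair :: "'k \<Rightarrow> 'k \<Rightarrow> bool" where
  "unif_pair q s \<longleftrightarrow> q \<in> p \<and> off s \<and> (\<forall>x\<in>p. \<exists>y. algebraic_int y \<and> s * x = q * y)"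

text \<open>Since \<open>O\<close> is integrally closed, \<open>g = b / a\<close> with \<open>(aO : b) = p\<close> cannot map the finitely
  generated \<open>p\<close> to itself; any \<open>q \<in> p\<close> with \<open>g q \<notin> p\<close> generates \<open>p\<close> locally.\<close>

lemma unif_pair_exists: "\<exists>q s. unif_pair q s"
proof -
  obtain a where a: "a \<in> p" "a \<noteq> 0" "algebraic_int a" by (rule nonzero_elem)
  obtain b where b: "algebraic_int b" "b \<notin> multiples a" "\<And>x. x \<in> p \<Longrightarrow> b * x \<in> multiples a"
    using colon_ideal[OF a(1,2)] by blast
  define g where "g = b / a"
  have g: "algebraic_int (g * x)" if "x \<in> p" for x
    using b(3)[OF that] a(2) by (simp add: multiples_iff g_def)
  have "\<exists>q\<in>p. g * q \<notin> p"
  proof (rule ccontr)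
    assume "\<not> (\<exists>q\<in>p. g * q \<notin> p)"
    hence gp: "g * x \<in> p" if "x \<in> p" for x using that by blast
    obtain W where W: "finite W" "W \<subseteq> p" "p \<subseteq> zmod.span W" by (rule finitely_generated)
    have "algebraic_int g"
    proof (rule algebraic_int_if_stable[of "insert a W" a])
      fix w assume "w \<in> insert a W"
      hence "g * w \<in> p" using W(2) a(1) gp by blast
      thus "g * w \<in> zmod.span (insert a W)"
        using W(3) zmod.span_mono[of W "insert a W"] by blast
    qed (use W a in auto)
    thus False using b(2) a(2) by (simp add: multiples_iff g_def)
  qed
  then obtain q where q: "q \<in> p" "g * q \<notin> p" by blast
  \<comment> \<open>The denominator is g q itself: g q x = q (g x), and g x is integral for every x
    in \<open>p\<close>.\<close>
  have "unif_pair q (g * q)"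
    unfolding unif_pair_def
  proof (intro conjI ballI)
    show "q \<in> p" "off (g * q)" using q g by (auto simp: off_def)
    show "\<exists>y. algebraic_int y \<and> g * q * x = q * y" if "x \<in> p" for x
      using g[OF that] by (intro exI[of _ "g * x"]) simp
  qed
  thus ?thesis by blast
qed

definition unif :: 'k where "unif = (SOME q. \<exists>s. unif_pair q s)"

lemma unif_ex: obtains s where "unif_pair unif s"
  using someI_ex[OF unif_pair_exists] unfolding unif_def by blast

lemma unif_in: "unif \<in> p" and unif_int: "algebraic_int unif"
  using unif_ex idl(1) by (auto simp: unif_pair_def)

lemma unif_nz: "unif \<noteq> 0"
proof
  assume z: "unif = 0"
  obtain s where s: "unif_pair unif s" by (rule unif_ex)
  obtain a where a: "a \<in> p" "a \<noteq> 0" by (rule nonzero_elem)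
  thus False using s z off_nz by (auto simp: unif_pair_def)
qed

text \<open>In the localisation at \<open>p\<close>, this says that \<open>x\<close> equals
  \<open>unif ^ n\<close> times a unit.\<close>

definition has_ord :: "'k \<Rightarrow> nat \<Rightarrow> bool" where
  "has_ord x n \<longleftrightarrow> (\<exists>t u. off t \<and> off u \<and> t * x = unif ^ n * u)"

text \<open>If \<open>n\<close> exceeded \<open>n'\<close>, cancelling the common power of
  \<open>unif\<close> would put the local unit \<open>t * u'\<close> into \<open>p\<close>. Here
  \<open>u\<close> is merely integral, so the lemma bounds divisibility and not only exact
  orders.\<close>

lemma has_ord_le:
  assumes "off t" "t * x = unif ^ n * u" "algebraic_int u" "off t'" "off u'" "t' * x = unif ^ n' * u'"
  shows "n \<le> n'"
proof (rule ccontr)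
  assume "\<not> n \<le> n'"
  then obtain d where d: "n = n' + Suc d" using less_iff_Suc_add[of n' n] by auto
  have "t' * (unif ^ n * u) = t * (unif ^ n' * u')"
    using assms(2,6) by (metis mult.left_commute)
  hence "unif ^ n' * (t' * unif ^ Suc d * u) = unif ^ n' * (t * u')"
    by (simp add: d power_add mult_ac)
  hence "t' * unif ^ Suc d * u = t * u'" using unif_nz by simp
  moreover have "t' * unif ^ Suc d * u \<in> p"
    using unif_in off_int[OF assms(4)] assms(3) by (intro idl(3,4) pow_mem) auto
  ultimately show False using off_mult[OF assms(1,5)] by (simp add: off_def)
qed

lemma has_ord_unique: "has_ord x n \<Longrightarrow> has_ord x n' \<Longrightarrow> n = n'"
  unfolding has_ord_def using has_ord_le off_int by (metis le_antisym)

text \<open>A power \<open>unif ^ i\<close> is, up to a local unit, a multiple of \<open>x\<close>,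
  so \<open>unif\<close> divides \<open>x\<close> locally at most \<open>i\<close> times. At the
  largest exponent the cofactor lies outside \<open>p\<close>, since otherwise one more
  \<open>unif\<close> could be split off.\<close>

lemma has_ord_exists:
  assumes "algebraic_int x" "x \<noteq> 0"
  obtains n where "has_ord x n"
proof -
  let ?P = "\<lambda>n. \<exists>t y. off t \<and> algebraic_int y \<and> t * x = unif ^ n * y"
  obtain i j where ij: "j > 0" "unif ^ i * (1 - unif ^ j) \<in> multiples x"
    using powers_periodic[OF assms unif_int] .
  then obtain z where z: "algebraic_int z" "unif ^ i * (1 - unif ^ j) = x * z"
    by (auto simp: multiples_def)
  have u: "off (1 - unif ^ j)" using off_one_diff pow_mem unif_in ij(1) by blast
  have bound: "n \<le> i" if Pn: "?P n" for n
  proof -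
    obtain t y where ty: "off t" "algebraic_int y" "t * x = unif ^ n * y" using Pn by blast
    show ?thesis
    proof (rule has_ord_le[of t "x * z" n "y * z" 1 "1 - unif ^ j" i])
      show "t * (x * z) = unif ^ n * (y * z)" using ty(3) by (simp flip: mult.assoc)
    qed (use ty z u off_1 in auto)
  qed
  have P0: "?P 0" using assms(1) off_1 by (intro exI[of _ 1] exI[of _ x]) auto
  define n where "n = (GREATEST n. ?P n)"
  have "?P n" unfolding n_def using P0 bound by (rule GreatestI_nat)
  then obtain t y where ty: "off t" "algebraic_int y" "t * x = unif ^ n * y" by blast
  have "y \<notin> p"
  proof
    assume "y \<in> p"
    obtain s where s: "unif_pair unif s" by (rule unif_ex)
    then obtain y' where y': "algebraic_int y'" "s * y = unif * y'"
      using \<open>y \<in> p\<close> by (auto simp: unif_pair_def)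
    have "(s * t) * x = unif ^ n * (s * y)" using ty(3) by (simp add: mult_ac)
    hence "(s * t) * x = unif ^ Suc n * y'" by (simp add: y'(2) mult_ac)
    moreover have "off (s * t)" using s ty(1) off_mult by (auto simp: unif_pair_def)
    ultimately have "?P (Suc n)" using y'(1) by blast
    hence "Suc n \<le> n" unfolding n_def using bound by (rule Greatest_le_nat)
    thus False by simp
  qed
  thus ?thesis using that ty by (auto simp: has_ord_def off_def)
qed

lemma has_ord_mult:
  assumes "has_ord x n" "has_ord y n'"
  shows "has_ord (x * y) (n + n')"
proof -
  obtain t u t' u' where tu: "off t" "off u" "t * x = unif ^ n * u"
      "off t'" "off u'" "t' * y = unif ^ n' * u'"
    using assms by (auto simp: has_ord_def)
  have "(t * t') * (x * y) = (t * x) * (t' * y)" by (simp add: mult_ac)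
  also have "\<dots> = unif ^ (n + n') * (u * u')" by (simp add: tu power_add mult_ac)
  finally show ?thesis unfolding has_ord_def using tu off_mult by blast
qed

lemma has_ord_add:
  assumes "has_ord x n" "has_ord y n'" "has_ord (x + y) l"
  shows "min n n' \<le> l"
proof -
  have main: "n \<le> l"
    if ords: "has_ord x n" "has_ord y n'" "has_ord (x + y) l" and le: "n \<le> n'" for x y n n'
  proof -
    obtain t u t' u' where tu: "off t" "off u" "t * x = unif ^ n * u" "off t'" "off u'" "t' * y = unif ^ n' * u'"
      using ords by (auto simp: has_ord_def)
    obtain s v where sv: "off s" "off v" "s * (x + y) = unif ^ l * v" using ords by (auto simp: has_ord_def)
    have "unif ^ n' = unif ^ n * unif ^ (n' - n)" using le by (simp flip: power_add)
    have "(t * t') * (x + y) = t' * (t * x) + t * (t' * y)" by (simp add: algebra_simps)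
    also have "\<dots> = unif ^ n * (t' * u + t * unif ^ (n' - n) * u')"
      unfolding tu(3,6) \<open>unif ^ n' = _\<close> by (simp add: algebra_simps)
    finally have eq: "(t * t') * (x + y) = unif ^ n * (t' * u + t * unif ^ (n' - n) * u')" .
    show ?thesis
      by (rule has_ord_le[OF off_mult[OF tu(1,4)] eq _ sv])
        (use tu unif_int in \<open>auto dest!: off_int\<close>)
  qed
  show ?thesis
  proof (cases "n \<le> n'")
    case True thus ?thesis using main[OF assms] by simp
  next
    case False
    hence "n' \<le> n" by simp
    thus ?thesis using main[OF assms(2,1)] assms(3) by (simp add: add.commute)
  qed
qed

lemma has_ord_off: "off x \<Longrightarrow> has_ord x 0"
  unfolding has_ord_def using off_1 by (intro exI[of _ 1] exI[of _ x]) auto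

lemma has_ord_unif: "has_ord unif 1"
  unfolding has_ord_def using off_1 by (intro exI[of _ 1] exI[of _ 1]) auto

lemma has_ord_mem:
  assumes "algebraic_int x" "has_ord x n"
  shows "x \<in> p \<longleftrightarrow> n \<noteq> 0"
proof
  assume "x \<in> p"
  thus "n \<noteq> 0"
  proof (rule contrapos_pn)
    assume "n = 0"
    then obtain t u where "off t" "off u" "t * x = u" using assms(2) by (auto simp: has_ord_def)
    thus "x \<notin> p" using idl(3) off_int by (metis off_def)
  qed
next
  assume "n \<noteq> 0"
  thus "x \<in> p" using has_ord_off has_ord_unique assms off_def by blast
qed

section \<open>Powers of the prime and the order of an integer\<close>

abbreviation ipow :: "nat \<Rightarrow> 'k set" where
  "ipow n \<equiv> p [^]\<^bsub>ideals_set integer_ring\<^esub> n"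

lemma ideals_set_simps [simp]:
  "\<one>\<^bsub>ideals_set integer_ring\<^esub> = alg_ints"
  "I \<otimes>\<^bsub>ideals_set integer_ring\<^esub> J = ideal_prod integer_ring I J"
  by (simp_all add: ideals_set_def)

lemma ipow_0: "ipow 0 = alg_ints"
  by simp

lemma ipow_Suc: "ipow (Suc n) = ideal_prod integer_ring (ipow n) p"
  by simp

lemma ring_ideal_ipow: "ring_ideal (ipow n)"
proof (induction n)
  case 0 show ?case by (auto simp: ipow_0 ring_ideal_def add_closed_ints)
next
  case (Suc n)
  thus ?case
    using int_ring.ideal_prod_is_ideal[of "ipow n" p] prime_placeD(1)[OF prime]
    by (simp add: ipow_Suc ideal_iff)
qed

lemma power_in_ipow: "x \<in> p \<Longrightarrow> x ^ n \<in> ipow n"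
proof (induction n)
  case (Suc n)
  hence "x ^ n \<otimes>\<^bsub>integer_ring\<^esub> x \<in> ideal_prod integer_ring (ipow n) p"
    by (intro ideal_prod.prod) auto
  thus ?case by (simp add: ipow_Suc mult.commute)
qed (simp add: ipow_0)

text \<open>Each factor from \<open>p\<close> costs one denominator \<open>s\<close> and yields one
  \<open>unif\<close>; sums of such products keep the common denominator
  \<open>s ^ n\<close>.\<close>

lemma ipow_local:
  assumes s: "unif_pair unif s"
  shows "x \<in> ipow n \<Longrightarrow> \<exists>y. algebraic_int y \<and> s ^ n * x = unif ^ n * y"
proof (induction n arbitrary: x)
  case 0 thus ?case by (auto simp: ipow_0)
next
  case (Suc n)
  from Suc.prems have "x \<in> ideal_prod integer_ring (ipow n) p" by (simp add: ipow_Suc)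
  thus ?case
  proof (induction x rule: ideal_prod.induct)
    case (prod i j)
    obtain y where y: "algebraic_int y" "s ^ n * i = unif ^ n * y" using Suc.IH[OF prod(1)] by blast
    obtain z where z: "algebraic_int z" "s * j = unif * z" using s prod(2) by (auto simp: unif_pair_def)
    have "s ^ Suc n * (i * j) = (s ^ n * i) * (s * j)" by (simp add: mult_ac)
    also have "\<dots> = (unif ^ n * y) * (unif * z)" by (simp only: y z)
    also have "\<dots> = unif ^ Suc n * (y * z)" by (simp add: mult_ac)
    finally show ?case using y z by auto
  next
    case (sum x1 x2)
    then obtain y1 y2 where y: "algebraic_int y1" "s ^ Suc n * x1 = unif ^ Suc n * y1"
      "algebraic_int y2" "s ^ Suc n * x2 = unif ^ Suc n * y2" by blast
    hence "s ^ Suc n * (x1 + x2) = unif ^ Suc n * (y1 + y2)" by (simp only: distrib_left)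
    thus ?case using y by auto
  qed
qed

text \<open>An element outside \<open>p\<close> is invertible modulo every power of
  \<open>p\<close>: with e = 1 - t t' in \<open>p\<close>, the element 1 - e^n is a multiple of 1 -
  e = t t', and e^n lies in the n-th power.\<close>

lemma ipow_off_cancel:
  assumes "off t" "algebraic_int x" "t * x \<in> ipow n"
  shows "x \<in> ipow n"
proof -
  note J = ring_idealD[OF ring_ideal_ipow[of n]]
  obtain t' where t': "algebraic_int t'" "1 - t * t' \<in> p" using inverse_mod[OF assms(1)] .
  define e where "e = 1 - t * t'"
  have e: "e ^ n \<in> ipow n" "algebraic_int e" using t' idl(1) by (auto simp: e_def intro!: power_in_ipow)
  have "1 - e ^ n = (1 - e) * (\<Sum>i<n. e ^ i)" by (rule one_diff_power_eq)
  hence "(1 - e ^ n) * x = (t' * (\<Sum>i<n. e ^ i)) * (t * x)"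
    by (simp add: e_def mult_ac)
  hence "x = e ^ n * x + (t' * (\<Sum>i<n. e ^ i)) * (t * x)"
    by (simp only: left_diff_distrib mult_1 diff_eq_eq add.commute)
  moreover have "algebraic_int (t' * (\<Sum>i<n. e ^ i))" using t'(1) e(2) by auto
  hence "e ^ n * x + (t' * (\<Sum>i<n. e ^ i)) * (t * x) \<in> ipow n"
    by (intro J(5) J(4)[OF assms(2) e(1)] J(3)[OF _ assms(3)])
  ultimately show ?thesis by simp
qed

text \<open>Here the definition of the order by ideal powers meets the local description. One
  direction reads a power of \<open>unif\<close> off membership; the other cancels the denominator
  \<open>t\<close> modulo the k-th power.\<close>

lemma ipow_iff:
  assumes x: "algebraic_int x" "has_ord x n"
  shows "x \<in> ipow k \<longleftrightarrow> k \<le> n"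
proof
  obtain t u where tu: "off t" "off u" "t * x = unif ^ n * u" using x(2) by (auto simp: has_ord_def)
  obtain s where s: "unif_pair unif s" by (rule unif_ex)
  show "k \<le> n" if xk: "x \<in> ipow k"
  proof -
    have "off (s ^ k)" using s off_power by (simp add: unif_pair_def)
    moreover obtain y where "algebraic_int y" "s ^ k * x = unif ^ k * y"
      using ipow_local[OF s xk] by blast
    ultimately show ?thesis using has_ord_le[OF _ _ _ tu] by blast
  qed
  show "x \<in> ipow k" if "k \<le> n"
  proof (rule ipow_off_cancel[OF tu(1) x(1)])
    have "unif ^ n = unif ^ k * unif ^ (n - k)" using that by (simp flip: power_add)
    hence "t * x = (unif ^ (n - k) * u) * unif ^ k" using tu(3) by (simp add: mult_ac)
    also have "\<dots> \<in> ipow k"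
      using power_in_ipow[OF unif_in] unif_int off_int[OF tu(2)]
      by (intro ring_idealD(3)[OF ring_ideal_ipow]) auto
    finally show "t * x \<in> ipow k" .
  qed
qed

lemma integral_ord_eq:
  assumes "algebraic_int x" "has_ord x n"
  shows "iord p x = n"
  unfolding integral_ord_def ipow_iff[OF assms] by (rule Greatest_equality) auto

lemma has_ord_integral_ord: "algebraic_int x \<Longrightarrow> x \<noteq> 0 \<Longrightarrow> has_ord x (iord p x)"
  using has_ord_exists integral_ord_eq by metis

lemma integral_ord_mult:
  assumes "algebraic_int x" "x \<noteq> 0" "algebraic_int y" "y \<noteq> 0"
  shows "iord p (x * y) = iord p x + iord p y"
  using assms by (intro integral_ord_eq has_ord_mult has_ord_integral_ord) auto

lemma integral_ord_add:
  assumes "algebraic_int x" "x \<noteq> 0" "algebraic_int y" "y \<noteq> 0" "x + y \<noteq> 0"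
  shows "min (iord p x) (iord p y) \<le> iord p (x + y)"
  using assms by (intro has_ord_add[of x _ y] has_ord_integral_ord) auto

lemma integral_ord_mem:
  assumes "algebraic_int x" "x \<noteq> 0"
  shows "x \<in> p \<longleftrightarrow> iord p x \<noteq> 0"
  using has_ord_mem has_ord_integral_ord assms by blast

lemma integral_ord_unif: "iord p unif = 1"
  by (rule integral_ord_eq[OF unif_int has_ord_unif])

text \<open>Comparing orders amounts to divisibility in the localisation; \<open>w\<close> is the
  cleared denominator.\<close>

lemma integral_ord_local:
  assumes "algebraic_int x" "x \<noteq> 0" "algebraic_int t" "t \<noteq> 0" "iord p t \<le> iord p x"
  obtains w y where "off w" "algebraic_int y" "w * x = t * y"
proof -
  obtain a u where au: "off a" "off u" "a * x = unif ^ iord p x * u"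
    using has_ord_integral_ord[OF assms(1,2)] by (auto simp: has_ord_def)
  obtain b v where bv: "off b" "off v" "b * t = unif ^ iord p t * v"
    using has_ord_integral_ord[OF assms(3,4)] by (auto simp: has_ord_def)
  have "unif ^ iord p x = unif ^ iord p t * unif ^ (iord p x - iord p t)"
    using assms(5) by (simp flip: power_add)
  hence "v * (a * x) = (b * t) * (unif ^ (iord p x - iord p t) * u)"
    by (simp add: au(3) bv(3) mult_ac)
  hence "(v * a) * x = t * (unif ^ (iord p x - iord p t) * (u * b))"
    by (simp add: mult_ac)
  moreover have "off (v * a)" by (rule off_mult[OF bv(2) au(1)])
  moreover have "algebraic_int (unif ^ (iord p x - iord p t) * (u * b))"
    using unif_int off_int[OF au(2)] off_int[OF bv(1)] by auto
  ultimately show ?thesis by (rule that[rotated -1])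
qed

end

section \<open>The product formula\<close>

context primitive_gen
begin

lemma placeI: "p \<in> finite_places \<Longrightarrow> place \<theta> m p"
  by (simp add: place_def primitive_gen_axioms place_axioms_def finite_places_iff)

lemmas iord_mult = place.integral_ord_mult[OF placeI]
  and iord_add = place.integral_ord_add[OF placeI]
  and iord_mem = place.integral_ord_mem[OF placeI]

lemma iord_1: "p \<in> finite_places \<Longrightarrow> iord p (1::'k) = 0"
  using iord_mult[of p 1 1] by simp

lemma iord_power:
  "p \<in> finite_places \<Longrightarrow> algebraic_int (x::'k) \<Longrightarrow> x \<noteq> 0 \<Longrightarrow> iord p (x ^ n) = n * iord p x"
proof (induction n)
  case (Suc n)
  have "algebraic_int (x ^ n)" "x ^ n \<noteq> 0" using Suc.prems by auto
  thus ?case using Suc iord_mult[of p x "x ^ n"] by simp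
qed (simp add: iord_1)

lemma place_ideal: "p \<in> finite_places \<Longrightarrow> ring_ideal (p :: 'k set)"
  using finite_places_iff prime_placeD(1) by blast

lemma fraction:
  obtains a :: 'k and n :: nat where "algebraic_int a" "n > 0" "x = a / of_nat n"
proof -
  obtain n :: nat where n: "n > 0" "algebraic_int (of_nat n * x)"
    using algebraic_multiple_integral[OF all_algebraic] .
  thus ?thesis using that[of "of_nat n * x" n] by simp
qed

lemma prime_ord_divide:
  assumes p: "p \<in> finite_places" and a: "algebraic_int (a::'k)" "a \<noteq> 0" and b: "algebraic_int b" "b \<noteq> 0"
  shows "prime_ord p (a / b) = int (iord p a) - int (iord p b)"
  unfolding prime_ord_def
proof (rule the_equality)
  show "\<exists>a'\<in>carrier integer_ring. \<exists>b'\<in>carrier integer_ring. a' \<noteq> 0 \<and> b' \<noteq> 0 \<and> a / b = a' / b' \<and>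
      int (iord p a) - int (iord p b) = int (iord p a') - int (iord p b')"
    using a b by (intro bexI[of _ a] bexI[of _ b]) auto
  fix l assume "\<exists>a'\<in>carrier integer_ring. \<exists>b'\<in>carrier integer_ring. a' \<noteq> 0 \<and> b' \<noteq> 0 \<and>
      a / b = a' / b' \<and> l = int (iord p a') - int (iord p b')"
  then obtain a' b' where ab: "algebraic_int a'" "algebraic_int b'" "a' \<noteq> 0" "b' \<noteq> 0" "a / b = a' / b'"
    "l = int (iord p a') - int (iord p b')" by auto
  have "a * b' = a' * b" using ab(5) ab(4) b(2) by (simp add: frac_eq_eq)
  hence "iord p a + iord p b' = iord p a' + iord p b"
    using iord_mult[OF p] a b ab by metis
  thus "l = int (iord p a) - int (iord p b)" using ab(6) by linarith
qed

lemma prime_ord_int: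
  "p \<in> finite_places \<Longrightarrow> algebraic_int (a::'k) \<Longrightarrow> a \<noteq> 0 \<Longrightarrow> prime_ord p a = int (iord p a)"
  using prime_ord_divide[of p a 1] by (simp add: iord_1)

lemma prime_ord_mult:
  assumes p: "p \<in> finite_places" and x: "(x::'k) \<noteq> 0" and y: "y \<noteq> 0"
  shows "prime_ord p (x * y) = prime_ord p x + prime_ord p y"
proof -
  obtain a n where a: "algebraic_int a" "n > 0" "x = a / of_nat n" by (rule fraction)
  obtain b l where b: "algebraic_int b" "l > 0" "y = b / of_nat l" by (rule fraction)
  have nz: "a \<noteq> 0" "b \<noteq> 0" "(of_nat n :: 'k) \<noteq> 0" "(of_nat l :: 'k) \<noteq> 0" using a b x y by auto
  have "prime_ord p (x * y) = prime_ord p ((a * b) / (of_nat n * of_nat l))" by (simp add: a b)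
  also have "\<dots> = prime_ord p (a / of_nat n) + prime_ord p (b / of_nat l)"
    using a b nz by (simp add: prime_ord_divide[OF p] iord_mult[OF p] algebraic_int_mult)
  finally show ?thesis by (simp add: a b)
qed

lemma prime_ord_add:
  assumes p: "p \<in> finite_places" and nz: "(x::'k) \<noteq> 0" "y \<noteq> 0" "x + y \<noteq> 0"
  shows "min (prime_ord p x) (prime_ord p y) \<le> prime_ord p (x + y)"
proof -
  obtain a n where a: "algebraic_int a" "n > 0" "x = a / of_nat n" by (rule fraction)
  obtain b l where b: "algebraic_int b" "l > 0" "y = b / of_nat l" by (rule fraction)
  define c where "c = (of_nat (n * l) :: 'k)"
  have c: "c \<noteq> 0" "algebraic_int c" using a b by (auto simp: c_def)
  have int: "algebraic_int (c * x)" "algebraic_int (c * y)"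
    using a b by (auto simp: c_def)
  have add: "prime_ord p (c * z) = prime_ord p c + prime_ord p z" if "z \<noteq> 0" for z
    using prime_ord_mult[OF p c(1) that] .
  have ints: "iord p (c * z) = prime_ord p c + prime_ord p z"
    if "z \<noteq> 0" "algebraic_int (c * z)" for z
    using add[OF that(1)] prime_ord_int[OF p that(2)] that c by simp
  have "min (iord p (c * x)) (iord p (c * y)) \<le> iord p (c * x + c * y)"
    using int nz c by (intro iord_add[OF p]) (auto simp flip: distrib_left)
  hence "min (int (iord p (c * x))) (int (iord p (c * y))) \<le> int (iord p (c * (x + y)))"
    by (simp add: distrib_left)
  moreover have "algebraic_int (c * (x + y))" using int by (auto simp: distrib_left)
  ultimately show ?thesis using ints[OF nz(1) int(1)] ints[OF nz(2) int(2)] ints[OF nz(3)] by simp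
qed

text \<open>An ideal containing \<open>a\<close> is a union of classes modulo \<open>a\<close>, so
  its trace on a set of representatives determines it. This reduces questions about such ideals to
  subsets of a finite set.\<close>

lemma ideal_determined:
  assumes I: "ring_ideal I" and J: "ring_ideal J" and sub: "multiples a \<subseteq> I" "multiples a \<subseteq> J"
    and R: "\<forall>x\<in>alg_ints. \<exists>r\<in>R. x - r \<in> multiples a" and eq: "I \<inter> R \<subseteq> J"
  shows "I \<subseteq> J"
proof
  fix x assume x: "x \<in> I"
  obtain r where r: "r \<in> R" "x - r \<in> multiples a" using R ring_idealD(1)[OF I x] by blast
  have "x - r \<in> I" "x - r \<in> J" using r(2) sub by blast+
  from ring_idealD(6)[OF I x this(1)] have "r \<in> J" using eq r(1) by auto
  from ring_idealD(5)[OF J \<open>x - r \<in> J\<close> this] have "(x - r) + r \<in> J" .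
  thus "x \<in> J" by simp
qed

lemma ideal_multiples: "ring_ideal I \<Longrightarrow> a \<in> I \<Longrightarrow> multiples a \<subseteq> I"
  by (auto simp: multiples_def intro: ring_idealD)

lemma transversal_mod:
  assumes "algebraic_int (a::'k)" "a \<noteq> 0"
  obtains R where "finite R" "\<forall>x\<in>alg_ints. \<exists>r\<in>R. x - r \<in> multiples a"
proof -
  obtain R where R: "bij_betw (\<lambda>x. (+) x ` multiples a) R (residue_classes a)"
    "\<forall>x\<in>alg_ints. \<exists>r\<in>R. x - r \<in> multiples a"
    by (rule transversal[OF add_closed_multiples[of a], of alg_ints])
  have "finite R" using finite_mod[OF assms] bij_betw_finite[OF R(1)] by blast
  thus ?thesis using that R(2) by blast
qed

text \<open>The primes containing \<open>a\<close> inject into the subsets of a finite set of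
  representatives modulo \<open>a\<close>.\<close>

lemma finite_places_containing:
  assumes "algebraic_int (a::'k)" "a \<noteq> 0"
  shows "finite {p \<in> finite_places. a \<in> p}"
proof -
  obtain R where R: "finite R" "\<forall>x\<in>alg_ints. \<exists>r\<in>R. x - r \<in> multiples a"
    by (rule transversal_mod[OF assms])
  have "inj_on (\<lambda>p. p \<inter> R) {p \<in> finite_places. a \<in> p}"
  proof (rule inj_onI)
    fix I J assume IJ: "I \<in> {p \<in> finite_places. a \<in> p}" "J \<in> {p \<in> finite_places. a \<in> p}"
      and eq: "I \<inter> R = J \<inter> R"
    hence id: "ring_ideal I" "ring_ideal J" "a \<in> I" "a \<in> J" using place_ideal by auto
    note ms = ideal_multiples[OF id(1,3)] ideal_multiples[OF id(2,4)]
    show "I = J"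
      using ideal_determined[OF id(1,2) ms R(2)] ideal_determined[OF id(2,1) ms(2,1) R(2)] eq by blast
  qed
  moreover have "(\<lambda>p. p \<inter> R) ` {p \<in> finite_places. a \<in> p} \<subseteq> Pow R" by auto
  ultimately show ?thesis using R(1) by (meson finite_Pow_iff finite_imageD finite_subset)
qed

lemma finite_ord_support:
  assumes "(x::'k) \<noteq> 0"
  shows "finite {p \<in> finite_places. prime_ord p x \<noteq> 0}"
proof -
  obtain a n where a: "algebraic_int a" "n > 0" "x = a / of_nat n" by (rule fraction)
  have nz: "a \<noteq> 0" "(of_nat n :: 'k) \<noteq> 0" using a assms by auto
  have "{p \<in> finite_places. prime_ord p x \<noteq> 0}
      \<subseteq> {p \<in> finite_places. a \<in> p} \<union> {p \<in> finite_places. of_nat n \<in> p}"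
  proof
    fix p assume "p \<in> {p \<in> finite_places. prime_ord p x \<noteq> 0}"
    hence p: "p \<in> finite_places" "prime_ord p x \<noteq> 0" by auto
    have "iord p a \<noteq> 0 \<or> iord p (of_nat n :: 'k) \<noteq> 0"
      using p(2) prime_ord_divide[OF p(1) a(1) nz(1) _ nz(2)] a by auto
    thus "p \<in> {p \<in> finite_places. a \<in> p} \<union> {p \<in> finite_places. of_nat n \<in> p}"
      using iord_mem[OF p(1) a(1) nz(1)] iord_mem[OF p(1) _ nz(2)] p(1) by auto
  qed
  moreover have "finite ({p \<in> finite_places. a \<in> p} \<union> {p \<in> finite_places. of_nat n \<in> p})"
    using finite_places_containing[OF a(1) nz(1)] finite_places_containing[OF _ nz(2)] by simp
  ultimately show ?thesis by (rule finite_subset)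
qed

text \<open>A proper ideal containing \<open>c\<close> that is as large as possible modulo \<open>c\<close> is prime.\<close>

lemma prime_place_containing:
  assumes B: "ring_ideal (B :: 'k set)" "c \<in> B" "c \<noteq> 0" "1 \<notin> B"
  obtains p where "p \<in> finite_places" "B \<subseteq> p"
proof -
  have c: "algebraic_int c" using ring_idealD(1)[OF B(1,2)] .
  obtain R where R: "finite R" "\<forall>x\<in>alg_ints. \<exists>r\<in>R. x - r \<in> multiples c"
    by (rule transversal_mod[OF c B(3)])
  let ?P = "\<lambda>I. ring_ideal I \<and> B \<subseteq> I \<and> 1 \<notin> I"
  have bound: "\<forall>I. ?P I \<longrightarrow> card (I \<inter> R) < Suc (card R)"
    using R(1) by (auto intro!: card_mono le_imp_less_Suc)
  obtain I where I: "?P I" "\<And>J. ?P J \<Longrightarrow> card (J \<inter> R) \<le> card (I \<inter> R)"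
    using ex_has_greatest_nat[of ?P B "\<lambda>I. card (I \<inter> R)", OF _ bound] B by blast
  have cI: "multiples c \<subseteq> J" if "?P J" for J using that B(2) ideal_multiples by blast
  have maxi: "J = I" if J: "?P J" "I \<subseteq> J" for J
  proof -
    have "card (J \<inter> R) \<le> card (I \<inter> R)" "I \<inter> R \<subseteq> J \<inter> R" using I(2) J by blast+
    hence "J \<inter> R \<subseteq> I" using card_seteq[of "J \<inter> R" "I \<inter> R"] R(1) by blast
    hence "J \<subseteq> I" using ideal_determined[of J I c R] J(1) I(1) cI R(2) by blast
    thus ?thesis using J(2) by blast
  qed
  note idI = ring_idealD[OF conjunct1[OF I(1)]]
  have pr: "x \<in> I \<or> y \<in> I" if xy: "algebraic_int x" "algebraic_int y" "x * y \<in> I" for x y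
  proof (rule ccontr)
    assume n: "\<not> (x \<in> I \<or> y \<in> I)"
    \<comment> \<open>This is I + xO. It is strictly larger than \<open>I\<close>, so by maximality
      it contains 1 = i + x r; multiplying by \<open>y\<close> gives y \<in> I.\<close>
    define J where "J = {i + x * r | i r. i \<in> I \<and> algebraic_int r}"
    have idJ: "ring_ideal J"
      unfolding ring_ideal_def add_closed_def
    proof (intro conjI ballI subsetI)
      show "z \<in> alg_ints" if "z \<in> J" for z using that idI(1) xy(1) by (auto simp: J_def)
      show "0 \<in> J" unfolding J_def using idI(7) by (auto intro!: exI[of _ 0])
      show "z - z' \<in> J" if z: "z \<in> J" "z' \<in> J" for z z'
      proof -
        obtain i r i' r' where "z = i + x * r" "z' = i' + x * r'" "i \<in> I" "i' \<in> I"
          "algebraic_int r" "algebraic_int r'" using z by (auto simp: J_def)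
        thus ?thesis unfolding J_def using idI(6)
          by (intro CollectI exI[of _ "i - i'"] exI[of _ "r - r'"]) (auto simp: algebra_simps)
      qed
      show "s * z \<in> J" if z: "s \<in> alg_ints" "z \<in> J" for s z
      proof -
        obtain i r where "z = i + x * r" "i \<in> I" "algebraic_int r" using z by (auto simp: J_def)
        moreover from this have "s * i \<in> I" using idI(3)[of s i] z(1) by simp
        ultimately have "s * z = s * i + x * (s * r)" "s * i \<in> I" "algebraic_int (s * r)"
          using z(1) by (auto simp: algebra_simps)
        thus ?thesis unfolding J_def by blast
      qed
    qed
    have IJ: "I \<subseteq> J"
    proof
      fix i assume "i \<in> I"
      thus "i \<in> J" unfolding J_def by (intro CollectI exI[of _ i] exI[of _ 0]) simp
    qed
    have "x \<in> J" unfolding J_def using idI(7) by (intro CollectI exI[of _ 0] exI[of _ 1]) auto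
    hence "J \<noteq> I" using n by blast
    hence "1 \<in> J" using maxi[of J] idJ IJ I(1) by blast
    then obtain i r where ir: "1 = i + x * r" "i \<in> I" "algebraic_int r" by (auto simp: J_def)
    have "y = i * y + (x * y) * r" using arg_cong[OF ir(1), of "\<lambda>z. z * y"] by (simp add: algebra_simps)
    moreover have "i * y + (x * y) * r \<in> I"
      by (rule idI(5)[OF idI(4)[OF xy(2) ir(2)] idI(4)[OF ir(3) xy(3)]])
    ultimately show False using n by simp
  qed
  have "prime_place I" unfolding prime_place_def using I(1) pr B(2,3) by blast
  thus ?thesis using that[of I] I(1) finite_places_iff by blast
qed

text \<open>The denominators of a non-integral \<open>x\<close> form a proper ideal, contained in
  some prime \<open>p\<close>. But a nonnegative order at \<open>p\<close> provides a denominator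
  outside \<open>p\<close>.\<close>

lemma integral_if_ords_nonneg:
  assumes "(x::'k) \<noteq> 0" "\<And>p. p \<in> finite_places \<Longrightarrow> prime_ord p x \<ge> 0"
  shows "algebraic_int x"
proof (rule ccontr)
  assume nint: "\<not> algebraic_int x"
  obtain a n where a: "algebraic_int a" "n > 0" "x = a / of_nat n" by (rule fraction)
  define b where "b = (of_nat n :: 'k)"
  have ab: "a \<noteq> 0" "b \<noteq> 0" "algebraic_int b" "x = a / b" using a assms(1) by (auto simp: b_def)
  define B where "B = {c. algebraic_int c \<and> algebraic_int (c * x)}"
  have "ring_ideal B"
    unfolding ring_ideal_def add_closed_def B_def by (auto simp: left_diff_distrib mult.assoc)
  moreover have "b \<in> B" using ab a by (simp add: B_def)
  moreover have "1 \<notin> B" using nint by (simp add: B_def)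
  ultimately obtain p where p: "p \<in> finite_places" "B \<subseteq> p"
    using prime_place_containing[of B b] ab(2) by blast
  interpret place \<theta> m p by (rule placeI[OF p(1)])
  have "iord p b \<le> iord p a"
    using assms(2)[OF p(1)] prime_ord_divide[OF p(1) a(1) ab(1,3,2)] ab(4) by simp
  then obtain w y where wy: "off w" "algebraic_int y" "w * a = b * y"
    using integral_ord_local[OF a(1) ab(1,3,2)] by blast
  have "w * x = w * a / b" by (simp add: ab(4))
  hence "w * x = y" by (simp add: wy(3) ab(2))
  hence "w \<in> B" using wy off_int by (simp add: B_def)
  thus False using wy(1) p(2) by (auto simp: off_def)
qed

text \<open>The analogue of the product of the prime powers p^(e p), cut out by inequalities on
  orders, so that its index can be found without multiplying ideals.\<close>

definition val_ideal :: "('k set \<Rightarrow> nat) \<Rightarrow> 'k set" where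
  "val_ideal e = {x. algebraic_int x \<and> (x = 0 \<or> (\<forall>p\<in>finite_places. e p \<le> iord p x))}"

lemma val_ideal_ideal: "ring_ideal (val_ideal e)"
  unfolding ring_ideal_def add_closed_def
proof (intro conjI ballI subsetI)
  show "x \<in> alg_ints" if "x \<in> val_ideal e" for x using that by (simp add: val_ideal_def)
  show "0 \<in> val_ideal e" by (simp add: val_ideal_def)
  show "r * x \<in> val_ideal e" if "r \<in> alg_ints" "x \<in> val_ideal e" for r x
  proof (cases "r = 0 \<or> x = 0")
    case False
    thus ?thesis using that by (auto simp: val_ideal_def iord_mult trans_le_add2)
  qed (use that in \<open>auto simp: val_ideal_def\<close>)
  note mul = this
  show "x - y \<in> val_ideal e" if xy: "x \<in> val_ideal e" "y \<in> val_ideal e" for x y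
  proof (cases "x = 0 \<or> y = 0 \<or> x - y = 0")
    case True
    thus ?thesis using xy mul[of "- 1" y] by (auto simp: val_ideal_def)
  next
    case False
    have "- 1 * y \<in> val_ideal e" using mul[of "- 1" y] xy(2) by simp
    hence y: "- y \<in> val_ideal e" by simp
    have "e p \<le> iord p (x - y)" if p: "p \<in> finite_places" for p
    proof -
      have "min (iord p x) (iord p (- y)) \<le> iord p (x + - y)"
        using iord_add[OF p, of x "- y"] xy False by (simp add: val_ideal_def)
      moreover have "e p \<le> iord p x" "e p \<le> iord p (- y)"
        using xy(1) y False p by (auto simp: val_ideal_def)
      ultimately show ?thesis by simp
    qed
    thus ?thesis using xy by (auto simp: val_ideal_def)
  qed
qed

text \<open>Inclusion would make the larger prime contain both 1 - x y and x for some
  \<open>x\<close> outside the smaller one, hence contain 1.\<close>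

lemma places_incomparable:
  assumes p: "p \<in> finite_places" and q: "(\<qq> :: 'k set) \<in> finite_places" and ne: "p \<noteq> \<qq>"
  obtains c where "c \<in> p" "c \<notin> \<qq>"
proof -
  interpret P: place \<theta> m p by (rule placeI[OF p])
  interpret Q: place \<theta> m \<qq> by (rule placeI[OF q])
  have "\<not> p \<subseteq> \<qq>"
  proof
    assume sub: "p \<subseteq> \<qq>"
    then obtain x where x: "x \<in> \<qq>" "x \<notin> p" using ne by blast
    hence "P.off x" using Q.idl(1) by (simp add: P.off_def)
    then obtain y where y: "algebraic_int y" "1 - x * y \<in> p" by (rule P.inverse_mod)
    have "(1 - x * y) + x * y \<in> \<qq>" using y sub x by (intro Q.idl(5) Q.idl(4)) auto
    thus False using prime_placeD(2)[OF Q.prime] by simp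
  qed
  thus ?thesis using that by blast
qed

text \<open>The element is a product over \<open>S\<close> of factors raised to \<open>e p\<close>.
  For p = \<qq> the factor is a uniformiser; for any other p it lies in p but not in \<qq>, so it
  does not disturb the order at \<qq>.\<close>

lemma approximation:
  assumes q: "(\<qq> :: 'k set) \<in> finite_places" and S: "finite S" "S \<subseteq> finite_places"
  shows "\<exists>t. algebraic_int t \<and> t \<noteq> 0 \<and> iord \<qq> t = (if \<qq> \<in> S then e \<qq> else 0) \<and>
    (\<forall>p\<in>S. e p \<le> iord p t)"
  using S
proof (induction S rule: finite_induct)
  case empty
  show ?case using iord_1[OF q] by (intro exI[of _ 1]) auto
next
  case (insert p S)
  then obtain t where t: "algebraic_int t" "t \<noteq> 0" "iord \<qq> t = (if \<qq> \<in> S then e \<qq> else 0)"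
    "\<forall>p\<in>S. e p \<le> iord p t" by auto
  have p: "p \<in> finite_places" using insert.prems by auto
  interpret P: place \<theta> m p by (rule placeI[OF p])
  obtain c where c: "algebraic_int c" "c \<noteq> 0" "iord \<qq> c = (if \<qq> = p then 1 else 0)"
    "1 \<le> iord p c"
  proof (cases "\<qq> = p")
    case True
    thus ?thesis using that[of P.unif] P.unif_int P.unif_nz P.integral_ord_unif by simp
  next
    case False
    then obtain c where c: "c \<in> p" "c \<notin> \<qq>" using places_incomparable[OF p q] by blast
    have ci: "algebraic_int c" using P.idl(1)[OF c(1)] .
    have c0: "c \<noteq> 0" using c(2) ring_idealD(7)[OF place_ideal[OF q]] by auto
    show ?thesis
      using that[of c] ci c0 iord_mem[OF q ci c0] iord_mem[OF p ci c0] c False by simp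
  qed
  have ce: "algebraic_int (c ^ e p)" "c ^ e p \<noteq> 0" using c by auto
  have ord: "iord \<rr> (t * c ^ e p) = iord \<rr> t + e p * iord \<rr> c"
    if "\<rr> \<in> finite_places" for \<rr>
    using iord_mult[OF that t(1,2) ce] iord_power[OF that c(1,2)] by simp
  show ?case
  proof (intro exI conjI ballI)
    show "algebraic_int (t * c ^ e p)" using t(1) ce by auto
    show "t * c ^ e p \<noteq> 0" using t(2) ce by auto
    show "iord \<qq> (t * c ^ e p) = (if \<qq> \<in> insert p S then e \<qq> else 0)"
      unfolding ord[OF q] using t(3) c(3) insert.hyps by auto
    fix \<rr> assume r: "\<rr> \<in> insert p S"
    hence rf: "\<rr> \<in> finite_places" using insert.prems by auto
    show "e \<rr> \<le> iord \<rr> (t * c ^ e p)"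
    proof (cases "\<rr> = p")
      case True
      have "e p \<le> e p * iord p c"
        using mult_le_mono2[OF c(4), of "e p"] unfolding mult_1_right .
      thus ?thesis unfolding True ord[OF p] by (rule trans_le_add2)
    next
      case False
      thus ?thesis unfolding ord[OF rf] using r t(4) by (simp add: trans_le_add1)
    qed
  qed
qed

text \<open>Multiplication by an element \<open>t\<close> of the larger ideal with exact order
  \<open>e \<qq>\<close> at \<qq> induces an isomorphism from O/\<qq> onto the quotient of the two
  ideals.\<close>

lemma val_ideal_step:
  assumes q: "(\<qq> :: 'k set) \<in> finite_places" and S: "finite S" "S \<subseteq> finite_places" "\<And>p. p \<notin> S \<Longrightarrow> e p = 0"
    and e': "e' = e(\<qq> := Suc (e \<qq>))"
  shows "finite (cosets (val_ideal e) (val_ideal e'))"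
    "card (cosets (val_ideal e) (val_ideal e')) = ideal_norm \<qq>"
proof -
  interpret Q: place \<theta> m \<qq> by (rule placeI[OF q])
  obtain t where t: "algebraic_int t" "t \<noteq> 0" "iord \<qq> t = (if \<qq> \<in> S then e \<qq> else 0)"
    "\<forall>p\<in>S. e p \<le> iord p t" using approximation[OF q S(1,2)] by blast
  have tq: "iord \<qq> t = e \<qq>" using t(3) S(3) by auto
  have tp: "e p \<le> iord p t" for p using t(4) S(3)[of p] by (cases "p \<in> S") auto
  have tV: "t \<in> val_ideal e" using t(1) tp by (simp add: val_ideal_def)
  note V = ring_idealD[OF val_ideal_ideal[of e]]
  have ker: "z * t \<in> val_ideal e' \<longleftrightarrow> z \<in> \<qq>" if z: "algebraic_int z" for z
  proof (cases "z = 0")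
    case True
    thus ?thesis using Q.idl(7) by (simp add: val_ideal_def)
  next
    case False
    have "z * t \<in> val_ideal e' \<longleftrightarrow> (\<forall>p\<in>finite_places. e' p \<le> iord p z + iord p t)"
      using False t z by (auto simp: val_ideal_def iord_mult)
    also have "\<dots> \<longleftrightarrow> 1 \<le> iord \<qq> z"
    proof
      assume "\<forall>p\<in>finite_places. e' p \<le> iord p z + iord p t"
      from bspec[OF this q] show "1 \<le> iord \<qq> z" by (simp add: e' tq)
    next
      assume "1 \<le> iord \<qq> z"
      thus "\<forall>p\<in>finite_places. e' p \<le> iord p z + iord p t"
        using tp tq by (auto simp: e' trans_le_add2)
    qed
    also have "\<dots> \<longleftrightarrow> z \<in> \<qq>" using iord_mem[OF q z False] by auto
    finally show ?thesis .
  qed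
  have surj: "\<exists>r\<in>alg_ints. y - r * t \<in> val_ideal e'" if y: "y \<in> val_ideal e" for y
  proof (cases "y = 0")
    case True
    thus ?thesis by (intro bexI[of _ 0]) (auto simp: val_ideal_def)
  next
    case False
    have yi: "algebraic_int y" "iord \<qq> t \<le> iord \<qq> y"
      using y q False tq by (auto simp: val_ideal_def)
    obtain w y' where w: "Q.off w" "algebraic_int y'" "w * y = t * y'"
      using Q.integral_ord_local[OF yi(1) False t(1,2) yi(2)] by blast
    obtain w' where w': "algebraic_int w'" "1 - w * w' \<in> \<qq>" by (rule Q.inverse_mod[OF w(1)])
    \<comment> \<open>Locally at \<qq> the quotient y/t is y'/w, and w' inverts w modulo \<qq>. So r
      approximates y/t modulo \<qq>, which raises the order of y - r t by one.\<close>
    define r where "r = y' * w'"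
    have r: "algebraic_int r" using w w' by (auto simp: r_def)
    have dV: "y - r * t \<in> val_ideal e" using y r tV by (intro V(6) V(3)) auto
    have eq: "w * (y - r * t) = (t * y') * (1 - w * w')"
      using w(3) by (simp add: r_def algebra_simps)
    have "e' p \<le> iord p (y - r * t)" if p: "p \<in> finite_places" and nz: "y - r * t \<noteq> 0" for p
    proof (cases "p = \<qq>")
      case False
      thus ?thesis using dV p nz by (simp add: val_ideal_def e')
    next
      case True
      have wi: "algebraic_int w" "w \<noteq> 0" using Q.off_int Q.off_nz w(1) by auto
      have di: "algebraic_int (y - r * t)" using dV by (simp add: val_ideal_def)
      have "w * (y - r * t) \<noteq> 0" using wi nz by simp
      hence nz': "y' \<noteq> 0" "1 - w * w' \<noteq> 0" unfolding eq by auto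
      have oi: "algebraic_int (1 - w * w')" using Q.idl(1)[OF w'(2)] .
      have ty: "algebraic_int (t * y')" "t * y' \<noteq> 0" using t w(2) nz' by auto
      have "iord \<qq> (w * (y - r * t)) = iord \<qq> (y - r * t)"
        using iord_mult[OF q wi di nz] iord_mem[OF q wi] w(1) by (auto simp: Q.off_def)
      moreover have "iord \<qq> (w * (y - r * t)) = e \<qq> + iord \<qq> y' + iord \<qq> (1 - w * w')"
        unfolding eq iord_mult[OF q ty oi nz'(2)] iord_mult[OF q t(1,2) w(2) nz'(1)] tq by simp
      moreover have "iord \<qq> (1 - w * w') \<noteq> 0" using iord_mem[OF q oi nz'(2)] w'(2) by simp
      ultimately show ?thesis using True by (simp add: e')
    qed
    hence "y - r * t \<in> val_ideal e'" using dV by (auto simp: val_ideal_def)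
    thus ?thesis using r by blast
  qed
  have into: "r * t \<in> val_ideal e" if "r \<in> alg_ints" for r using that tV V(3) by simp
  have ker2: "x * t - y * t \<in> val_ideal e' \<longleftrightarrow> x - y \<in> \<qq>" if "x \<in> alg_ints" "y \<in> alg_ints" for x y
    using ker[of "x - y"] that by (auto simp: left_diff_distrib)
  note bij = bij_cosets[where h = "\<lambda>r. r * t", OF Q.idl(2) ring_idealD(2)[OF val_ideal_ideal] into ker2 surj]
  show "finite (cosets (val_ideal e) (val_ideal e'))"
    "card (cosets (val_ideal e) (val_ideal e')) = ideal_norm \<qq>"
    using bij Q.finite_residues ideal_norm_eq[OF place_ideal[OF q]] by auto
qed

lemma index_val_ideal:
  assumes S: "finite S" "S \<subseteq> finite_places" and e: "\<And>p. p \<notin> S \<Longrightarrow> e p = 0"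
  shows "finite (cosets alg_ints (val_ideal e)) \<and>
    card (cosets alg_ints (val_ideal e)) = (\<Prod>p\<in>S. ideal_norm p ^ e p)"
  using e
proof (induction "\<Sum>p\<in>S. e p" arbitrary: e)
  case 0
  hence "e = (\<lambda>_. 0)" using S(1) by (auto simp: fun_eq_iff)
  hence V: "val_ideal e = alg_ints" by (auto simp: val_ideal_def)
  have "cosets alg_ints (alg_ints :: 'k set) = {alg_ints}"
  proof -
    have "(+) x ` alg_ints = (+) 0 ` alg_ints" if "x \<in> alg_ints" for x :: 'k
      using coset_eq_iff[OF add_closed_ints, of x 0] that by simp
    thus ?thesis unfolding cosets_def by (auto simp: image_iff)
  qed
  thus ?case using \<open>e = _\<close> V by simp
next
  case (Suc n)
  then obtain \<qq> where q: "\<qq> \<in> S" "e \<qq> > 0"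
    by (metis less_not_refl neq0_conv sum.neutral zero_less_Suc)
  define e0 where "e0 = e(\<qq> := e \<qq> - 1)"
  have e: "e = e0(\<qq> := Suc (e0 \<qq>))" using q(2) by (auto simp: e0_def)
  have sup: "e0 p = 0" if "p \<notin> S" for p using Suc.prems[OF that] that q by (auto simp: e0_def)
  have "(\<Sum>p\<in>S. e p) = Suc (\<Sum>p\<in>S. e0 p)"
    using S(1) q by (simp add: sum.remove e0_def)
  hence IH: "finite (cosets alg_ints (val_ideal e0))"
    "card (cosets alg_ints (val_ideal e0)) = (\<Prod>p\<in>S. ideal_norm p ^ e0 p)"
    using Suc.hyps(1)[of e0] Suc.hyps(2) sup by auto
  have qf: "\<qq> \<in> finite_places" using q S by auto
  note step = val_ideal_step[OF qf S sup e]
  have sub: "val_ideal e \<subseteq> val_ideal e0"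
    by (force simp: val_ideal_def e0_def)
  have sub2: "val_ideal e0 \<subseteq> alg_ints" by (auto simp: val_ideal_def)
  note tower = card_cosets_tower[OF add_closed_ints ring_idealD(2)[OF val_ideal_ideal]
      ring_idealD(2)[OF val_ideal_ideal] sub sub2 IH(1) step(1)]
  have "(\<Prod>p\<in>S. ideal_norm p ^ e p) = (\<Prod>p\<in>S. ideal_norm p ^ e0 p) * ideal_norm \<qq>"
    using S(1) q by (simp add: prod.remove[of S \<qq>] e0_def) (metis Suc_pred mult.assoc mult.commute power_Suc)
  thus ?case using tower IH(2) step(2) by simp
qed

text \<open>The principal ideal of \<open>a\<close> is the one cut out by the orders of
  \<open>a\<close>: having at least these orders makes x/a of nonnegative order everywhere, hence
  integral.\<close>

lemma index_multiples:
  assumes a: "algebraic_int (a::'k)" "a \<noteq> 0" and S: "S = {p \<in> finite_places. a \<in> p}"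
  shows "card (residue_classes a) = (\<Prod>p\<in>S. ideal_norm p ^ iord p a)"
proof -
  define e where "e = (\<lambda>p. if p \<in> S then iord p a else 0)"
  have eS: "e p = iord p a" if "p \<in> finite_places" for p
    using that iord_mem[OF that a] by (auto simp: e_def S)
  have "multiples a = val_ideal e"
  proof (intro equalityI subsetI)
    fix x assume "x \<in> multiples a"
    then obtain y where "algebraic_int y" "x = a * y" by (auto simp: multiples_def)
    thus "x \<in> val_ideal e" using a eS by (auto simp: val_ideal_def iord_mult)
  next
    fix x assume x: "x \<in> val_ideal e"
    show "x \<in> multiples a"
    proof (cases "x = 0")
      case True thus ?thesis using a by (simp add: multiples_iff)
    next
      case False
      have xi: "algebraic_int x" using x by (simp add: val_ideal_def)
      have "prime_ord p (x / a) \<ge> 0" if "p \<in> finite_places" for p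
        using x False that eS[OF that] prime_ord_divide[OF that xi False a] by (auto simp: val_ideal_def)
      hence "algebraic_int (x / a)" using integral_if_ords_nonneg[of "x / a"] False a(2) by simp
      thus ?thesis using a by (simp add: multiples_iff)
    qed
  qed
  moreover have "finite S" "S \<subseteq> finite_places" unfolding S using finite_places_containing[OF a] by auto
  hence "card (cosets alg_ints (val_ideal e)) = (\<Prod>p\<in>S. ideal_norm p ^ e p)"
    using index_val_ideal[of S e] by (simp add: e_def)
  ultimately show ?thesis by (simp add: e_def cong: prod.cong)
qed

lemma ideal_norm_ge_2:
  assumes p: "(p :: 'k set) \<in> finite_places"
  shows "ideal_norm p \<ge> 2"
proof -
  interpret P: place \<theta> m p by (rule placeI[OF p])
  have "(+) 1 ` p \<noteq> (+) 0 ` p"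
    using coset_eq_iff[OF P.idl(2), of 1 0] prime_placeD(2)[OF P.prime] by simp
  hence "card {(+) 1 ` p, (+) 0 ` p} = 2" by simp
  moreover have "(+) 1 ` p \<in> cosets alg_ints p" "(+) 0 ` p \<in> cosets alg_ints p"
    unfolding cosets_def by (rule imageI, simp)+
  hence "{(+) 1 ` p, (+) 0 ` p} \<subseteq> cosets alg_ints p" by blast
  ultimately show ?thesis
    using card_mono[OF P.finite_residues] ideal_norm_eq[OF place_ideal[OF p]] by metis
qed

section \<open>Absolute values and their product\<close>

abbreviation "nabs \<equiv> normalized_abs"

lemma normalized_abs_mult:
  assumes p: "p \<in> finite_places"
  shows "nabs p (x * y :: 'k) = nabs p x * nabs p y"
  using ideal_norm_ge_2[OF p]
  by (auto simp: normalized_abs_def prime_ord_mult[OF p] power_int_add[symmetric])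

lemma normalized_abs_pos: "p \<in> finite_places \<Longrightarrow> (x::'k) \<noteq> 0 \<Longrightarrow> nabs p x > 0"
  using ideal_norm_ge_2[of p] by (auto simp: normalized_abs_def intro!: zero_less_power_int)

lemma normalized_abs_nonneg: "nabs p (x::'k) \<ge> 0"
  by (auto simp: normalized_abs_def)

lemma normalized_abs_1: "p \<in> finite_places \<Longrightarrow> nabs p (1::'k) = 1"
  using normalized_abs_mult[of p 1 1] normalized_abs_pos[of p 1] by simp

lemma normalized_abs_le_1_iff:
  assumes p: "p \<in> finite_places" and x: "(x::'k) \<noteq> 0"
  shows "nabs p x \<le> 1 \<longleftrightarrow> prime_ord p x \<ge> 0"
proof
  have N: "real (ideal_norm p) > 1" using ideal_norm_ge_2[OF p] by simp
  assume le: "nabs p x \<le> 1"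
  show "prime_ord p x \<ge> 0"
  proof (rule ccontr)
    assume "\<not> prime_ord p x \<ge> 0"
    hence "real (ideal_norm p) powi (- prime_ord p x) > real (ideal_norm p) powi 0"
      using N by (intro power_int_strict_increasing) auto
    thus False using le x by (simp add: normalized_abs_def)
  qed
next
  assume ge: "prime_ord p x \<ge> 0"
  have "real (ideal_norm p) powi (- prime_ord p x) \<le> real (ideal_norm p) powi 0"
    using ge ideal_norm_ge_2[OF p] by (intro power_int_increasing) auto
  thus "nabs p x \<le> 1" using x by (simp add: normalized_abs_def)
qed

lemma normalized_abs_add:
  assumes p: "p \<in> finite_places"
  shows "nabs p (x + y :: 'k) \<le> max (nabs p x) (nabs p y)"
proof (cases "x = 0 \<or> y = 0 \<or> x + y = 0")
  case True
  thus ?thesis using normalized_abs_nonneg[of p x] by (auto simp: normalized_abs_def le_max_iff_disj)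
next
  case False
  have N: "real (ideal_norm p) \<ge> 1" using ideal_norm_ge_2[OF p] by simp
  have "- prime_ord p (x + y) \<le> - prime_ord p x \<or> - prime_ord p (x + y) \<le> - prime_ord p y"
    using prime_ord_add[OF p, of x y] False by (auto simp: min_def split: if_splits)
  thus ?thesis using False N
    by (auto simp: normalized_abs_def le_max_iff_disj intro!: power_int_increasing)
qed

lemma normalized_abs_minus:
  assumes p: "p \<in> finite_places"
  shows "nabs p (- x :: 'k) = nabs p x"
proof -
  have "nabs p (- 1 :: 'k) * nabs p (- 1 :: 'k) = 1"
    using normalized_abs_mult[OF p, of "- 1" "- 1"] normalized_abs_1[OF p] by simp
  hence "nabs p (- 1 :: 'k) = 1"
    using normalized_abs_nonneg[of p "- 1"] by (simp add: square_eq_1_iff)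
  thus ?thesis using normalized_abs_mult[OF p, of "- 1" x] by simp
qed

lemma finite_abs_support: "(x::'k) \<noteq> 0 \<Longrightarrow> finite {p \<in> finite_places. nabs p x \<noteq> 1}"
  by (rule finite_subset[OF _ finite_ord_support[of x]]) (auto simp: normalized_abs_def)

definition fin_abs :: "'k \<Rightarrow> real" where
  "fin_abs x = (\<Prod>p\<in>{p \<in> finite_places. nabs p x \<noteq> 1}. nabs p x)"

lemma fin_abs_eq:
  assumes "finite T" "T \<subseteq> finite_places" "\<And>p. p \<in> finite_places \<Longrightarrow> nabs p x \<noteq> 1 \<Longrightarrow> p \<in> T"
  shows "fin_abs x = (\<Prod>p\<in>T. nabs p x)"
  unfolding fin_abs_def using assms by (intro prod.mono_neutral_left) auto

lemma fin_abs_mult: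
  assumes "x \<noteq> 0" "y \<noteq> 0"
  shows "fin_abs (x * y) = fin_abs x * fin_abs y"
proof -
  define T where "T = {p \<in> finite_places. nabs p x \<noteq> 1} \<union> {p \<in> finite_places. nabs p y \<noteq> 1}"
  have T: "finite T" "T \<subseteq> finite_places" using finite_abs_support assms by (auto simp: T_def)
  have "fin_abs x = (\<Prod>p\<in>T. nabs p x)" "fin_abs y = (\<Prod>p\<in>T. nabs p y)"
    by (rule fin_abs_eq[OF T]; simp add: T_def)+
  moreover have "fin_abs (x * y) = (\<Prod>p\<in>T. nabs p (x * y))"
    by (rule fin_abs_eq[OF T]) (auto simp: T_def normalized_abs_mult)
  moreover have "(\<Prod>p\<in>T. nabs p (x * y)) = (\<Prod>p\<in>T. nabs p x * nabs p y)"
    using T(2) normalized_abs_mult by (intro prod.cong) auto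
  ultimately show ?thesis by (simp add: prod.distrib)
qed

lemma fin_abs_pos: "x \<noteq> 0 \<Longrightarrow> fin_abs x > 0"
  unfolding fin_abs_def using normalized_abs_pos by (intro prod_pos) auto

text \<open>Each normalised absolute value is the inverse of the corresponding factor in
  \<open>index_multiples\<close>.\<close>

lemma fin_abs_int:
  assumes a: "algebraic_int a" "a \<noteq> 0"
  shows "fin_abs a * card (residue_classes a) = 1"
proof -
  define S where "S = {p \<in> finite_places. a \<in> p}"
  have S: "finite S" "S \<subseteq> finite_places" unfolding S_def using finite_places_containing[OF a] by auto
  have "fin_abs a = (\<Prod>p\<in>S. nabs p a)"
  proof (rule fin_abs_eq[OF S])
    fix p assume p: "p \<in> finite_places" "nabs p a \<noteq> 1"
    hence "prime_ord p a \<noteq> 0" using a by (auto simp: normalized_abs_def)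
    thus "p \<in> S" using p a iord_mem[OF p(1) a] prime_ord_int[OF p(1) a] by (simp add: S_def)
  qed
  moreover have "real (card (residue_classes a)) = (\<Prod>p\<in>S. real (ideal_norm p) ^ iord p a)"
    using index_multiples[OF a S_def] by simp
  ultimately have "fin_abs a * card (residue_classes a) =
      (\<Prod>p\<in>S. nabs p a * real (ideal_norm p) ^ iord p a)"
    by (simp add: prod.distrib)
  also have "\<dots> = (\<Prod>p\<in>S. 1)"
  proof (rule prod.cong[OF refl])
    fix p assume "p \<in> S"
    hence p: "p \<in> finite_places" using S by auto
    have "real (ideal_norm p) > 0" using ideal_norm_ge_2[OF p] by simp
    thus "nabs p a * real (ideal_norm p) ^ iord p a = 1"
      using a prime_ord_int[OF p a] by (simp add: normalized_abs_def power_int_minus)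
  qed
  finally show ?thesis by simp
qed

text \<open>The absolute value of the field norm.\<close>

definition arch_abs :: "'k \<Rightarrow> real" where
  "arch_abs x = (\<Prod>\<sigma>\<in>E. cmod (\<sigma> x))"

lemma arch_abs_mult: "arch_abs (x * y) = arch_abs x * arch_abs y"
  unfolding arch_abs_def prod.distrib[symmetric]
  by (rule prod.cong) (auto simp: complex_embeddings_D(3) norm_mult)

lemma arch_abs_pos: "x \<noteq> 0 \<Longrightarrow> arch_abs x > 0"
  unfolding arch_abs_def by (intro prod_pos) (auto simp: complex_embeddings_D(9))

text \<open>The product of all absolute values is a homomorphism to the positive reals, so it is enough
  to bound it above: powers and inverses then force it to be 1.\<close>

lemma product_formula_bound:
  obtains C where "\<And>x. x \<noteq> 0 \<Longrightarrow> arch_abs x * fin_abs x \<le> C"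
proof -
  obtain C1 :: real where C1: "C1 > 0"
    "\<And>a::'k. algebraic_int a \<Longrightarrow> a \<noteq> 0 \<Longrightarrow>
      (\<Prod>\<sigma>\<in>E. cmod (\<sigma> a)) \<le> C1 * card (residue_classes a)"
    using norm_le_index by blast
  obtain C2 :: nat where C2:
    "\<forall>n>0. finite (residue_classes (of_nat n :: 'k)) \<and>
      card (residue_classes (of_nat n :: 'k)) \<le> C2 * n ^ deg"
    by (rule ints_mod_nat)
  have "arch_abs x * fin_abs x \<le> C1 * C2" if x: "x \<noteq> 0" for x
  proof -
    obtain a n where a: "algebraic_int a" "n > 0" "x = a / of_nat n" by (rule fraction)
    define b where "b = (of_nat n :: 'k)"
    have nz: "a \<noteq> 0" "b \<noteq> 0" "algebraic_int b" using a x by (auto simp: b_def)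
    let ?f = "\<lambda>a::'k. real (card (residue_classes a))"
    have xb: "x * b = a" using a(3) nz(2) by (simp add: b_def)
    have fa: "fin_abs a * ?f a = 1" by (rule fin_abs_int[OF a(1) nz(1)])
    have fb: "fin_abs b * ?f b = 1" by (rule fin_abs_int[OF nz(3,2)])
    have "arch_abs a * fin_abs a \<le> (C1 * ?f a) * fin_abs a"
      using C1(2)[OF a(1) nz(1)] fin_abs_pos[OF nz(1)] by (intro mult_right_mono) (auto simp: arch_abs_def)
    also have "\<dots> = C1 * (fin_abs a * ?f a)" by (simp add: mult_ac)
    also have "\<dots> = C1" using fa by simp
    finally have ub: "arch_abs a * fin_abs a \<le> C1" .
    \<comment> \<open>The denominator is a natural number, whose norm is exactly
      \<open>n ^ deg\<close>. The bound of \<open>ints_mod_nat\<close> then keeps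
      \<open>arch_abs b * fin_abs b\<close> away from 0, so dividing by \<open>b\<close> costs at
      most the factor \<open>C2\<close>.\<close>
    have "arch_abs b = (\<Prod>\<sigma>\<in>E. real n)"
      unfolding arch_abs_def b_def by (rule prod.cong) (auto simp: complex_embeddings_D(13))
    hence ab: "arch_abs b = real n ^ deg" by (simp add: card_embeddings)
    have "?f b \<le> real (C2 * n ^ deg)"
      unfolding b_def of_nat_le_iff using C2 a(2) by blast
    hence "?f b \<le> C2 * arch_abs b" unfolding ab by simp
    hence "fin_abs b * ?f b \<le> fin_abs b * (C2 * arch_abs b)"
      using fin_abs_pos[OF nz(2)] by (intro mult_left_mono) auto
    hence lb: "1 \<le> C2 * (arch_abs b * fin_abs b)" using fb by (simp add: mult_ac)
    have "arch_abs x * fin_abs x \<le> (arch_abs x * fin_abs x) * (C2 * (arch_abs b * fin_abs b))"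
      using mult_left_mono[OF lb, of "arch_abs x * fin_abs x"] arch_abs_pos[OF x] fin_abs_pos[OF x]
      by simp
    also have "\<dots> = C2 * (arch_abs (x * b) * fin_abs (x * b))"
      using x nz(2) by (simp add: arch_abs_mult fin_abs_mult mult_ac)
    also have "\<dots> \<le> C2 * C1" unfolding xb using ub by (intro mult_left_mono) auto
    finally show ?thesis by (simp add: mult.commute)
  qed
  thus ?thesis using that by blast
qed

theorem product_formula:
  assumes "(x::'k) \<noteq> 0"
  shows "arch_abs x * fin_abs x = 1"
proof -
  define \<phi> where "\<phi> x = arch_abs x * fin_abs x" for x
  obtain C where C: "\<And>x. x \<noteq> 0 \<Longrightarrow> \<phi> x \<le> C" using product_formula_bound unfolding \<phi>_def by blast
  have mult: "\<phi> (x * y) = \<phi> x * \<phi> y" if "x \<noteq> 0" "y \<noteq> 0" for x y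
    using that by (simp add: \<phi>_def arch_abs_mult fin_abs_mult mult_ac)
  have pos: "\<phi> x > 0" if "x \<noteq> 0" for x
    using that by (simp add: \<phi>_def arch_abs_pos fin_abs_pos)
  have one: "\<phi> 1 = 1" using mult[of 1 1] pos[of 1] by simp
  have le: "\<phi> x \<le> 1" if x: "x \<noteq> 0" for x
  proof (rule ccontr)
    assume "\<not> \<phi> x \<le> 1"
    then obtain n where "C < \<phi> x ^ n" using real_arch_pow[of "\<phi> x" C] by auto
    moreover have "\<phi> x ^ n = \<phi> (x ^ n)" by (induction n) (auto simp: one mult x)
    ultimately show False using C[of "x ^ n"] x by simp
  qed
  have "\<phi> x * \<phi> (inverse x) = 1" using mult[of x "inverse x"] assms one by simp
  moreover have "\<phi> x * \<phi> (inverse x) \<le> \<phi> x * 1"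
    using le[of "inverse x"] pos[OF assms] assms by (intro mult_left_mono) auto
  ultimately have "\<phi> x = 1" using le[OF assms] by simp
  thus ?thesis by (simp add: \<phi>_def)
qed

end

section \<open>Heights\<close>

lemma Max_mult_left:
  fixes f :: "'i \<Rightarrow> real"
  assumes "finite I" "I \<noteq> {}" "c \<ge> 0"
  shows "(MAX i\<in>I. c * f i) = c * (MAX i\<in>I. f i)"
proof -
  have "mono (\<lambda>x. c * x)" using assms(3) by (auto simp: mono_def mult_left_mono)
  from mono_Max_commute[OF this, of "f ` I"] show ?thesis
    using assms by (simp add: image_image)
qed

context primitive_gen
begin

definition loc_max :: "'i set \<Rightarrow> ('i \<Rightarrow> 'k) \<Rightarrow> 'k set \<Rightarrow> real" where
  "loc_max I x p = (MAX i\<in>I. nabs p (x i))"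

definition arch_max :: "'i set \<Rightarrow> ('i \<Rightarrow> 'k) \<Rightarrow> ('k \<Rightarrow> complex) \<Rightarrow> real" where
  "arch_max I x \<sigma> = (MAX i\<in>I. cmod (\<sigma> (x i)))"

definition arch_part :: "'i set \<Rightarrow> ('i \<Rightarrow> 'k) \<Rightarrow> real" where
  "arch_part I x = (\<Prod>\<sigma>\<in>E. arch_max I x \<sigma>)"

abbreviation loc_support :: "'i set \<Rightarrow> ('i \<Rightarrow> 'k) \<Rightarrow> 'k set set" where
  "loc_support I x \<equiv> {p\<in>finite_places. loc_max I x p \<noteq> 1}"

definition fin_part :: "'i set \<Rightarrow> ('i \<Rightarrow> 'k) \<Rightarrow> real" where
  "fin_part I x = (\<Prod>p\<in>loc_support I x. loc_max I x p)"

lemma weil_height_eq: "weil_height I x = (arch_part I x * fin_part I x) powr (1 / real deg)"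
  unfolding weil_height_def field_degree_eq arch_part_def fin_part_def arch_max_def loc_max_def
  by (subst prod_arch_places) simp

lemma arch_max_ge: "finite I \<Longrightarrow> i \<in> I \<Longrightarrow> cmod (\<sigma> (x i)) \<le> arch_max I x \<sigma>"
  unfolding arch_max_def by (intro Max_ge) auto

lemma loc_max_ge: "finite I \<Longrightarrow> i \<in> I \<Longrightarrow> nabs p (x i) \<le> loc_max I x p"
  unfolding loc_max_def by (intro Max_ge) auto

context
  fixes I :: "'i set" and x :: "'i \<Rightarrow> 'k" and i0 :: 'i
  assumes fin: "finite I" and i0: "i0 \<in> I" "x i0 \<noteq> 0"
begin

lemma arch_max_pos: "\<sigma> \<in> E \<Longrightarrow> arch_max I x \<sigma> > 0"
  using arch_max_ge[OF fin i0(1), of \<sigma> x] i0(2) complex_embeddings_D(9)[of \<sigma> "x i0"]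
  by (smt (verit) zero_less_norm_iff)

lemma loc_max_pos: "p \<in> finite_places \<Longrightarrow> loc_max I x p > 0"
  using loc_max_ge[OF fin i0(1), of p x] normalized_abs_pos[of p "x i0"] i0(2) by simp

lemma finite_loc_support: "finite (loc_support I x)"
proof (rule finite_subset)
  show "finite (\<Union>i\<in>{i\<in>I. x i \<noteq> 0}. {p\<in>finite_places. nabs p (x i) \<noteq> 1})"
    using fin finite_abs_support by auto
  show "loc_support I x
      \<subseteq> (\<Union>i\<in>{i\<in>I. x i \<noteq> 0}. {p\<in>finite_places. nabs p (x i) \<noteq> 1})"
  proof (rule subsetI, rule ccontr)
    fix p assume p: "p \<in> loc_support I x"
      and n: "p \<notin> (\<Union>i\<in>{i\<in>I. x i \<noteq> 0}. {p\<in>finite_places. nabs p (x i) \<noteq> 1})"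
    have 1: "nabs p (x i) = 1" if "i \<in> I" "x i \<noteq> 0" for i using n p that by blast
    have "loc_max I x p = 1" unfolding loc_max_def
    proof (rule Max_eqI)
      show "1 \<in> (\<lambda>i. nabs p (x i)) ` I" using 1[OF i0] i0(1) by force
      show "y \<le> 1" if "y \<in> (\<lambda>i. nabs p (x i)) ` I" for y
        using that 1 by (force simp: normalized_abs_def)
    qed (use fin in auto)
    thus False using p by simp
  qed
qed

text \<open>The support depends on the vector; passing to a common finite set of primes lets the
  finite parts of different vectors be compared factor by factor.\<close>

lemma fin_part_eq:
  assumes "finite T" "T \<subseteq> finite_places" "loc_support I x \<subseteq> T"
  shows "fin_part I x = (\<Prod>p\<in>T. loc_max I x p)"
  unfolding fin_part_def using assms by (intro prod.mono_neutral_left) auto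

lemma arch_part_pos: "arch_part I x > 0"
  unfolding arch_part_def by (intro prod_pos arch_max_pos) auto

lemma fin_part_pos: "fin_part I x > 0"
  unfolding fin_part_def by (intro prod_pos loc_max_pos) auto

lemma weil_height_power: "weil_height I x ^ deg = arch_part I x * fin_part I x"
proof -
  have "weil_height I x > 0"
    using arch_part_pos fin_part_pos by (simp add: weil_height_eq)
  hence "weil_height I x ^ deg = weil_height I x powr real deg" by (simp add: powr_realpow)
  also have "\<dots> = arch_part I x * fin_part I x"
    using arch_part_pos fin_part_pos deg_pos by (simp add: weil_height_eq powr_powr)
  finally show ?thesis .
qed

lemma weil_height_scale:
  assumes c: "c \<noteq> 0"
  shows "weil_height I (\<lambda>i. c * x i) = weil_height I x"
proof -
  have ne: "I \<noteq> {}" using i0 by auto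
  have A: "arch_part I (\<lambda>i. c * x i) = arch_abs c * arch_part I x"
    unfolding arch_part_def arch_abs_def prod.distrib[symmetric] arch_max_def
  proof (rule prod.cong[OF refl])
    fix \<sigma> assume s: "\<sigma> \<in> E"
    show "(MAX i\<in>I. cmod (\<sigma> (c * x i))) = cmod (\<sigma> c) * (MAX i\<in>I. cmod (\<sigma> (x i)))"
      using Max_mult_left[OF fin ne, of "cmod (\<sigma> c)" "\<lambda>i. cmod (\<sigma> (x i))"]
      by (simp add: complex_embeddings_D(3)[OF s] norm_mult)
  qed
  have L: "loc_max I (\<lambda>i. c * x i) p = nabs p c * loc_max I x p" if p: "p \<in> finite_places" for p
    unfolding loc_max_def
    using Max_mult_left[OF fin ne normalized_abs_nonneg[of p c], of "\<lambda>i. nabs p (x i)"]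
    by (simp add: normalized_abs_mult[OF p])
  define T where "T = loc_support I x \<union> {p \<in> finite_places. nabs p c \<noteq> 1}"
  have T: "finite T" "T \<subseteq> finite_places"
    using finite_loc_support finite_abs_support[OF c] by (auto simp: T_def)
  have "fin_part I (\<lambda>i. c * x i) = (\<Prod>p\<in>T. loc_max I (\<lambda>i. c * x i) p)"
    unfolding fin_part_def using T by (intro prod.mono_neutral_left) (auto simp: T_def L)
  also have "\<dots> = (\<Prod>p\<in>T. nabs p c * loc_max I x p)"
    using T(2) L by (intro prod.cong) auto
  also have "\<dots> = fin_abs c * fin_part I x"
  proof -
    have "fin_abs c = (\<Prod>p\<in>T. nabs p c)"
      by (rule fin_abs_eq[OF T]) (simp add: T_def)
    moreover have "fin_part I x = (\<Prod>p\<in>T. loc_max I x p)"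
      by (rule fin_part_eq[OF T]) (auto simp: T_def)
    ultimately show ?thesis by (simp add: prod.distrib)
  qed
  finally have "arch_part I (\<lambda>i. c * x i) * fin_part I (\<lambda>i. c * x i)
      = (arch_abs c * fin_abs c) * (arch_part I x * fin_part I x)"
    using A by (simp add: mult_ac)
  thus ?thesis using product_formula[OF c] by (simp add: weil_height_eq)
qed

end

text \<open>The height of the point [1 : a], raised to the degree of the field.\<close>

definition coord_height :: "'k \<Rightarrow> real" where
  "coord_height a = (\<Prod>\<sigma>\<in>E. max 1 (cmod (\<sigma> a))) *
     (\<Prod>p\<in>{p\<in>finite_places. nabs p a > 1}. nabs p a)"

lemma coord_height_le:
  assumes fin: "finite I" and i: "i \<in> I" "x i = 1" and j: "j \<in> I"
  shows "coord_height (x j) \<le> arch_part I x * fin_part I x"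
  unfolding coord_height_def
proof (rule mult_mono)
  have nz: "x i \<noteq> 0" using i by simp
  have "max 1 (cmod (\<sigma> (x j))) \<le> arch_max I x \<sigma>" if "\<sigma> \<in> E" for \<sigma>
    using arch_max_ge[OF fin i(1), of \<sigma> x] arch_max_ge[OF fin j, of \<sigma> x] i(2) complex_embeddings_D(1)[OF that]
    by simp
  thus "(\<Prod>\<sigma>\<in>E. max 1 (cmod (\<sigma> (x j)))) \<le> arch_part I x"
    unfolding arch_part_def by (intro prod_mono) auto
  show "arch_part I x \<ge> 0" using arch_part_pos[of I i x, OF fin i(1) nz] by simp
  let ?P = "{p\<in>finite_places. nabs p (x j) > 1}"
  let ?S = "loc_support I x"
  have S: "finite ?S" by (rule finite_loc_support[of I i x, OF fin i(1) nz])
  have PS: "?P \<subseteq> ?S" 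
  proof
    fix p assume "p \<in> ?P"
    thus "p \<in> ?S" using loc_max_ge[OF fin j, of p x] by simp
  qed
  have ge1: "loc_max I x p \<ge> 1" if "p \<in> finite_places" for p
    using loc_max_ge[OF fin i(1), of p x] i(2) normalized_abs_1[OF that] by simp
  have "(\<Prod>p\<in>?P. nabs p (x j)) \<le> (\<Prod>p\<in>?P. loc_max I x p)"
    using loc_max_ge[OF fin j, of _ x] normalized_abs_nonneg by (intro prod_mono) auto
  also have "\<dots> \<le> (\<Prod>p\<in>?S. loc_max I x p)"
    using ge1 by (intro prod_mono2 S PS) (auto intro: order_trans[OF zero_le_one])
  finally show "(\<Prod>p\<in>?P. nabs p (x j)) \<le> fin_part I x" by (simp add: fin_part_def)
  show "0 \<le> (\<Prod>p\<in>?P. nabs p (x j))" using normalized_abs_nonneg by (intro prod_nonneg) auto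
qed

text \<open>Two of the N(p) + 1 numbers from 0 to N(p) agree modulo \<open>p\<close>. The bound by
  N(p) keeps the common denominator in the finiteness proof below the height.\<close>

lemma small_nat_in_place:
  assumes p: "(p :: 'k set) \<in> finite_places"
  obtains n :: nat where "n > 0" "n \<le> ideal_norm p" "of_nat n \<in> p"
proof -
  interpret P: place \<theta> m p by (rule placeI[OF p])
  let ?h = "\<lambda>n::nat. (+) (of_nat n) ` p"
  have "\<not> inj_on ?h {..ideal_norm p}"
  proof
    assume "inj_on ?h {..ideal_norm p}"
    moreover have "?h ` {..ideal_norm p} \<subseteq> cosets alg_ints p" by (auto simp: cosets_def)
    ultimately have "card {..ideal_norm p} \<le> card (cosets alg_ints p)" using P.finite_residues card_inj_on_le by blast
    thus False using ideal_norm_eq[OF place_ideal[OF p]] by simp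
  qed
  then obtain i j where ij: "i \<le> ideal_norm p" "j \<le> ideal_norm p" "i < j" "?h i = ?h j"
    unfolding inj_on_def by (metis atMost_iff nat_neq_iff)
  have "of_nat j - of_nat i \<in> p" using ij(4) coset_eq_iff[OF P.idl(2)] by metis
  thus ?thesis using that[of "j - i"] ij by (simp add: of_nat_diff)
qed

text \<open>If \<open>coord_height a \<le> B\<close>, the denominators of \<open>a\<close> are cleared by an integer \<open>n \<le> B\<close>, and all
  conjugates of \<open>n a\<close> have absolute value at most \<open>B\<^sup>2\<close>.\<close>

lemma finite_coord_height: "finite {a. coord_height a \<le> B}"
proof -
  define U where "U = {y::'k. algebraic_int y \<and> (\<forall>\<sigma>\<in>E. cmod (\<sigma> y) \<le> B * B)}"
  have "{a. coord_height a \<le> B} \<subseteq> insert 0 ((\<lambda>(n, y). y / of_nat n) ` ({..nat \<lfloor>B\<rfloor>} \<times> U))"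
  proof
    fix a assume "a \<in> {a. coord_height a \<le> B}"
    hence h: "coord_height a \<le> B" by simp
    show "a \<in> insert 0 ((\<lambda>(n, y). y / of_nat n) ` ({..nat \<lfloor>B\<rfloor>} \<times> U))"
    proof (cases "a = 0")
      case False
      define P where "P = {p\<in>finite_places. nabs p a > 1}"
      have finP: "finite P"
        by (rule finite_subset[OF _ finite_abs_support[OF False]]) (auto simp: P_def)
      define A F where "A = (\<Prod>\<sigma>\<in>E. max 1 (cmod (\<sigma> a)))" and "F = (\<Prod>p\<in>P. nabs p a)"
      have AF: "A * F \<le> B" using h by (simp add: coord_height_def A_def F_def P_def)
      have A1: "A \<ge> 1" unfolding A_def by (intro prod_ge_1) auto
      have F1: "F \<ge> 1" unfolding F_def P_def by (intro prod_ge_1) auto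
      have AB: "A \<le> B" using mult_left_mono[OF F1, of A] A1 AF by linarith
      have FB: "F \<le> B" using mult_right_mono[OF A1, of F] F1 AF by linarith
      have "\<forall>p\<in>P. \<exists>n::nat. n > 0 \<and> n \<le> ideal_norm p \<and> of_nat n \<in> p"
        using small_nat_in_place by (metis (no_types, lifting) P_def mem_Collect_eq)
      then obtain k where k: "\<And>p. p \<in> P \<Longrightarrow> k p > 0 \<and> k p \<le> ideal_norm p \<and> of_nat (k p) \<in> p"
        by metis
      \<comment> \<open>The exponent is the pole order of \<open>a\<close> at \<open>p\<close>.
        Since \<open>k p\<close> lies in \<open>p\<close> and is at most N(p), its power
        \<open>k p ^ e p\<close> clears the pole and is at most \<open>nabs p a\<close>.\<close>
      define e where "e p = nat (- prime_ord p a)" for p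
      define n where "n = (\<Prod>p\<in>P. k p ^ e p)"
      have n0: "n > 0" unfolding n_def using k by (auto intro!: prod_pos)
      have "real n \<le> F" unfolding n_def F_def of_nat_prod
      proof (rule prod_mono, safe)
        fix p assume p: "p \<in> P"
        hence pf: "p \<in> finite_places" by (simp add: P_def)
        have "prime_ord p a < 0"
          using p normalized_abs_le_1_iff[OF pf False] by (auto simp: P_def)
        hence "nabs p a = real (ideal_norm p) ^ e p"
          using False by (simp add: normalized_abs_def e_def power_int_def)
        thus "real (k p ^ e p) \<le> nabs p a"
          using k[OF p] by (simp add: power_mono)
      qed auto
      hence nB: "real n \<le> B" using FB by simp
      have nnz: "(of_nat n :: 'k) \<noteq> 0" using n0 by simp
      have int: "algebraic_int (of_nat n * a)"
      proof (rule integral_if_ords_nonneg)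
        fix p :: "'k set" assume pf: "p \<in> finite_places"
        have split: "prime_ord p (of_nat n * a) = int (iord p (of_nat n :: 'k)) + prime_ord p a"
          using prime_ord_mult[OF pf nnz False] prime_ord_int[OF pf _ nnz] by simp
        show "prime_ord p (of_nat n * a) \<ge> 0"
        proof (cases "p \<in> P")
          case False
          hence "prime_ord p a \<ge> 0"
            using pf \<open>a \<noteq> 0\<close> normalized_abs_le_1_iff[OF pf, of a] by (auto simp: P_def)
          thus ?thesis using split by simp
        next
          case True
          define r where "r = (\<Prod>\<qq>\<in>P - {p}. k \<qq> ^ e \<qq>)"
          have nr: "n = k p ^ e p * r" unfolding n_def r_def by (rule prod.remove[OF finP True])
          have nz: "(of_nat (k p) :: 'k) \<noteq> 0" "(of_nat r :: 'k) \<noteq> 0" using nnz nr k[OF True] by auto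
          have "iord p (of_nat (k p) :: 'k) \<noteq> 0"
            using iord_mem[OF pf _ nz(1)] k[OF True] by simp
          hence "e p * 1 \<le> e p * iord p (of_nat (k p) :: 'k)" by (intro mult_le_mono2) simp
          also have "\<dots> \<le> iord p (of_nat n :: 'k)"
            using iord_mult[OF pf, of "of_nat (k p) ^ e p" "of_nat r"] iord_power[OF pf _ nz(1)] nz
            by (simp add: nr algebraic_int_power)
          finally show ?thesis unfolding split e_def by linarith
        qed
      qed (use False nnz in simp)
      have "cmod (\<sigma> (of_nat n * a)) \<le> B * B" if s: "\<sigma> \<in> E" for \<sigma>
      proof -
        have "max 1 (cmod (\<sigma> a)) \<le> A"
          unfolding A_def using s finite_embeddings
          by (subst prod.remove[of _ \<sigma>]) (auto intro!: mult_right_le_one_le prod_ge_1 simp: le_max_iff_disj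
              mult_le_cancel_left1)
        hence "cmod (\<sigma> a) \<le> B" using AB by simp
        hence "real n * cmod (\<sigma> a) \<le> B * B" using nB by (intro mult_mono) auto
        thus ?thesis by (simp add: complex_embeddings_D[OF s] norm_mult)
      qed
      hence "of_nat n * a \<in> U" using int by (simp add: U_def)
      moreover have "n \<in> {..nat \<lfloor>B\<rfloor>}" using nB by (simp add: le_nat_floor)
      moreover have "a = (of_nat n * a) / of_nat n" using nnz by simp
      ultimately show ?thesis by (intro insertI2 image_eqI[of _ _ "(n, of_nat n * a)"]) auto
    qed simp
  qed
  moreover have "finite U" unfolding U_def by (rule finite_bounded_ints)
  ultimately show ?thesis by (meson finite_SigmaI finite_atMost finite_imageI finite_insert finite_subset)
qed

text \<open>Dividing by a nonzero coordinate leaves the height unchanged and produces an entry 1,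
  after which every coordinate has bounded \<open>coord_height\<close>. The set \<open>T\<close>
  depends on \<open>B\<close> alone and serves all index sets of the type and all vectors at
  once.\<close>

theorem northcott:
  "\<exists>T. finite T \<and> (\<forall>(I :: 'i set) (x :: 'i \<Rightarrow> 'k) i j. finite I \<longrightarrow> i \<in> I \<longrightarrow> x i \<noteq> 0 \<longrightarrow> j \<in> I \<longrightarrow>
     weil_height I x \<le> B \<longrightarrow> x j / x i \<in> T)"
proof (intro exI conjI allI impI)
  show "finite {a. coord_height a \<le> B ^ deg}" by (rule finite_coord_height)
  fix I :: "'i set" and x :: "'i \<Rightarrow> 'k" and i j
  assume a: "finite I" "i \<in> I" "x i \<noteq> 0" "j \<in> I" "weil_height I x \<le> B"
  define z where "z = (\<lambda>l. inverse (x i) * x l)"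
  have z: "z i = 1" using a by (simp add: z_def)
  hence znz: "z i \<noteq> 0" by simp
  have "weil_height I z = weil_height I x"
    unfolding z_def using a(3) by (intro weil_height_scale[of I i x, OF a(1-3)]) simp
  moreover have "weil_height I z \<ge> 0" by (simp add: weil_height_eq)
  ultimately have "weil_height I z ^ deg \<le> B ^ deg" using a(5) by (intro power_mono) auto
  hence "coord_height (z j) \<le> B ^ deg"
    using coord_height_le[of I i z j, OF a(1,2) z a(4)] weil_height_power[of I i z, OF a(1,2) znz] by simp
  thus "x j / x i \<in> {a. coord_height a \<le> B ^ deg}" by (simp add: z_def divide_inverse mult.commute)
qed

end

section \<open>Lines through a point\<close>

hide_fact (open) Matrix.vec_eq_iff

section \<open>Points, lines and their Pluecker coordinates\<close>

lemma proj_point_span: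
  assumes "P \<in> proj_points"
  shows "homog_coords P \<noteq> 0" "P = vec.span {homog_coords P}"
proof -
  have P: "vec.subspace P" "vec.dim P = 1" using assms by (auto simp: proj_points_def)
  have "\<exists>x. x \<in> P \<and> x \<noteq> 0"
  proof (rule ccontr)
    assume "\<not> (\<exists>x. x \<in> P \<and> x \<noteq> 0)"
    hence "P \<subseteq> {0}" by blast
    thus False using P(2) vec.dim_eq_0[of P] by simp
  qed
  from someI_ex[OF this] have h: "homog_coords P \<in> P" "homog_coords P \<noteq> 0"
    by (auto simp: homog_coords_def)
  show "homog_coords P \<noteq> 0" by (rule h)
  have "vec.span {homog_coords P} \<subseteq> P" using h(1) P(1) by (simp add: vec.span_minimal)
  moreover have "vec.dim (vec.span {homog_coords P}) = 1"
    using vec.dim_eq_card_independent[of "{homog_coords P}"] h(2) by simp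
  ultimately show "P = vec.span {homog_coords P}"
    using vec.subspace_dim_equal[of "vec.span {homog_coords P}" P] P by simp
qed

lemma plucker_eq_0_dependent:
  fixes x y :: "'k::field ^ 'n::{finite, linorder}"
  assumes "\<And>ij. ij \<in> plucker_index \<Longrightarrow> plucker x y ij = 0"
  shows "vec.dim (vec.span {x, y}) \<le> 1"
proof -
  have eq: "x $ i * y $ j = x $ j * y $ i" for i j
    using assms[of "(i, j)"] assms[of "(j, i)"]
    by (cases i j rule: linorder_cases) (auto simp: plucker_index_def plucker_def)
  show ?thesis
  proof (cases "x = 0")
    case True
    have "vec.dim (vec.span {y}) \<le> card {y}" by (simp add: vec.dim_le_card')
    thus ?thesis using True by (simp add: vec.span_insert_0)
  next
    case False
    then obtain i where i: "x $ i \<noteq> 0" by (auto simp: vec_eq_iff)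
    have "y = (y $ i / x $ i) *s x"
      using eq[of _ i] i by (auto simp: vec_eq_iff field_simps)
    moreover have "(y $ i / x $ i) *s x \<in> vec.span {x}" by (intro vec.span_scale vec.span_base) simp
    ultimately have "y \<in> vec.span {x}" by simp
    hence "vec.span (insert y {x}) = vec.span {x}" by (rule vec.span_redundant)
    hence "vec.span {x, y} = vec.span {x}" by (simp add: insert_commute)
    thus ?thesis using vec.dim_le_card'[of "{x}"] by simp
  qed
qed

lemma plucker_comb:
  "plucker (a *s p + b *s q) (c *s p + d *s q) ij = (a * d - b * c) * plucker p q ij"
  by (cases ij) (simp add: plucker_def algebra_simps)

lemma span_pairE:
  fixes x p q :: "'k::field ^ 'n"
  assumes "x \<in> vec.span {p, q}"
  obtains a b where "x = a *s p + b *s q"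
proof -
  obtain a where "x - a *s p \<in> vec.span {q}" using assms vec.span_breakdown_eq by blast
  then obtain b where "x - a *s p - b *s q \<in> vec.span {}" using vec.span_breakdown_eq by blast
  thus ?thesis using that[of a b] by (simp add: algebra_simps)
qed

lemma plucker_same_span:
  fixes x y p q :: "'k::field ^ 'n::{finite, linorder}"
  assumes eq: "vec.span {x, y} = vec.span {p, q}" and dim: "vec.dim (vec.span {p, q}) = 2"
  obtains c where "c \<noteq> 0" "plucker x y = (\<lambda>ij. c * plucker p q ij)"
proof -
  have "x \<in> vec.span {p, q}" "y \<in> vec.span {p, q}"
    unfolding eq[symmetric] by (simp_all add: vec.span_base)
  then obtain a b c d where xy: "x = a *s p + b *s q" "y = c *s p + d *s q"
    using span_pairE by metis
  have pl: "plucker x y = (\<lambda>ij. (a * d - b * c) * plucker p q ij)"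
    unfolding xy by (rule ext) (rule plucker_comb)
  have "a * d - b * c \<noteq> 0"
  proof
    assume "a * d - b * c = 0"
    hence "vec.dim (vec.span {x, y}) \<le> 1" by (intro plucker_eq_0_dependent) (simp add: pl)
    thus False using eq dim by simp
  qed
  thus ?thesis using pl that by blast
qed

text \<open>Gives a name to the choice made inside \<open>plucker_height\<close>.\<close>

definition line_basis :: "('k::field ^ 'n) set \<Rightarrow> ('k ^ 'n) \<times> ('k ^ 'n)" where
  "line_basis L = (SOME (x, y). vec.span {x, y} = L)"

lemma line_basis:
  assumes "L \<in> proj_lines"
  shows "vec.span {fst (line_basis L), snd (line_basis L)} = L"
proof -
  have L: "vec.subspace L" "vec.dim L = 2" using assms by (auto simp: proj_lines_def)
  obtain B where B: "B \<subseteq> L" "vec.independent B" "L \<subseteq> vec.span B" "card B = vec.dim L"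
    using vec.basis_exists[of L] by blast
  then obtain x y where "B = {x, y}" using L(2) by (auto simp: card_2_iff)
  moreover have "vec.span B = L" using B L(1) by (simp add: vec.span_minimal subset_antisym)
  ultimately have "\<exists>xy. case xy of (x, y) \<Rightarrow> vec.span {x, y} = L" by auto
  from someI_ex[OF this] show ?thesis unfolding line_basis_def by (auto split: prod.splits)
qed

lemma plucker_height_eq:
  "plucker_height L = weil_height plucker_index (plucker (fst (line_basis L)) (snd (line_basis L)))"
  by (simp add: plucker_height_def line_basis_def Let_def case_prod_unfold)

lemma finite_plucker_index: "finite (plucker_index :: ('n::{finite, linorder} \<times> 'n) set)"
  by (rule finite)

lemma plucker_nonzero:
  fixes x y :: "'k::field ^ 'n::{finite, linorder}"
  assumes "vec.dim (vec.span {x, y}) = 2"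
  obtains ij where "ij \<in> plucker_index" "plucker x y ij \<noteq> 0"
  using plucker_eq_0_dependent[of x y] assms by fastforce

text \<open>Up to the common divisor, row \<open>i\<close> of the matrix of minors is x_i y - y_i x,
  a vector of the plane whose coordinate \<open>i\<close> vanishes. When the minor at (i, j) is
  nonzero, rows \<open>i\<close> and \<open>j\<close> span the plane, so ratios of Pluecker
  coordinates recover the line.\<close>

lemma span_plucker_rows:
  fixes x y :: "'k::field ^ 'n::{finite, linorder}"
  assumes nz: "plucker x y (i, j) \<noteq> 0"
  shows "vec.span {x, y} = vec.span {\<chi> l. plucker x y (i, l) / plucker x y (i, j),
    \<chi> l. plucker x y (j, l) / plucker x y (i, j)}" (is "_ = vec.span {?r, ?s}")
proof -
  define c where "c = plucker x y (i, j)"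
  have c: "c \<noteq> 0" "c = x $ i * y $ j - x $ j * y $ i" using nz by (auto simp: c_def plucker_def)
  have r: "?r = (x $ i / c) *s y - (y $ i / c) *s x" and s: "?s = (x $ j / c) *s y - (y $ j / c) *s x"
    unfolding c_def[symmetric]
    by (simp_all add: vec_eq_iff plucker_def diff_divide_distrib mult_ac)
  have "x = (x $ j) *s ?r - (x $ i) *s ?s" "y = (y $ j) *s ?r - (y $ i) *s ?s"
    using c(1) by (simp_all add: r s vec_eq_iff field_simps) (simp_all add: c(2) algebra_simps)
  hence "x \<in> vec.span {?r, ?s}" "y \<in> vec.span {?r, ?s}"
    by (metis insertCI vec.span_base vec.span_diff vec.span_scale)+
  moreover have "?r \<in> vec.span {x, y}" "?s \<in> vec.span {x, y}"
    unfolding r s by (intro vec.span_diff vec.span_scale vec.span_base; simp)+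
  ultimately show ?thesis
    by (intro subset_antisym vec.span_minimal vec.subspace_span) auto
qed

section \<open>Lines of bounded height and the height of a joining line\<close>

context primitive_gen
begin

lemma finite_lines_bounded_height:
  "finite {L \<in> proj_lines :: ('k ^ 'n::{finite, linorder}) set set. plucker_height L \<le> B}"
proof -
  obtain T :: "'k set" where T: "finite T"
    "\<forall>(I :: ('n \<times> 'n) set) (x :: 'n \<times> 'n \<Rightarrow> 'k) i j. finite I \<longrightarrow> i \<in> I \<longrightarrow> x i \<noteq> 0 \<longrightarrow> j \<in> I \<longrightarrow>
     weil_height I x \<le> B \<longrightarrow> x j / x i \<in> T"
    using northcott[where 'i = "'n \<times> 'n", of B] by blast
  \<comment> \<open>\<open>plucker_index\<close> only holds pairs with i < j. The other minors are
    negatives of these or zero, so \<open>T'\<close> contains the ratios for the whole antisymmetric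
    matrix.\<close>
  define T' where "T' = insert 0 (T \<union> uminus ` T)"
  define Z where "Z = PiE (UNIV :: ('n \<times> 'n) set) (\<lambda>_. T')"
  have finZ: "finite Z" unfolding Z_def T'_def using T(1) by (intro finite_PiE) auto
  define rec :: "('n \<times> 'n) \<times> ('n \<times> 'n \<Rightarrow> 'k) \<Rightarrow> ('k ^ 'n::{finite, linorder}) set" where
    "rec = (\<lambda>((i, j), z). vec.span {\<chi> l. z (i, l), \<chi> l. z (j, l)})"
  have "{L \<in> proj_lines. plucker_height L \<le> B} \<subseteq> rec ` (UNIV \<times> Z)"
  proof
    fix L :: "('k ^ 'n::{finite, linorder}) set" assume "L \<in> {L \<in> proj_lines. plucker_height L \<le> B}"
    hence L: "L \<in> proj_lines" "plucker_height L \<le> B" by auto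
    define x y where "x = fst (line_basis L)" and "y = snd (line_basis L)"
    have span: "vec.span {x, y} = L" using line_basis[OF L(1)] by (simp add: x_def y_def)
    have "vec.dim (vec.span {x, y}) = 2" using L(1) span by (simp add: proj_lines_def)
    then obtain ij where ij: "ij \<in> plucker_index" "plucker x y ij \<noteq> 0" by (rule plucker_nonzero)
    obtain i j where ijp: "ij = (i, j)" by (cases ij)
    have h: "weil_height plucker_index (plucker x y) \<le> B"
      using L(2) by (simp add: plucker_height_eq x_def y_def)
    define z where "z = (\<lambda>kl. plucker x y kl / plucker x y ij)"
    have zT: "z kl \<in> T" if "kl \<in> plucker_index" for kl
      unfolding z_def using T(2) finite_plucker_index ij that h by blast
    have "z (k, l) \<in> T'" for k l
    proof (cases k l rule: linorder_cases)
      case less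
      thus ?thesis using zT[of "(k, l)"] by (simp add: T'_def plucker_index_def)
    next
      case equal
      thus ?thesis by (simp add: T'_def z_def plucker_def)
    next
      case greater
      have "z (k, l) = - z (l, k)" by (simp add: z_def plucker_def diff_divide_distrib)
      moreover have "z (l, k) \<in> T" using zT[of "(l, k)"] greater by (simp add: plucker_index_def)
      ultimately show ?thesis by (simp add: T'_def)
    qed
    hence "z \<in> Z" by (auto simp: Z_def)
    moreover have "L = rec (ij, z)"
      using span_plucker_rows[of x y i j] ij(2) span by (simp add: rec_def z_def ijp)
    ultimately show "L \<in> rec ` (UNIV \<times> Z)" by blast
  qed
  moreover have "finite (rec ` (UNIV \<times> Z))" using finZ by simp
  ultimately show ?thesis by (rule finite_subset)
qed

lemma finite_arch_places: "finite (arch_places :: ('k \<Rightarrow> real) set)"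
  unfolding arch_places_def using finite_embeddings by simp

text \<open>In projective dimension 0 there are no pairs i < j, and the maximum over the empty set
  has no specified sign.\<close>

lemma local_dist_nonneg:
  fixes P Q :: "('k ^ 'n::{finite, linorder}) set"
  assumes "\<sigma> \<in> E" "(plucker_index :: ('n \<times> 'n) set) \<noteq> {}"
  shows "local_dist (\<lambda>x. cmod (\<sigma> x)) P Q \<ge> 0"
proof -
  have M: "(MAX i\<in>I. cmod (\<sigma> (x i))) \<ge> 0" if I: "finite I" "I \<noteq> {}" for I :: "'i set" and x
  proof -
    obtain i where "i \<in> I" using I by blast
    hence "cmod (\<sigma> (x i)) \<le> (MAX i\<in>I. cmod (\<sigma> (x i)))" using I(1) by (intro Max_ge) auto
    thus ?thesis using norm_ge_zero order_trans by blast
  qed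
  show ?thesis unfolding local_dist_def Let_def
    by (intro divide_nonneg_nonneg mult_nonneg_nonneg M assms(2)) auto
qed

lemma plucker_height_le:
  fixes P Q :: "('k ^ 'n::{finite, linorder}) set"
  assumes P: "P \<in> proj_points" and Q: "Q \<in> proj_points" and ne: "P \<noteq> Q"
  obtains L where "L \<in> proj_lines" "P \<in> points_of L" "Q \<in> points_of L"
    "plucker_height L \<le> point_height P * ((\<Sum>v\<in>arch_places. local_dist v P Q) * point_height Q)"
proof -
  define p q where "p = homog_coords P" and "q = homog_coords Q"
  have p: "p \<noteq> 0" "P = vec.span {p}" and q: "q \<noteq> 0" "Q = vec.span {q}"
    using proj_point_span[OF P] proj_point_span[OF Q] by (simp_all add: p_def q_def)
  define L where "L = vec.span {p, q}"
  have sub: "P \<subseteq> L" "Q \<subseteq> L" unfolding p(2) q(2) L_def by (intro vec.span_mono; blast)+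
  have "p \<notin> vec.span {q}"
  proof
    assume "p \<in> vec.span {q}"
    hence "P \<subseteq> Q" unfolding p(2) q(2) by (intro vec.span_minimal vec.subspace_span) simp
    thus False using vec.subspace_dim_equal[of P Q] P Q ne by (simp add: proj_points_def)
  qed
  hence "vec.independent {p, q}" "p \<noteq> q"
    using q(1) by (auto simp: vec.independent_insert vec.span_base)
  hence dim: "vec.dim L = 2"
    using vec.dim_eq_card_independent[of "{p, q}"] by (simp add: L_def)
  have L: "L \<in> proj_lines" using dim by (simp add: proj_lines_def L_def)
  have pts: "P \<in> points_of L" "Q \<in> points_of L" using P Q sub by (auto simp: points_of_def)
  define pl where "pl = plucker p q"
  obtain ij where ij: "ij \<in> plucker_index" "pl ij \<noteq> 0"
    using plucker_nonzero[of p q] dim by (auto simp: pl_def L_def)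
  have "vec.span {fst (line_basis L), snd (line_basis L)} = vec.span {p, q}"
    using line_basis[OF L] by (simp add: L_def)
  \<comment> \<open>The basis chosen inside \<open>plucker_height\<close> need not be
    \<open>p\<close> and \<open>q\<close>, but its minors are theirs times a nonzero determinant,
    and scaling leaves the height unchanged.\<close>
  then obtain c where c: "c \<noteq> 0"
    "plucker (fst (line_basis L)) (snd (line_basis L)) = (\<lambda>ij. c * pl ij)"
    using plucker_same_span dim unfolding L_def pl_def by metis
  have hL: "plucker_height L = weil_height plucker_index pl"
    unfolding plucker_height_eq c(2) by (rule weil_height_scale[of plucker_index ij pl c, OF finite_plucker_index ij c(1)])
  obtain i where i: "p $ i \<noteq> 0" using p(1) by (auto simp: vec_eq_iff)
  obtain j where j: "q $ j \<noteq> 0" using q(1) by (auto simp: vec_eq_iff)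
  define D where "D = (\<Sum>v\<in>arch_places. local_dist v P Q)"
  let ?p = "\<lambda>i. p $ i" and ?q = "\<lambda>i. q $ i"
  note ppos = arch_max_pos[of UNIV i ?p, OF finite UNIV_I i] loc_max_pos[of UNIV i ?p, OF finite UNIV_I i]
  note qpos = arch_max_pos[of UNIV j ?q, OF finite UNIV_I j] loc_max_pos[of UNIV j ?q, OF finite UNIV_I j]
  have distD: "local_dist (\<lambda>x. cmod (\<sigma> x)) P Q \<le> D" if s: "\<sigma> \<in> E" for \<sigma>
    unfolding D_def
  proof (rule member_le_sum[OF _ _ finite_arch_places])
    show "(\<lambda>x. cmod (\<sigma> x)) \<in> arch_places" using s by (auto simp: arch_places_def)
    show "local_dist v P Q \<ge> 0" if "v \<in> arch_places - {\<lambda>x. cmod (\<sigma> x)}" for v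
      using that local_dist_nonneg ij(1) by (auto simp: arch_places_def)
  qed
  have D0: "D \<ge> 0" unfolding D_def
    using local_dist_nonneg ij(1) by (intro sum_nonneg) (auto simp: arch_places_def)
  have "arch_max plucker_index pl \<sigma> \<le> D * (arch_max UNIV ?p \<sigma> * arch_max UNIV ?q \<sigma>)" if s: "\<sigma> \<in> E" for \<sigma>
  proof -
    have "arch_max plucker_index pl \<sigma> =
        local_dist (\<lambda>x. cmod (\<sigma> x)) P Q * (arch_max UNIV ?p \<sigma> * arch_max UNIV ?q \<sigma>)"
      using ppos(1)[OF s] qpos(1)[OF s]
      by (simp add: local_dist_def Let_def arch_max_def pl_def p_def q_def)
    also have "\<dots> \<le> D * (arch_max UNIV ?p \<sigma> * arch_max UNIV ?q \<sigma>)"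
      using distD[OF s] ppos(1)[OF s] qpos(1)[OF s] by (intro mult_right_mono) auto
    finally show ?thesis .
  qed
  hence "arch_part plucker_index pl \<le> (\<Prod>\<sigma>\<in>E. D * (arch_max UNIV ?p \<sigma> * arch_max UNIV ?q \<sigma>))"
    unfolding arch_part_def using arch_max_pos[of plucker_index ij pl, OF finite_plucker_index ij]
    by (intro prod_mono) (auto intro: less_imp_le)
  also have "\<dots> = D ^ deg * (arch_part UNIV ?p * arch_part UNIV ?q)"
    by (simp add: prod.distrib card_embeddings arch_part_def)
  finally have A: "arch_part plucker_index pl \<le> D ^ deg * (arch_part UNIV ?p * arch_part UNIV ?q)" .
  \<comment> \<open>The ultrametric inequality bounds the difference of two products by the larger
    one, so no factor 2 enters here.\<close>
  have Lq: "loc_max plucker_index pl \<pp> \<le> loc_max UNIV ?p \<pp> * loc_max UNIV ?q \<pp>"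
    if f: "\<pp> \<in> finite_places" for \<pp>
    unfolding loc_max_def[of plucker_index]
  proof (rule Max.boundedI)
    fix r assume "r \<in> (\<lambda>i. nabs \<pp> (pl i)) ` plucker_index"
    then obtain k l where r: "r = nabs \<pp> (p $ k * q $ l + - (p $ l * q $ k))"
      by (auto simp: pl_def plucker_def)
    have m: "nabs \<pp> (p $ k * q $ l) \<le> loc_max UNIV ?p \<pp> * loc_max UNIV ?q \<pp>" for k l
      unfolding normalized_abs_mult[OF f]
      using ppos(2)[OF f] normalized_abs_nonneg
      by (intro mult_mono loc_max_ge[of UNIV _ \<pp> ?p, simplified] loc_max_ge[of UNIV _ \<pp> ?q, simplified]) auto
    show "r \<le> loc_max UNIV ?p \<pp> * loc_max UNIV ?q \<pp>"
      unfolding r using normalized_abs_add[OF f, of "p $ k * q $ l" "- (p $ l * q $ k)"]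
        normalized_abs_minus[OF f, of "p $ l * q $ k"] m[of k l] m[of l k] by simp
  qed (use ij finite_plucker_index in auto)
  define S where "S = loc_support plucker_index pl \<union>
    loc_support UNIV ?p \<union> loc_support UNIV ?q"
  have S: "finite S" "S \<subseteq> finite_places"
    unfolding S_def
    using finite_loc_support[of plucker_index ij pl, OF finite_plucker_index ij]
      finite_loc_support[of UNIV i ?p, OF finite UNIV_I i] finite_loc_support[of UNIV j ?q, OF finite UNIV_I j]
    by auto
  have "fin_part plucker_index pl = (\<Prod>\<pp>\<in>S. loc_max plucker_index pl \<pp>)"
    by (rule fin_part_eq[of plucker_index ij pl, OF finite_plucker_index ij S]) (auto simp: S_def)
  also have "\<dots> \<le> (\<Prod>\<pp>\<in>S. loc_max UNIV ?p \<pp> * loc_max UNIV ?q \<pp>)"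
    using S(2) Lq loc_max_pos[of plucker_index ij pl, OF finite_plucker_index ij]
    by (intro prod_mono) (auto intro: less_imp_le)
  also have "\<dots> = fin_part UNIV ?p * fin_part UNIV ?q"
  proof -
    have "fin_part UNIV ?p = (\<Prod>\<pp>\<in>S. loc_max UNIV ?p \<pp>)"
      by (rule fin_part_eq[of UNIV i ?p, OF finite UNIV_I i S]) (auto simp: S_def)
    moreover have "fin_part UNIV ?q = (\<Prod>\<pp>\<in>S. loc_max UNIV ?q \<pp>)"
      by (rule fin_part_eq[of UNIV j ?q, OF finite UNIV_I j S]) (auto simp: S_def)
    ultimately show ?thesis by (simp add: prod.distrib)
  qed
  finally have F: "fin_part plucker_index pl \<le> fin_part UNIV ?p * fin_part UNIV ?q" .
  note pos = arch_part_pos[of UNIV i ?p, OF finite UNIV_I i] arch_part_pos[of UNIV j ?q, OF finite UNIV_I j]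
    fin_part_pos[of UNIV i ?p, OF finite UNIV_I i] fin_part_pos[of UNIV j ?q, OF finite UNIV_I j]
    fin_part_pos[of plucker_index ij pl, OF finite_plucker_index ij]
  have hP: "point_height P = weil_height UNIV ?p" "point_height Q = weil_height UNIV ?q"
    by (simp_all add: point_height_def p_def q_def)
  have "plucker_height L ^ deg = arch_part plucker_index pl * fin_part plucker_index pl"
    unfolding hL by (rule weil_height_power[of plucker_index ij pl, OF finite_plucker_index ij])
  also have "\<dots> \<le> (D ^ deg * (arch_part UNIV ?p * arch_part UNIV ?q)) * (fin_part UNIV ?p * fin_part UNIV ?q)"
    using A F pos D0 by (intro mult_mono) auto
  also have "\<dots> = D ^ deg * ((arch_part UNIV ?p * fin_part UNIV ?p) * (arch_part UNIV ?q * fin_part UNIV ?q))"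
    by (simp add: mult_ac)
  also have "\<dots> = (point_height P * (D * point_height Q)) ^ deg"
    unfolding hP weil_height_power[of UNIV i ?p, OF finite UNIV_I i, symmetric]
      weil_height_power[of UNIV j ?q, OF finite UNIV_I j, symmetric] power_mult_distrib by (simp add: mult_ac)
  finally have "plucker_height L ^ deg \<le> (point_height P * (D * point_height Q)) ^ deg" .
  moreover have "point_height P * (D * point_height Q) \<ge> 0"
    using D0 by (simp add: hP weil_height_eq)
  ultimately have "plucker_height L \<le> point_height P * (D * point_height Q)"
    using power_mono_iff[of "plucker_height L" "point_height P * (D * point_height Q)" deg] deg_pos
    by (simp add: hL weil_height_eq)
  thus ?thesis using that L pts by (simp add: D_def)
qed

end

theorem theorem2p1:
  fixes P :: "('k::field_char_0 ^ 'n::{finite, linorder}) set"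
  assumes "number_field TYPE('k)" and "P \<in> proj_points"
  shows "\<exists>N::real. \<forall>c>0.
    finite (lines_through_upto P (N * c)) \<and>
    (\<forall>Q :: nat \<Rightarrow> ('k ^ 'n::{finite, linorder}) set.
       (\<forall>i. Q i \<in> proj_points) \<longrightarrow>
       (\<forall>i. (\<Sum>v\<in>arch_places. local_dist v P (Q i)) * point_height (Q i) \<le> c) \<longrightarrow>
       (\<exists>i. Q i \<noteq> P) \<longrightarrow>
       range Q \<subseteq> (\<Union>L\<in>lines_through_upto P (N * c). points_of L))"
proof -
  obtain \<theta> :: 'k and m where "primitive_gen \<theta> m" by (rule primitive_gen_exists[OF assms(1)])
  then interpret primitive_gen \<theta> m .
  show ?thesis
  proof (intro exI allI impI conjI)
    fix c :: real
    let ?B = "point_height P * c"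
    show "finite (lines_through_upto P ?B)"
      by (rule finite_subset[OF _ finite_lines_bounded_height[of ?B]]) (auto simp: lines_through_upto_def)
    fix Q :: "nat \<Rightarrow> ('k ^ 'n::{finite, linorder}) set"
    assume Q: "\<forall>i. Q i \<in> proj_points" "\<exists>i. Q i \<noteq> P"
      and h: "\<forall>i. (\<Sum>v\<in>arch_places. local_dist v P (Q i)) * point_height (Q i) \<le> c"
    have line: "\<exists>L\<in>lines_through_upto P ?B. P \<in> points_of L \<and> Q i \<in> points_of L" if ne: "Q i \<noteq> P" for i
    proof -
      obtain L where L: "L \<in> proj_lines" "P \<in> points_of L" "Q i \<in> points_of L"
        "plucker_height L \<le> point_height P * ((\<Sum>v\<in>arch_places. local_dist v P (Q i)) * point_height (Q i))"
        using plucker_height_le[OF assms(2) spec[OF Q(1), of i]] ne by metis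
      have "point_height P \<ge> 0" by (simp add: point_height_def weil_height_eq)
      hence "plucker_height L \<le> ?B" using L(4) spec[OF h, of i] mult_left_mono order_trans by blast
      thus ?thesis using L by (auto simp: lines_through_upto_def)
    qed
    show "range Q \<subseteq> (\<Union>L\<in>lines_through_upto P ?B. points_of L)"
    proof
      fix R assume "R \<in> range Q"
      then obtain i where R: "R = Q i" by blast
      \<comment> \<open>A member equal to \<open>P\<close> lies on every line through
        \<open>P\<close>. The line joining \<open>P\<close> to some other member \<open>Q j\<close>
        shows that at least one such line satisfies the height bound.\<close>
      obtain j where j: "Q j \<noteq> P" using Q(2) by blast
      show "R \<in> (\<Union>L\<in>lines_through_upto P ?B. points_of L)"
        using line[of i] line[OF j] R by (cases "Q i = P") auto
    qed
  qed
qed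

end
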